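(* Let $p$ be a prime and $F$ a field containing a primitive $p$th root of unity $\xi_p$. The following are equivalent: (1) There exists $\sigma\in V_F\setminus\Phi(V_F)$ of order $p$. (2) There exists $\sigma\in W_F\setminus\Phi(W_F)$ of order $p$. (3) There exists $\sigma\in V_F\setminus\Phi(V_F)$ such that for each cyclic extension $E/F$ of degree $p$ its image $\sigma_{E/F}\in T_{E/F}$ has order at most $p$. (4) $p=2$ and $F$ is formally real. If these conditions hold, then (for $\sigma$ as in (1), (2) or (3)) the elements of $F$ whose square roots are fixed by $\sigma$ form an ordering of $F$.
   Context: Fix a separable closure of $F$. Define: $F^{(2)}$ is the compositum of all cyclic extensions of $F$ of degree $p$; $F^{(3)}$ is the compositum of all cyclic extensions of $F^{(2)}$ of degree $p$ which are Galois over $F$; ${F^{(2)}}^{(2)}$ is the compositum of all cyclic extensions of $F^{(2)}$ of degree $p$. Set $W_F=\mathrm{Gal}(F^{(3)}/F)$ and $V_F=\mathrm{Gal}({F^{(2)}}^{(2)}/F)$. For a cyclic extension $E/F$ of degree $p$, $T_{E/F}=G_F/G_E^p[G_E,G_E]=\mathrm{Gal}(E^{(2)}/F)$, where $G_F,G_E$ are absolute Galois groups, $G_E^p[G_E,G_E]$ is the closed subgroup generated by $p$th powers and commutators, and $E^{(2)}$ is the compositum of all cyclic extensions of $E$ of degree $p$; since $E^{(2)}\subset{F^{(2)}}^{(2)}$, restriction gives a map $V_F\to T_{E/F}$, $\sigma\mapsto\sigma_{E/F}$. $\Phi(\cdot)$ is the Frattini subgroup of a pro-$p$-group. An "ordering"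 of $F$ is identified with its set of positive (nonzero) elements, so the last assertion says $\{a\in F^\times:\sigma(\sqrt a)=\sqrt a\}$ is the set of positive elements of an ordering of $F$. *)

theory Defs
  imports "HOL-Algebra.Algebra" "HOL-Analysis.Abstract_Topology"
begin

text \<open>
  All fields are subfields of an ambient field \<open>L\<close>.  The definitions concerning roots of minimal
  polynomials are meant for \<open>L\<close> an algebraic closure of the base field, so that
  the roots in \<open>L\<close> are all the conjugates.  (The library's \<open>splitted_on\<close> is not
  used: it goes through \<open>mset_set\<close>, which is empty for infinite sets.)
\<close>

definition separable_over :: "('a, 'b) ring_scheme \<Rightarrow> 'a set \<Rightarrow> 'a \<Rightarrow> bool"
  where "separable_over L K x \<longleftrightarrow> (ring.algebraic L over K) x \<and>
    (\<forall>y. ring.is_root L (ring.Irr L K x) y \<longrightarrow> ring.alg_mult L (ring.Irr L K x) y = 1)"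

definition separable_closure :: "('a, 'b) ring_scheme \<Rightarrow> 'a set \<Rightarrow> 'a set"
  where "separable_closure L F = {x \<in> carrier L. separable_over L F x}"

definition galois_extension :: "('a, 'b) ring_scheme \<Rightarrow> 'a set \<Rightarrow> 'a set \<Rightarrow> bool"
  where "galois_extension L K E \<longleftrightarrow> subfield K L \<and> subfield E L \<and> K \<subseteq> E \<and>
    (\<forall>x\<in>E. separable_over L K x) \<and>
    (\<forall>x\<in>E. \<forall>y. ring.is_root L (ring.Irr L K x) y \<longrightarrow> y \<in> E)"

text \<open>Automorphisms are extensional functions on \<open>E\<close>, as in \<^const>\<open>BijGroup\<close>.\<close>

definition galois_group :: "('a, 'b) ring_scheme \<Rightarrow> 'a set \<Rightarrow> 'a set \<Rightarrow> ('a \<Rightarrow> 'a) monoid"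
  where "galois_group L K E = BijGroup E
    \<lparr>carrier := {\<sigma> \<in> Bij E. \<sigma> \<in> ring_hom (L\<lparr>carrier := E\<rparr>) (L\<lparr>carrier := E\<rparr>) \<and> (\<forall>x\<in>K. \<sigma> x = x)}\<rparr>"

text \<open>The cosets of \<open>Gal(E/M)\<close>, for \<open>M/K\<close> finite inside \<open>E\<close>, are a base of the Krull topology.\<close>

definition krull_topology :: "('a, 'b) ring_scheme \<Rightarrow> 'a set \<Rightarrow> 'a set \<Rightarrow> ('a \<Rightarrow> 'a) topology"
  where "krull_topology L K E = topology_generated_by
    {\<sigma> <#\<^bsub>galois_group L K E\<^esub> carrier (galois_group L M E) | \<sigma> M.
      \<sigma> \<in> carrier (galois_group L K E) \<and>
      subfield M L \<and> K \<subseteq> M \<and> M \<subseteq> E \<and> ring.finite_dimension L K M}"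

definition maximal_open_subgroup :: "('a, 'b) monoid_scheme \<Rightarrow> 'a topology \<Rightarrow> 'a set \<Rightarrow> bool"
  where "maximal_open_subgroup G T H \<longleftrightarrow> subgroup H G \<and> openin T H \<and> H \<noteq> carrier G \<and>
    (\<forall>H'. subgroup H' G \<and> H \<subseteq> H' \<longrightarrow> H' = H \<or> H' = carrier G)"

text \<open>Frattini subgroup of a profinite group; it is the whole group if there is no maximal open
  subgroup.\<close>

definition frattini :: "('a, 'b) monoid_scheme \<Rightarrow> 'a topology \<Rightarrow> 'a set"
  where "frattini G T = carrier G \<inter> \<Inter>{H. maximal_open_subgroup G T H}"

definition cyclic_extension :: "('a, 'b) ring_scheme \<Rightarrow> nat \<Rightarrow> 'a set \<Rightarrow> 'a set \<Rightarrow> bool"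
  where "cyclic_extension L p K E \<longleftrightarrow>
    galois_extension L K E \<and> cyclic_group (galois_group L K E) \<and> ring.dimension L p K E"

text \<open>\<open>K\<close> itself is thrown in so that the compositum of an empty family is \<open>K\<close>.\<close>

definition compositum :: "('a, 'b) ring_scheme \<Rightarrow> 'a set \<Rightarrow> 'a set set \<Rightarrow> 'a set"
  where "compositum L K \<E> = generate_field L (K \<union> \<Union>\<E>)"

text \<open>\<open>K\<^sup>(\<^sup>2\<^sup>)\<close>, formed in a fixed separable closure \<open>S\<close> of the base field.\<close>

definition second_ext :: "('a, 'b) ring_scheme \<Rightarrow> 'a set \<Rightarrow> nat \<Rightarrow> 'a set \<Rightarrow> 'a set"
  where "second_ext L S p K = compositum L K {E. E \<subseteq> S \<and> cyclic_extension L p K E}"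

definition third_ext :: "('a, 'b) ring_scheme \<Rightarrow> 'a set \<Rightarrow> nat \<Rightarrow> 'a set \<Rightarrow> 'a set"
  where "third_ext L S p F = compositum L (second_ext L S p F)
    {E. E \<subseteq> S \<and> cyclic_extension L p (second_ext L S p F) E \<and> galois_extension L F E}"

definition second_second_ext :: "('a, 'b) ring_scheme \<Rightarrow> 'a set \<Rightarrow> nat \<Rightarrow> 'a set \<Rightarrow> 'a set"
  where "second_second_ext L S p F = second_ext L S p (second_ext L S p F)"

definition W_group :: "('a, 'b) ring_scheme \<Rightarrow> nat \<Rightarrow> 'a set \<Rightarrow> ('a \<Rightarrow> 'a) monoid"
  where "W_group L p F = galois_group L F (third_ext L (separable_closure L F) p F)"

definition W_frattini :: "('a, 'b) ring_scheme \<Rightarrow> nat \<Rightarrow> 'a set \<Rightarrow> ('a \<Rightarrow> 'a) set"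
  where "W_frattini L p F =
    frattini (W_group L p F) (krull_topology L F (third_ext L (separable_closure L F) p F))"

definition V_group :: "('a, 'b) ring_scheme \<Rightarrow> nat \<Rightarrow> 'a set \<Rightarrow> ('a \<Rightarrow> 'a) monoid"
  where "V_group L p F = galois_group L F (second_second_ext L (separable_closure L F) p F)"

definition V_frattini :: "('a, 'b) ring_scheme \<Rightarrow> nat \<Rightarrow> 'a set \<Rightarrow> ('a \<Rightarrow> 'a) set"
  where "V_frattini L p F =
    frattini (V_group L p F) (krull_topology L F (second_second_ext L (separable_closure L F) p F))"

text \<open>\<open>T\<close> is realised as \<open>Gal(E\<^sup>(\<^sup>2\<^sup>)/F)\<close>, so that the map from the \<open>V\<close>-group is
  literally restriction.\<close>

definition T_group :: "('a, 'b) ring_scheme \<Rightarrow> nat \<Rightarrow> 'a set \<Rightarrow> 'a set \<Rightarrow> ('a \<Rightarrow> 'a) monoid"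
  where "T_group L p F E = galois_group L F (second_ext L (separable_closure L F) p E)"

definition T_restrict ::
    "('a, 'b) ring_scheme \<Rightarrow> nat \<Rightarrow> 'a set \<Rightarrow> 'a set \<Rightarrow> ('a \<Rightarrow> 'a) \<Rightarrow> ('a \<Rightarrow> 'a)"
  where "T_restrict L p F E \<sigma> = restrict \<sigma> (second_ext L (separable_closure L F) p E)"

definition formally_real :: "('a, 'b) ring_scheme \<Rightarrow> 'a set \<Rightarrow> bool"
  where "formally_real L F \<longleftrightarrow>
    (\<forall>(n::nat) x. x \<in> {..<n} \<rightarrow> F \<longrightarrow> finsum L (\<lambda>i. x i \<otimes>\<^bsub>L\<^esub> x i) {..<n} \<noteq> \<ominus>\<^bsub>L\<^esub> \<one>\<^bsub>L\<^esub>)"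

text \<open>\<open>P\<close> is the set of strictly positive elements of an ordering of the subfield \<open>F\<close>.\<close>

definition field_ordering :: "('a, 'b) ring_scheme \<Rightarrow> 'a set \<Rightarrow> 'a set \<Rightarrow> bool"
  where "field_ordering L F P \<longleftrightarrow> P \<subseteq> F - {\<zero>\<^bsub>L\<^esub>} \<and>
    (\<forall>a\<in>P. \<forall>b\<in>P. a \<oplus>\<^bsub>L\<^esub> b \<in> P \<and> a \<otimes>\<^bsub>L\<^esub> b \<in> P) \<and>
    (\<forall>a\<in>F - {\<zero>\<^bsub>L\<^esub>}. (a \<in> P) \<noteq> (\<ominus>\<^bsub>L\<^esub> a \<in> P))"

definition fixed_sqrts :: "('a, 'b) ring_scheme \<Rightarrow> 'a set \<Rightarrow> ('a \<Rightarrow> 'a) \<Rightarrow> 'a set"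
  where "fixed_sqrts L F \<sigma> =
    {a \<in> F - {\<zero>\<^bsub>L\<^esub>}. \<forall>s\<in>carrier L. s \<otimes>\<^bsub>L\<^esub> s = a \<longrightarrow> \<sigma> s = s}"

end

theory Submission
  imports Defs
begin

text \<open>
  Kummer theory identifies all the fields involved with root adjunctions, and the fixed field of the
  absolute automorphism group in the tower \<open>F \<subseteq> F^(2) \<subseteq> F^(2)^(2)\<close> is \<open>F\<close>, level by level.  In an
  extension of elementary abelian \<open>p\<close>-groups, a maximal open subgroup missing an element of the kernel
  is normal of index \<open>p\<close>, so it comes from a Kummer generator; hence \<open>\<sigma>\<close> outside the Frattini subgroup
  moves some \<open>\<alpha>\<close> with \<open>\<alpha>^p \<in> F\<close>.  If \<open>\<sigma>\<close> has order \<open>p\<close>, applying \<open>\<sigma>\<close> repeatedly to \<open>\<beta>\<close> with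
  \<open>\<beta>^p = \<alpha>\<close> multiplies it by \<open>\<zeta>\<close> after \<open>p\<close> steps unless \<open>p = 2\<close> and \<open>\<sigma>\<close> moves \<open>\<surd>-1\<close>.  For \<open>p = 2\<close> the
  elements with \<open>\<sigma>\<close>-fixed square roots form a subgroup of index \<open>2\<close> without \<open>-1\<close>, and it is closed under
  addition: if \<open>c\<close> lies in it and \<open>1 + c\<close> does not, then \<open>\<beta> = \<surd>(1 + \<surd>-c)\<close> satisfies \<open>\<sigma>\<^sup>2 \<beta> = -\<beta>\<close>.
  Conversely, for a maximal formally real subfield \<open>R \<supseteq> F\<close> of \<open>F^(2)^(2)\<close> one has \<open>F^(2)^(2) = R(\<surd>-1)\<close>, and
  \<open>\<sigma>\<close> is complex conjugation.
\<close>

subsection \<open>Extension of homomorphisms\<close>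

text \<open>Automorphisms of the layers are handled as restrictions of endomorphisms of
  \<open>L\<close> over the base, so iteration and passage between layers are plain operations on
  functions; extending maps from an intermediate field to \<open>L\<close> therefore has to come
  early. All three hypotheses on \<sigma> are reduced to one property of a lift,
  \<open>twist_free\<close>: its p-th iterate fixes certain roots built from an \<alpha> that it
  moves. The same roots serve every case, since over \<open>F2\<close> they generate extensions
  stable over \<open>F\<close>, and since their p-th powers lie in F(\<alpha>), which puts them into
  the field of a T-group. The parity of p enters through p(p - 1)/2, the exponent collected by
  iterating p times an eigenvalue that is itself an eigenvector; p divides it exactly when p is odd.
  The obstacle on the group side is that a maximal open subgroup is not known to be normal.
  Nilpotency of h - 1 on the kernel of restriction to \<open>F2\<close> overcomes it.\<close>

lemma map_poly_ring_hom:
  assumes "h \<in> ring_hom R S" "field R" "field S"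
  shows "map h \<in> ring_hom (poly_ring R) (poly_ring S)"
proof -
  interpret ring_hom_ring R S h
    using ring_hom_ringI2[OF assms(2-3)[THEN field.is_ring] assms(1)] .
  interpret Rf: field R by fact
  have carr: "set p \<subseteq> carrier R" if "p \<in> carrier (poly_ring R)" for p
    using that R.polynomial_incl unfolding sym[OF univ_poly_carrier] by auto
  \<comment> \<open>A field homomorphism is injective, so the leading coefficient stays nonzero and
    nothing is stripped.\<close>
  have norm: "S.normalize (map h p) = map h p" if "p \<in> carrier (poly_ring R)" for p
    using polynomial_hom[OF assms that] S.normalize_polynomial
    unfolding sym[OF univ_poly_carrier] by auto
  interpret RX: ring "poly_ring R" using Rf.univ_poly_is_ring[OF R.carrier_is_subring] .
  show ?thesis
  proof (rule ring_hom_memI)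
    fix p assume p: "p \<in> carrier (poly_ring R)"
    then show "map h p \<in> carrier (poly_ring S)" using polynomial_hom[OF assms] by auto
    fix q assume q: "q \<in> carrier (poly_ring R)"
    show "map h (p \<otimes>\<^bsub>poly_ring R\<^esub> q) = map h p \<otimes>\<^bsub>poly_ring S\<^esub> map h q"
      using poly_mult_hom'[OF carr[OF p] carr[OF q]] norm[OF RX.m_closed[OF p q]]
      by (simp add: univ_poly_mult)
    show "map h (p \<oplus>\<^bsub>poly_ring R\<^esub> q) = map h p \<oplus>\<^bsub>poly_ring S\<^esub> map h q"
      using poly_add_hom'[OF carr[OF p] carr[OF q]] norm[OF RX.a_closed[OF p q]]
      by (simp add: univ_poly_add)
  next
    show "map h \<one>\<^bsub>poly_ring R\<^esub> = \<one>\<^bsub>poly_ring S\<^esub>"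
      by (simp add: univ_poly_one)
  qed
qed

text \<open>M(x) is M[X] modulo the minimal polynomial of x. So g sends P(x) to (hP)(y) for a chosen
  P; two choices differ by a multiple of \<open>Irr M x\<close>, whose image under h vanishes at
  y.\<close>

lemma (in field) extend_hom_simple:
  assumes M: "subfield M R" and h: "h \<in> ring_hom (R\<lparr>carrier := M\<rparr>) R"
    and x: "x \<in> carrier R" "(algebraic over M) x"
    and y: "y \<in> carrier R" "eval (map h (Irr M x)) y = \<zero>"
  shows "\<exists>g\<in>ring_hom (R\<lparr>carrier := simple_extension M x\<rparr>) R. (\<forall>z\<in>M. g z = h z) \<and> g x = y"
proof -
  define \<phi> where "\<phi> P = eval (map h P) y" for P
  have sr: "subring M R" using subfieldE(1)[OF M] .
  interpret MX: ring "M[X]" using univ_poly_is_ring[OF sr] .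
  have mh: "map h \<in> ring_hom (M[X]) (poly_ring R)"
    using map_poly_ring_hom[OF h subfield_iff(2)[OF M] field_axioms] univ_poly_consistent[OF sr] by simp
  have "\<phi> \<in> ring_hom (M[X]) R"
    using ring_hom_trans[OF mh eval_is_hom[OF carrier_is_subring y(1)]] unfolding \<phi>_def comp_def .
  then interpret \<phi>: ring_hom_ring "M[X]" R \<phi>
    using ring_hom_ringI2[OF MX.ring_axioms ring_axioms] by simp
  interpret ev: ring_hom_ring "M[X]" R "\<lambda>p. eval p x"
    using eval_ring_hom[OF sr x(1)] .
  have irr: "Irr M x \<in> carrier (M[X])" "\<phi> (Irr M x) = \<zero>"
    using IrrE(1)[OF M x] y unfolding \<phi>_def by auto
  have wd: "\<phi> P = \<phi> Q" if PQ: "P \<in> carrier (M[X])" "Q \<in> carrier (M[X])" "eval P x = eval Q x" for P Q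
  proof -
    have "P \<ominus>\<^bsub>M[X]\<^esub> Q \<in> carrier (M[X])" "eval (P \<ominus>\<^bsub>M[X]\<^esub> Q) x = \<zero>"
      using PQ by (auto simp add: MX.minus_eq r_neg)
    then have "Irr M x divides\<^bsub>M[X]\<^esub> (P \<ominus>\<^bsub>M[X]\<^esub> Q)"
      using Irr_minimal[OF M x] pdivides_iff_shell[OF M irr(1)] by blast
    then obtain S where S: "S \<in> carrier (M[X])" "P \<ominus>\<^bsub>M[X]\<^esub> Q = Irr M x \<otimes>\<^bsub>M[X]\<^esub> S"
      unfolding factor_def by auto
    have "\<phi> (P \<ominus>\<^bsub>M[X]\<^esub> Q) = \<zero>"
      using S irr by simp
    then show ?thesis
      using PQ by (simp add: MX.minus_eq) (metis \<phi>.hom_closed minus_eq r_right_minus_eq)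
  qed
  define g where "g z = \<phi> (SOME P. P \<in> carrier (M[X]) \<and> eval P x = z)" for z
  have g: "g (eval P x) = \<phi> P" if "P \<in> carrier (M[X])" for P
    unfolding g_def
    by (rule wd) (use that someI[of "\<lambda>Q. Q \<in> carrier (M[X]) \<and> eval Q x = eval P x" P] in auto)
  have im: "simple_extension M x = (\<lambda>p. eval p x) ` carrier (M[X])"
    using simple_extension_as_eval_img[OF subfieldE(3)[OF M] x(1)] .
  have "g \<in> ring_hom (R\<lparr>carrier := simple_extension M x\<rparr>) R"
  proof (rule ring_hom_memI)
    fix a assume "a \<in> carrier (R\<lparr>carrier := simple_extension M x\<rparr>)"
    then obtain P where P: "P \<in> carrier (M[X])" "a = eval P x" using im by auto
    show "g a \<in> carrier R" using P g by simp
    fix b assume "b \<in> carrier (R\<lparr>carrier := simple_extension M x\<rparr>)"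
    then obtain Q where Q: "Q \<in> carrier (M[X])" "b = eval Q x" using im by auto
    show "g (a \<otimes>\<^bsub>R\<lparr>carrier := simple_extension M x\<rparr>\<^esub> b) = g a \<otimes> g b"
      using P Q g[of P] g[of Q] g[OF MX.m_closed[OF P(1) Q(1)]] by simp
    show "g (a \<oplus>\<^bsub>R\<lparr>carrier := simple_extension M x\<rparr>\<^esub> b) = g a \<oplus> g b"
      using P Q g[of P] g[of Q] g[OF MX.a_closed[OF P(1) Q(1)]] by simp
  next
    show "g \<one>\<^bsub>R\<lparr>carrier := simple_extension M x\<rparr>\<^esub> = \<one>"
      using g[OF MX.one_closed] by simp
  qed
  moreover have "g z = h z" if z: "z \<in> M" for z
  proof (cases "z = \<zero>")
    case True
    have "g \<zero> = \<phi> \<zero>\<^bsub>M[X]\<^esub>" using g[OF MX.zero_closed] by simp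
    moreover have "h \<zero> = \<zero>"
      using ring_hom_zero[OF h subring_is_ring[OF sr] ring_axioms] by simp
    ultimately show ?thesis using True by simp
  next
    case False
    have zc: "z \<in> carrier R" using z subfieldE(3)[OF M] by auto
    have "[z] \<in> carrier (M[X])"
      using z False unfolding sym[OF univ_poly_carrier] polynomial_def by auto
    moreover have "h z \<in> carrier R" using ring_hom_closed[OF h] z by simp
    ultimately show ?thesis using g[of "[z]"] zc y(1) by (simp add: \<phi>_def)
  qed
  moreover have "g x = y"
  proof -
    have "h \<one> = \<one>" using ring_hom_one[OF h] by simp
    moreover have "h \<zero> = \<zero>"
      using ring_hom_zero[OF h subring_is_ring[OF sr] ring_axioms] by simp
    ultimately show ?thesis
      using g[OF var_closed(1)[OF sr]] x y(1) unfolding \<phi>_def var_def by simp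
  qed
  ultimately show ?thesis by blast
qed

text \<open>Homomorphisms from subfields are represented by their graphs, so that Zorn's lemma applies to
  inclusion.\<close>

definition hom_graph :: "('a, 'b) ring_scheme \<Rightarrow> ('a \<times> 'a) set \<Rightarrow> bool"
  where "hom_graph L \<Gamma> \<longleftrightarrow> \<Gamma> \<subseteq> carrier L \<times> carrier L \<and> (\<one>\<^bsub>L\<^esub>, \<one>\<^bsub>L\<^esub>) \<in> \<Gamma> \<and>
    (\<forall>a b c d. (a, b) \<in> \<Gamma> \<longrightarrow> (c, d) \<in> \<Gamma> \<longrightarrow>
      (a \<oplus>\<^bsub>L\<^esub> c, b \<oplus>\<^bsub>L\<^esub> d) \<in> \<Gamma> \<and> (a \<otimes>\<^bsub>L\<^esub> c, b \<otimes>\<^bsub>L\<^esub> d) \<in> \<Gamma> \<and> (a = c \<longrightarrow> b = d)) \<and>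
    (\<forall>a b. (a, b) \<in> \<Gamma> \<longrightarrow> (\<ominus>\<^bsub>L\<^esub> a, \<ominus>\<^bsub>L\<^esub> b) \<in> \<Gamma> \<and> (a \<noteq> \<zero>\<^bsub>L\<^esub> \<longrightarrow> (inv\<^bsub>L\<^esub> a, inv\<^bsub>L\<^esub> b) \<in> \<Gamma>))"

lemma (in field) hom_graph_of_hom:
  assumes M: "subfield M R" and h: "h \<in> ring_hom (R\<lparr>carrier := M\<rparr>) R"
  shows "hom_graph R {(x, h x) | x. x \<in> M}"
proof -
  have sr: "subring M R" using subfieldE(1)[OF M] .
  interpret h: ring_hom_ring "R\<lparr>carrier := M\<rparr>" R h
    using ring_hom_ringI2[OF subring_is_ring[OF sr] ring_axioms h] .
  have Mc: "a \<in> carrier R" if "a \<in> M" for a using that subfieldE(3)[OF M] by auto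
  have hc: "h a \<in> carrier R" if "a \<in> M" for a using that h.hom_closed by simp
  have one: "h \<one> = \<one>" "\<one> \<in> M" using h.hom_one subringE(3)[OF sr] by auto
  have add: "h (a \<oplus> b) = h a \<oplus> h b" "h (a \<otimes> b) = h a \<otimes> h b" if "a \<in> M" "b \<in> M" for a b
    using h.hom_add h.hom_mult that by auto
  have neg: "h (\<ominus> a) = \<ominus> h a" if "a \<in> M" for a
  proof -
    have na: "\<ominus> a \<in> M" using subringE(5)[OF sr that] .
    have "h (\<ominus> a) \<oplus> h a = \<zero>"
      using add(1)[OF na that] Mc[OF that] h.hom_zero by (simp add: l_neg)
    then show ?thesis using minus_equality[of "h (\<ominus> a)" "h a"] hc that na by simp
  qed
  have inv: "h (inv a) = inv (h a)" "inv a \<in> M" if "a \<in> M" "a \<noteq> \<zero>" for a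
  proof -
    show ia: "inv a \<in> M" using subfield_m_inv(1)[OF M] that by blast
    have "h a \<otimes> h (inv a) = \<one>"
      using add(2)[OF that(1) ia] subfield_m_inv(2)[OF M, of a] that one by simp
    then show "h (inv a) = inv (h a)"
      using comm_inv_char[of "h a" "h (inv a)"] hc[OF that(1)] hc[OF ia] by simp
  qed
  show ?thesis
    unfolding hom_graph_def
  proof (intro conjI allI impI)
    show "{(x, h x) | x. x \<in> M} \<subseteq> carrier R \<times> carrier R" using Mc hc by auto
    show "(\<one>, \<one>) \<in> {(x, h x) | x. x \<in> M}" using one by auto
  next
    fix a b c d assume "(a, b) \<in> {(x, h x) | x. x \<in> M}" "(c, d) \<in> {(x, h x) | x. x \<in> M}"
    then have *: "a \<in> M" "b = h a" "c \<in> M" "d = h c" by auto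
    show "(a \<oplus> c, b \<oplus> d) \<in> {(x, h x) | x. x \<in> M}"
      using * add(1)[of a c] subringE(7)[OF sr, of a c] by auto
    show "(a \<otimes> c, b \<otimes> d) \<in> {(x, h x) | x. x \<in> M}"
      using * add(2)[of a c] subringE(6)[OF sr, of a c] by auto
    show "b = d" if "a = c" using * that by simp
  next
    fix a b assume "(a, b) \<in> {(x, h x) | x. x \<in> M}"
    then have *: "a \<in> M" "b = h a" by auto
    show "(\<ominus> a, \<ominus> b) \<in> {(x, h x) | x. x \<in> M}"
      using * neg[of a] subringE(5)[OF sr, of a] by auto
    show "(inv a, inv b) \<in> {(x, h x) | x. x \<in> M}" if "a \<noteq> \<zero>"
      using * inv[of a] that by auto
  qed
qed

lemma (in field) hom_of_hom_graph:
  assumes "hom_graph R \<Gamma>"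
  obtains M h where "subfield M R" "h \<in> ring_hom (R\<lparr>carrier := M\<rparr>) R" "\<Gamma> = {(x, h x) | x. x \<in> M}"
proof -
  have G: "a \<in> carrier R \<and> b \<in> carrier R" "(\<ominus> a, \<ominus> b) \<in> \<Gamma>" "a \<noteq> \<zero> \<Longrightarrow> (inv a, inv b) \<in> \<Gamma>"
    if "(a, b) \<in> \<Gamma>" for a b
    using assms that unfolding hom_graph_def by blast+
  have G2: "(a \<oplus> c, b \<oplus> d) \<in> \<Gamma>" "(a \<otimes> c, b \<otimes> d) \<in> \<Gamma>"
    if "(a, b) \<in> \<Gamma>" "(c, d) \<in> \<Gamma>" for a b c d
    using assms that unfolding hom_graph_def by blast+
  have G3: "b = d" if "(a, b) \<in> \<Gamma>" "(a, d) \<in> \<Gamma>" for a b d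
    using assms that unfolding hom_graph_def by blast
  have G1: "(\<one>, \<one>) \<in> \<Gamma>"
    using assms unfolding hom_graph_def by blast
  define h where "h x = (THE y. (x, y) \<in> \<Gamma>)" for x
  have uniq: "h x = y" if "(x, y) \<in> \<Gamma>" for x y
    unfolding h_def using that G3 by blast
  have eq: "\<Gamma> = {(x, h x) | x. x \<in> Domain \<Gamma>}"
    using uniq by auto
  have mem: "(a, h a) \<in> \<Gamma>" if "a \<in> Domain \<Gamma>" for a
    using that eq by auto
  have sub: "subfield (Domain \<Gamma>) R"
  proof (rule subfieldI')
    show "subring (Domain \<Gamma>) R"
    proof (rule subringI)
      show "Domain \<Gamma> \<subseteq> carrier R" using G(1) by blast
      show "\<one> \<in> Domain \<Gamma>" using G1 by blast
      show "\<ominus> a \<in> Domain \<Gamma>" if "a \<in> Domain \<Gamma>" for a using that G(2) by blast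
      show "a \<otimes> b \<in> Domain \<Gamma>" if "a \<in> Domain \<Gamma>" "b \<in> Domain \<Gamma>" for a b
        using G2(2)[OF mem mem] that by blast
      show "a \<oplus> b \<in> Domain \<Gamma>" if "a \<in> Domain \<Gamma>" "b \<in> Domain \<Gamma>" for a b
        using G2(1)[OF mem mem] that by blast
    qed
    show "inv k \<in> Domain \<Gamma>" if "k \<in> Domain \<Gamma> - {\<zero>}" for k
      using that G(3)[OF mem] by blast
  qed
  have "h \<in> ring_hom (R\<lparr>carrier := Domain \<Gamma>\<rparr>) R"
  proof (rule ring_hom_memI)
    fix a assume "a \<in> carrier (R\<lparr>carrier := Domain \<Gamma>\<rparr>)"
    then have a: "(a, h a) \<in> \<Gamma>" using mem by auto
    then show "h a \<in> carrier R" using G(1) by blast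
    fix b assume "b \<in> carrier (R\<lparr>carrier := Domain \<Gamma>\<rparr>)"
    then have b: "(b, h b) \<in> \<Gamma>" using mem by auto
    show "h (a \<otimes>\<^bsub>R\<lparr>carrier := Domain \<Gamma>\<rparr>\<^esub> b) = h a \<otimes> h b"
      using uniq[OF G2(2)[OF a b]] by simp
    show "h (a \<oplus>\<^bsub>R\<lparr>carrier := Domain \<Gamma>\<rparr>\<^esub> b) = h a \<oplus> h b"
      using uniq[OF G2(1)[OF a b]] by simp
  next
    show "h \<one>\<^bsub>R\<lparr>carrier := Domain \<Gamma>\<rparr>\<^esub> = \<one>" using uniq[OF G1] by simp
  qed
  then show thesis using that sub eq by blast
qed

text \<open>Each axiom of \<open>hom_graph\<close> mentions at most two pairs, and two pairs from a
  chain lie in a common member.\<close>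

lemma hom_graph_Union:
  assumes "\<C> \<noteq> {}" "subset.chain (Collect (hom_graph L)) \<C>"
  shows "hom_graph L (\<Union>\<C>)"
proof -
  have g: "hom_graph L \<Gamma>" if "\<Gamma> \<in> \<C>" for \<Gamma>
    using assms(2) that unfolding subset.chain_def by auto
  have common: "\<exists>\<Gamma>\<in>\<C>. u \<in> \<Gamma> \<and> v \<in> \<Gamma>" if "u \<in> \<Union>\<C>" "v \<in> \<Union>\<C>" for u v
    using assms(2) that unfolding subset_chain_def by blast
  show ?thesis
    unfolding hom_graph_def
  proof (intro conjI allI impI)
    show "\<Union>\<C> \<subseteq> carrier L \<times> carrier L" using g unfolding hom_graph_def by blast
    show "(\<one>\<^bsub>L\<^esub>, \<one>\<^bsub>L\<^esub>) \<in> \<Union>\<C>" using g assms(1) unfolding hom_graph_def by blast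
  next
    fix a b c d assume "(a, b) \<in> \<Union>\<C>" "(c, d) \<in> \<Union>\<C>"
    then obtain \<Gamma> where \<Gamma>: "\<Gamma> \<in> \<C>" "(a, b) \<in> \<Gamma>" "(c, d) \<in> \<Gamma>" using common by blast
    have "(a \<oplus>\<^bsub>L\<^esub> c, b \<oplus>\<^bsub>L\<^esub> d) \<in> \<Gamma>" "(a \<otimes>\<^bsub>L\<^esub> c, b \<otimes>\<^bsub>L\<^esub> d) \<in> \<Gamma>" "a = c \<longrightarrow> b = d"
      using g[OF \<Gamma>(1)] \<Gamma>(2,3) unfolding hom_graph_def by blast+
    then show "(a \<oplus>\<^bsub>L\<^esub> c, b \<oplus>\<^bsub>L\<^esub> d) \<in> \<Union>\<C>" "(a \<otimes>\<^bsub>L\<^esub> c, b \<otimes>\<^bsub>L\<^esub> d) \<in> \<Union>\<C>" "a = c \<Longrightarrow> b = d"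
      using \<Gamma>(1) by blast+
  next
    fix a b assume "(a, b) \<in> \<Union>\<C>"
    then obtain \<Gamma> where \<Gamma>: "\<Gamma> \<in> \<C>" "(a, b) \<in> \<Gamma>" by blast
    have "(\<ominus>\<^bsub>L\<^esub> a, \<ominus>\<^bsub>L\<^esub> b) \<in> \<Gamma>" "a \<noteq> \<zero>\<^bsub>L\<^esub> \<longrightarrow> (inv\<^bsub>L\<^esub> a, inv\<^bsub>L\<^esub> b) \<in> \<Gamma>"
      using g[OF \<Gamma>(1)] \<Gamma>(2) unfolding hom_graph_def by blast+
    then show "(\<ominus>\<^bsub>L\<^esub> a, \<ominus>\<^bsub>L\<^esub> b) \<in> \<Union>\<C>" "a \<noteq> \<zero>\<^bsub>L\<^esub> \<Longrightarrow> (inv\<^bsub>L\<^esub> a, inv\<^bsub>L\<^esub> b) \<in> \<Union>\<C>"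
      using \<Gamma>(1) by blast+
  qed
qed

lemma (in algebraically_closed) poly_has_root:
  assumes "P \<in> carrier (poly_ring L)" "degree P \<ge> 1"
  shows "\<exists>y\<in>carrier L. eval P y = \<zero>"
proof -
  have "size (roots P) \<ge> 1" using roots_over_carrier[OF assms(1)] assms(2) unfolding splitted_def by simp
  then obtain y where "y \<in># roots P" by (metis multiset_nonemptyE not_one_le_zero size_empty)
  then show ?thesis using roots_mem_iff_is_root[OF assms(1)] unfolding is_root_def by blast
qed

text \<open>On a maximal extension, with domain E, any x is still algebraic because K \<subseteq> E.
  The transported minimal polynomial of x has a root in \<open>L\<close>, so the map extends to
  E(x), and maximality puts x into E.\<close>

lemma (in algebraic_closure) extend_hom:
  assumes M: "subfield M L" and KM: "K \<subseteq> M" and h: "h \<in> ring_hom (L\<lparr>carrier := M\<rparr>) L"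
  obtains g where "g \<in> ring_hom L L" "\<And>z. z \<in> M \<Longrightarrow> g z = h z"
proof -
  define \<Gamma>0 where "\<Gamma>0 = {(x, h x) | x. x \<in> M}"
  define A where "A = {\<Gamma>. hom_graph L \<Gamma> \<and> \<Gamma>0 \<subseteq> \<Gamma>}"
  have "\<Gamma>0 \<in> A" using hom_graph_of_hom[OF M h] unfolding \<Gamma>0_def A_def by auto
  then have "\<exists>\<Gamma>\<in>A. \<forall>Y\<in>A. \<Gamma> \<subseteq> Y \<longrightarrow> Y = \<Gamma>"
  proof (intro subset_Zorn_nonempty)
    show "A \<noteq> {}" using \<open>\<Gamma>0 \<in> A\<close> by blast
    fix \<C> assume C: "\<C> \<noteq> {}" "subset.chain A \<C>"
    then have "subset.chain (Collect (hom_graph L)) \<C>" unfolding A_def subset.chain_def by blast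
    moreover have "\<Gamma>0 \<subseteq> \<Union>\<C>" using C unfolding A_def subset.chain_def by blast
    ultimately show "\<Union>\<C> \<in> A" using hom_graph_Union[OF C(1)] unfolding A_def by blast
  qed
  then obtain \<Gamma> where "\<Gamma> \<in> A" and mx: "\<forall>Y\<in>A. \<Gamma> \<subseteq> Y \<longrightarrow> Y = \<Gamma>" by (elim bexE)
  then have \<Gamma>: "hom_graph L \<Gamma>" "\<Gamma>0 \<subseteq> \<Gamma>" by (simp_all add: A_def)
  have max: "Y = \<Gamma>" if "hom_graph L Y" "\<Gamma> \<subseteq> Y" for Y
  proof -
    have "Y \<in> A" using that(1) subset_trans[OF \<Gamma>(2) that(2)] by (simp add: A_def)
    then show ?thesis using mx that(2) by (elim ballE[where x = Y]) simp_all
  qed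
  obtain E g where E: "subfield E L" and g: "g \<in> ring_hom (L\<lparr>carrier := E\<rparr>) L"
    and eq: "\<Gamma> = {(x, g x) | x. x \<in> E}"
    using hom_of_hom_graph[OF \<Gamma>(1)] .
  have ME: "z \<in> E \<and> g z = h z" if "z \<in> M" for z
  proof -
    have "(z, h z) \<in> \<Gamma>0" unfolding \<Gamma>0_def using that by blast
    then have "(z, h z) \<in> \<Gamma>" using \<Gamma>(2) by blast
    then show ?thesis using eq by auto
  qed
  have "x \<in> E" if x: "x \<in> carrier L" for x
  proof -
    have alg: "(algebraic over E) x"
      using algebraic_mono[of K E] algebraic_extension[OF x] KM ME by blast
    have irr: "Irr E x \<in> carrier (E[X])" using IrrE(1)[OF E x alg] .
    have mirr: "map g (Irr E x) \<in> carrier (poly_ring L)"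
      using polynomial_hom[OF g subfield_iff(2)[OF E] field_axioms] irr
        univ_poly_consistent[OF subfieldE(1)[OF E]] by simp
    have "degree (map g (Irr E x)) \<ge> 1"
      using pirreducible_degree[OF E irr IrrE(2)[OF E x alg]] by simp
    then obtain y where y: "y \<in> carrier L" "eval (map g (Irr E x)) y = \<zero>"
      using poly_has_root[OF mirr] by blast
    obtain g' where g': "g' \<in> ring_hom (L\<lparr>carrier := simple_extension E x\<rparr>) L"
      "\<forall>z\<in>E. g' z = g z" "g' x = y"
      using extend_hom_simple[OF E g x alg y] by blast
    have sE: "subfield (simple_extension E x) L" using simple_extension_is_subfield[OF E x] alg by simp
    have "\<Gamma> \<subseteq> {(z, g' z) | z. z \<in> simple_extension E x}"
    proof
      fix u assume "u \<in> \<Gamma>"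
      then obtain z where "z \<in> E" "u = (z, g z)" using eq by auto
      then show "u \<in> {(z, g' z) | z. z \<in> simple_extension E x}"
        using g'(2) simple_extension_incl[OF subfieldE(3)[OF E] x] by auto
    qed
    then have "{(z, g' z) | z. z \<in> simple_extension E x} = \<Gamma>"
      using max[OF hom_graph_of_hom[OF sE g'(1)]] by simp
    moreover have "(x, g' x) \<in> {(z, g' z) | z. z \<in> simple_extension E x}"
      using simple_extension_mem[OF subfieldE(1)[OF E] x] by auto
    ultimately show "x \<in> E" using eq by auto
  qed
  then have "E = carrier L" using subfieldE(3)[OF E] by blast
  then have "g \<in> ring_hom L L" using g unfolding ring_hom_def by simp
  then show thesis using that ME by blast
qed

subsection \<open>Homomorphisms over a subfield and Galois groups\<close>

text \<open>Stands in for the absolute Galois group of K. The maps are neither extensional nor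
  required to be bijective, so ordinary composition and \<open>funpow\<close> apply; bijectivity on
  normal subextensions is recovered in \<open>stable_image\<close>.\<close>

definition hom_over :: "('a, 'b) ring_scheme \<Rightarrow> 'a set \<Rightarrow> ('a \<Rightarrow> 'a) set"
  where "hom_over L K = {h \<in> ring_hom L L. \<forall>x\<in>K. h x = x}"

text \<open>Normality expressed by endomorphisms instead of roots of minimal polynomials;
  \<open>galois_stable\<close> and \<open>galois_if_stable\<close> translate between the
  two.\<close>

definition stable_over :: "('a, 'b) ring_scheme \<Rightarrow> 'a set \<Rightarrow> 'a set \<Rightarrow> bool"
  where "stable_over L K E \<longleftrightarrow> (\<forall>h\<in>hom_over L K. h ` E \<subseteq> E)"

lemma hom_overD: "h \<in> hom_over L K \<Longrightarrow> h \<in> ring_hom L L" "h \<in> hom_over L K \<Longrightarrow> x \<in> K \<Longrightarrow> h x = x"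
  unfolding hom_over_def by auto

lemma hom_over_mono: "K \<subseteq> K' \<Longrightarrow> hom_over L K' \<subseteq> hom_over L K"
  unfolding hom_over_def by auto

lemma stable_overD: "stable_over L K E \<Longrightarrow> h \<in> hom_over L K \<Longrightarrow> x \<in> E \<Longrightarrow> h x \<in> E"
  unfolding stable_over_def by blast

lemma hom_over_comp: "g \<in> hom_over L K \<Longrightarrow> h \<in> hom_over L K \<Longrightarrow> g \<circ> h \<in> hom_over L K"
  unfolding hom_over_def using ring_hom_trans by auto

lemma hom_over_funpow: "h \<in> hom_over L K \<Longrightarrow> h ^^ n \<in> hom_over L K"
proof (induct n)
  case 0
  have "id \<in> ring_hom L L" by (rule ring_hom_memI) auto
  then show ?case by (auto simp: hom_over_def id_def)
next
  case (Suc n) then show ?case using hom_over_comp by (metis funpow.simps(2))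
qed

lemma id_hom_over: "id \<in> hom_over L K"
  using ring_hom_memI[of L id L] by (auto simp: hom_over_def)

lemma (in field) self_hom:
  assumes h: "h \<in> ring_hom R R"
  shows "\<And>x. x \<in> carrier R \<Longrightarrow> h x \<in> carrier R" "h \<zero> = \<zero>" "h \<one> = \<one>"
    and "\<And>x y. x \<in> carrier R \<Longrightarrow> y \<in> carrier R \<Longrightarrow> h (x \<oplus> y) = h x \<oplus> h y"
    and "\<And>x y. x \<in> carrier R \<Longrightarrow> y \<in> carrier R \<Longrightarrow> h (x \<otimes> y) = h x \<otimes> h y"
    and "\<And>x. x \<in> carrier R \<Longrightarrow> h (\<ominus> x) = \<ominus> h x"
    and "\<And>x n. x \<in> carrier R \<Longrightarrow> h (x [^] (n::nat)) = h x [^] n"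
    and "\<And>x. x \<in> carrier R \<Longrightarrow> x \<noteq> \<zero> \<Longrightarrow> h (inv x) = inv (h x)"
    and "inj_on h (carrier R)"
    and "\<And>x. x \<in> carrier R \<Longrightarrow> h x = \<zero> \<longleftrightarrow> x = \<zero>"
proof -
  interpret h: ring_hom_cring R R h
    using h by unfold_locales
  show c: "\<And>x. x \<in> carrier R \<Longrightarrow> h x \<in> carrier R" and "h \<zero> = \<zero>" and one: "h \<one> = \<one>"
    "\<And>x y. x \<in> carrier R \<Longrightarrow> y \<in> carrier R \<Longrightarrow> h (x \<oplus> y) = h x \<oplus> h y"
    and m: "\<And>x y. x \<in> carrier R \<Longrightarrow> y \<in> carrier R \<Longrightarrow> h (x \<otimes> y) = h x \<otimes> h y"
    and "\<And>x. x \<in> carrier R \<Longrightarrow> h (\<ominus> x) = \<ominus> h x"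
    by auto
  show "h (x [^] (n::nat)) = h x [^] n" if "x \<in> carrier R" for x n
    using that by (induct n) (auto simp: one m)
  show inj: "inj_on h (carrier R)"
    using non_trivial_field_hom_is_inj[OF h field_axioms field_axioms] .
  show "h x = \<zero> \<longleftrightarrow> x = \<zero>" if "x \<in> carrier R" for x
    using inj that h.hom_zero unfolding inj_on_def by (metis zero_closed)
  show "h (inv x) = inv (h x)" if "x \<in> carrier R" "x \<noteq> \<zero>" for x
  proof -
    have u: "x \<in> Units R" using that field_Units by blast
    then have "h x \<otimes> h (inv x) = \<one>" using m[of x "inv x"] that one by simp
    then show ?thesis using comm_inv_char[of "h x" "h (inv x)"] c that u by simp
  qed
qed

lemma (in field) subfield_props:
  assumes "subfield E R"
  shows "E \<subseteq> carrier R" "\<zero> \<in> E" "\<one> \<in> E"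
    and "\<And>x y. x \<in> E \<Longrightarrow> y \<in> E \<Longrightarrow> x \<oplus> y \<in> E"
    and "\<And>x y. x \<in> E \<Longrightarrow> y \<in> E \<Longrightarrow> x \<otimes> y \<in> E"
    and "\<And>x. x \<in> E \<Longrightarrow> \<ominus> x \<in> E"
    and "\<And>x y. x \<in> E \<Longrightarrow> y \<in> E \<Longrightarrow> x \<ominus> y \<in> E"
    and "\<And>x. x \<in> E \<Longrightarrow> x \<noteq> \<zero> \<Longrightarrow> inv x \<in> E"
    and "\<And>x n. x \<in> E \<Longrightarrow> x [^] (n::nat) \<in> E"
proof -
  note sr = subfieldE(1)[OF assms]
  show "E \<subseteq> carrier R" "\<zero> \<in> E" and one: "\<one> \<in> E"
    and a: "\<And>x y. x \<in> E \<Longrightarrow> y \<in> E \<Longrightarrow> x \<oplus> y \<in> E"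
    and m: "\<And>x y. x \<in> E \<Longrightarrow> y \<in> E \<Longrightarrow> x \<otimes> y \<in> E"
    and n: "\<And>x. x \<in> E \<Longrightarrow> \<ominus> x \<in> E"
    using subringE[OF sr] by auto
  show "\<And>x y. x \<in> E \<Longrightarrow> y \<in> E \<Longrightarrow> x \<ominus> y \<in> E" using a n by (simp add: minus_eq)
  show "\<And>x. x \<in> E \<Longrightarrow> x \<noteq> \<zero> \<Longrightarrow> inv x \<in> E" using subfield_m_inv(1)[OF assms] by blast
  show "x [^] n \<in> E" if "x \<in> E" for x and n :: nat using that by (induct n) (auto simp: one m)
qed

lemma (in field) subfield_mult_cancel:
  assumes "subfield E R" "x \<in> E" "x \<noteq> \<zero>" "y \<in> carrier R" "x \<otimes> y \<in> E"
  shows "y \<in> E"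
proof -
  have "x \<in> Units R" using assms subfield_props(1) field_Units by blast
  then have "y = inv x \<otimes> (x \<otimes> y)"
    using assms(4) by (simp add: m_assoc[symmetric] Units_closed)
  then show ?thesis using subfield_props(5,8)[OF assms(1)] assms by metis
qed

lemma (in field) fixed_subfield:
  assumes h: "h \<in> ring_hom R R" and E: "subfield E R"
  shows "subfield {x \<in> E. h x = x} R"
  by (intro subfieldI' subringI)
     (use subfield_props[OF E] self_hom[OF h] in \<open>auto simp: subset_iff\<close>)

lemma (in field) image_subfield:
  assumes h: "h \<in> ring_hom R R" and E: "subfield E R"
  shows "subfield {x \<in> carrier R. h x \<in> E} R"
  by (intro subfieldI' subringI)
     (use subfield_props[OF E] self_hom[OF h] field_Units in \<open>auto simp: subset_iff\<close>)

lemma (in field) hom_eq_on_generate_field: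
  assumes "h \<in> ring_hom R R" "A \<subseteq> carrier R" "\<And>x. x \<in> A \<Longrightarrow> h x = x" "x \<in> generate_field R A"
  shows "h x = x"
proof -
  have "A \<subseteq> {x \<in> carrier R. h x = x}" using assms(2,3) by auto
  then have "generate_field R A \<subseteq> {x \<in> carrier R. h x = x}"
    using generate_field_min_subfield1[OF assms(2) fixed_subfield[OF assms(1) carrier_is_subfield]] by simp
  then show ?thesis using assms(4) by auto
qed

lemma (in field) hom_generate_field:
  assumes "h \<in> ring_hom R R" "A \<subseteq> carrier R" "subfield E R" "\<And>x. x \<in> A \<Longrightarrow> h x \<in> E"
    "x \<in> generate_field R A"
  shows "h x \<in> E"
proof -
  have "A \<subseteq> {x \<in> carrier R. h x \<in> E}" using assms(2,4) by auto
  then have "generate_field R A \<subseteq> {x \<in> carrier R. h x \<in> E}"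
    using generate_field_min_subfield1[OF assms(2) image_subfield[OF assms(1,3)]] by simp
  then show ?thesis using assms(5) by auto
qed

context algebraic_closure
begin

lemma algebraic_over: "K \<subseteq> M \<Longrightarrow> x \<in> carrier L \<Longrightarrow> (algebraic over M) x"
  using algebraic_mono[of K M] algebraic_extension by blast

lemma Irr_props:
  assumes "subfield M L" "K \<subseteq> M" "x \<in> carrier L"
  shows "Irr M x \<in> carrier (M[X])" "Irr M x \<in> carrier (poly_ring L)" "Irr M x \<noteq> []"
    "eval (Irr M x) x = \<zero>" "degree (Irr M x) \<ge> 1"
proof -
  note alg = algebraic_over[OF assms(2,3)]
  show c: "Irr M x \<in> carrier (M[X])" and "eval (Irr M x) x = \<zero>" using IrrE[OF assms(1,3) alg] by auto
  then show "Irr M x \<in> carrier (poly_ring L)"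
    using carrier_polynomial_shell[OF subfieldE(1)[OF assms(1)]] by blast
  show "degree (Irr M x) \<ge> 1" using pirreducible_degree[OF assms(1) c IrrE(2)[OF assms(1,3) alg]] .
  then show "Irr M x \<noteq> []" by auto
qed

lemma hom_is_root:
  assumes M: "subfield M L" "K \<subseteq> M" and x: "x \<in> carrier L" and h: "h \<in> hom_over L M"
  shows "is_root (Irr M x) (h x)"
proof -
  interpret h: ring_hom_ring L L h
    using hom_overD(1)[OF h] ring_hom_ringI2[OF ring_axioms ring_axioms] by blast
  note I = Irr_props[OF M x]
  have "map h (Irr M x) = Irr M x"
    using polynomial_incl[of M "Irr M x"] I(1) hom_overD(2)[OF h] unfolding univ_poly_carrier
    by (intro map_idI) auto
  then have "eval (Irr M x) (h x) = \<zero>"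
    using h.eval_hom[OF carrier_is_subring x I(2)] I(4) by simp
  then show ?thesis unfolding is_root_def using I(3) x by simp
qed

text \<open>The identity of M is extended first to M(x), sending x to y, and then to all of
  \<open>L\<close>. Together with \<open>hom_is_root\<close>, the conjugates of x are exactly its
  orbit.\<close>

lemma root_hom:
  assumes M: "subfield M L" "K \<subseteq> M" and x: "x \<in> carrier L" and y: "is_root (Irr M x) y"
  obtains h where "h \<in> hom_over L M" "h x = y"
proof -
  have i: "id \<in> ring_hom (L\<lparr>carrier := M\<rparr>) L"
    using subfieldE(3)[OF M(1)] by (auto intro!: ring_hom_memI)
  obtain g where g: "g \<in> ring_hom (L\<lparr>carrier := simple_extension M x\<rparr>) L" "\<forall>z\<in>M. g z = id z" "g x = y"
    using extend_hom_simple[OF M(1) i x algebraic_over[OF M(2) x], of y] y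
    unfolding is_root_def by auto
  have sub: "subfield (simple_extension M x) L"
    using simple_extension_is_subfield[OF M(1) x] algebraic_over[OF M(2) x] by simp
  have inc: "M \<subseteq> simple_extension M x" using simple_extension_incl[OF subfieldE(3)[OF M(1)] x] .
  obtain h where h: "h \<in> ring_hom L L" "\<And>z. z \<in> simple_extension M x \<Longrightarrow> h z = g z"
    using extend_hom[OF sub _ g(1)] inc M(2) by blast
  show thesis
  proof (rule that)
    show "h \<in> hom_over L M" unfolding hom_over_def using h g(2) inc by auto
    show "h x = y" using h(2) g(3) simple_extension_mem[OF subfieldE(1)[OF M(1)] x] by simp
  qed
qed

lemma finite_orbit:
  assumes "subfield M L" "K \<subseteq> M" "x \<in> carrier L"
  shows "finite {h x | h. h \<in> hom_over L M}"
proof -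
  have "{h x | h. h \<in> hom_over L M} \<subseteq> {y. is_root (Irr M x) y}"
    using hom_is_root[OF assms] by auto
  then show ?thesis using finite_number_of_roots[OF Irr_props(2)[OF assms]] finite_subset by blast
qed

text \<open>Every element of E lies in a finite orbit inside E, and the injective map h sends that
  orbit into itself, hence permutes it.\<close>

lemma stable_image:
  assumes M: "subfield M L" "K \<subseteq> M" and E: "E \<subseteq> carrier L" "stable_over L M E"
    and h: "h \<in> hom_over L M"
  shows "h ` E = E"
proof
  show "h ` E \<subseteq> E" using E h unfolding stable_over_def by blast
  show "E \<subseteq> h ` E"
  proof
    fix x assume x: "x \<in> E"
    define Z where "Z = {g x | g. g \<in> hom_over L M}"
    have xc: "x \<in> carrier L" using x E by blast
    have fin: "finite Z" unfolding Z_def using finite_orbit[OF M xc] .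
    have ZE: "Z \<subseteq> E" unfolding Z_def using stable_overD[OF E(2)] x by blast
    have hZ: "h ` Z \<subseteq> Z"
    proof
      fix z assume "z \<in> h ` Z"
      then obtain g where "g \<in> hom_over L M" "z = h (g x)" unfolding Z_def by blast
      then have "h \<circ> g \<in> hom_over L M" "z = (h \<circ> g) x" using hom_over_comp[OF h, of g] by auto
      then show "z \<in> Z" unfolding Z_def by blast
    qed
    have "inj_on h Z"
      using self_hom(9)[OF hom_overD(1)[OF h]] ZE E(1) by (meson inj_on_subset subset_trans)
    then have "h ` Z = Z" using endo_inj_surj[OF fin hZ] by blast
    moreover have "x \<in> Z" unfolding Z_def mem_Collect_eq by (rule exI[of _ id]) (simp add: id_hom_over)
    ultimately show "x \<in> h ` E" using ZE by blast
  qed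
qed

lemma galois_stable:
  assumes "galois_extension L M E" "K \<subseteq> M"
  shows "stable_over L M E"
proof -
  have *: "subfield M L" "E \<subseteq> carrier L" using assms(1) subfieldE(3) unfolding galois_extension_def by auto
  have "h x \<in> E" if "h \<in> hom_over L M" "x \<in> E" for h x
    using hom_is_root[OF *(1) assms(2) _ that(1), of x] * that assms(1)
    unfolding galois_extension_def by blast
  then show ?thesis unfolding stable_over_def by blast
qed

lemma restrict_in_galois_group:
  assumes M: "subfield M L" "K \<subseteq> M" "M \<subseteq> E" and E: "subfield E L" "stable_over L M E"
    and h: "h \<in> hom_over L M"
  shows "restrict h E \<in> carrier (galois_group L M E)"
proof -
  note Ec = subfield_props[OF E(1)]
  note hh = self_hom[OF hom_overD(1)[OF h]]
  have "inj_on h E" using hh(9) Ec(1) inj_on_subset by blast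
  then have "bij_betw h E E"
    using stable_image[OF M(1,2) Ec(1) E(2) h] unfolding bij_betw_def by blast
  then have "bij_betw (restrict h E) E E" by simp
  then have B: "restrict h E \<in> Bij E" unfolding Bij_def by simp
  have "restrict h E \<in> ring_hom (L\<lparr>carrier := E\<rparr>) (L\<lparr>carrier := E\<rparr>)"
    using stable_overD[OF E(2) h] Ec hh by (intro ring_hom_memI) (auto simp: subset_iff)
  then show ?thesis unfolding galois_group_def
    using B M(3) hom_overD(2)[OF h] by auto
qed

lemma galois_group_lift:
  assumes M: "K \<subseteq> M" "M \<subseteq> E" and E: "subfield E L"
    and \<tau>: "\<tau> \<in> carrier (galois_group L M E)"
  obtains h where "h \<in> hom_over L M" "\<tau> = restrict h E"
proof -
  have t: "\<tau> \<in> Bij E" "\<tau> \<in> ring_hom (L\<lparr>carrier := E\<rparr>) (L\<lparr>carrier := E\<rparr>)" "\<forall>x\<in>M. \<tau> x = x"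
    using \<tau> unfolding galois_group_def by auto
  have "\<tau> \<in> ring_hom (L\<lparr>carrier := E\<rparr>) L"
    using t(2) subfieldE(3)[OF E] unfolding ring_hom_def by auto
  then obtain h where h: "h \<in> ring_hom L L" "\<And>z. z \<in> E \<Longrightarrow> h z = \<tau> z"
    using extend_hom[OF E] M by blast
  have "h \<in> hom_over L M" using h t(3) M(2) unfolding hom_over_def by auto
  moreover have "\<tau> = restrict h E"
    using h(2) Bij_imp_extensional[OF t(1)] by (intro ext) (auto simp: extensional_def)
  ultimately show thesis using that by blast
qed

end

section \<open>Computing in Galois groups of extensional maps\<close>

lemma galois_group_mult:
  assumes "\<sigma> \<in> carrier (galois_group L K E)" "\<tau> \<in> carrier (galois_group L K E)"
  shows "\<sigma> \<otimes>\<^bsub>galois_group L K E\<^esub> \<tau> = compose E \<sigma> \<tau>"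
  using assms unfolding galois_group_def BijGroup_def by auto

lemma galois_group_one: "\<one>\<^bsub>galois_group L K E\<^esub> = (\<lambda>x\<in>E. x)"
  unfolding galois_group_def BijGroup_def by auto

lemma galois_group_ext:
  assumes "\<sigma> \<in> carrier (galois_group L K E)" "\<tau> \<in> carrier (galois_group L K E)"
    "\<And>x. x \<in> E \<Longrightarrow> \<sigma> x = \<tau> x"
  shows "\<sigma> = \<tau>"
proof -
  have "\<sigma> \<in> extensional E" "\<tau> \<in> extensional E"
    using assms(1,2) Bij_imp_extensional unfolding galois_group_def by auto
  then show ?thesis using extensionalityI assms(3) by blast
qed

lemma (in field) group_galois_group:
  assumes E: "subfield E R" "K \<subseteq> E"
  shows "group (galois_group R K E)"
proof -
  let ?H = "{\<sigma> \<in> Bij E. \<sigma> \<in> ring_hom (R\<lparr>carrier := E\<rparr>) (R\<lparr>carrier := E\<rparr>) \<and> (\<forall>x\<in>K. \<sigma> x = x)}"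
  note Ec = subfield_props[OF E(1)]
  interpret B: group "BijGroup E" by (rule group_BijGroup)
  have "subgroup ?H (BijGroup E)"
  proof (rule subgroup.intro)
    show "?H \<subseteq> carrier (BijGroup E)" by (auto simp: BijGroup_def)
    show "\<one>\<^bsub>BijGroup E\<^esub> \<in> ?H"
      using id_Bij Ec E(2) by (auto simp: BijGroup_def intro!: ring_hom_memI)
  next
    fix \<sigma> \<tau> assume *: "\<sigma> \<in> ?H" "\<tau> \<in> ?H"
    have eq: "\<sigma> \<otimes>\<^bsub>BijGroup E\<^esub> \<tau> = compose E \<sigma> \<tau>" using * by (auto simp: BijGroup_def)
    have tE: "\<And>x. x \<in> E \<Longrightarrow> \<tau> x \<in> E" "\<And>x. x \<in> E \<Longrightarrow> \<sigma> x \<in> E"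
      using * Bij_imp_funcset by auto
    have "compose E \<sigma> \<tau> \<in> ring_hom (R\<lparr>carrier := E\<rparr>) (R\<lparr>carrier := E\<rparr>)"
      using * tE Ec(3-5) unfolding ring_hom_def by (auto simp: compose_def)
    then show "\<sigma> \<otimes>\<^bsub>BijGroup E\<^esub> \<tau> \<in> ?H"
      using * eq compose_Bij E(2) by (auto simp: compose_def)
  next
    fix \<sigma> assume *: "\<sigma> \<in> ?H"
    then have B: "\<sigma> \<in> Bij E" by simp
    have bij: "bij_betw \<sigma> E E" using B unfolding Bij_def by simp
    have h: "\<sigma> \<in> ring_hom (R\<lparr>carrier := E\<rparr>) (R\<lparr>carrier := E\<rparr>)" using * by simp
    have sa: "\<And>x y. x \<in> E \<Longrightarrow> y \<in> E \<Longrightarrow> \<sigma> (x \<otimes> y) = \<sigma> x \<otimes> \<sigma> y"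
      "\<And>x y. x \<in> E \<Longrightarrow> y \<in> E \<Longrightarrow> \<sigma> (x \<oplus> y) = \<sigma> x \<oplus> \<sigma> y" "\<sigma> \<one> = \<one>"
      using ring_hom_mult[OF h] ring_hom_add[OF h] ring_hom_one[OF h] by auto
    have fs: "(\<otimes>) \<in> E \<rightarrow> E \<rightarrow> E" "(\<oplus>) \<in> E \<rightarrow> E \<rightarrow> E" using Ec by auto
    have iE: "inv_into E \<sigma> x \<in> E" if "x \<in> E" for x using Bij_inv_into_mem[OF B that] .
    have ifix: "inv_into E \<sigma> x = x" if "x \<in> E" "\<sigma> x = x" for x
      using bij that unfolding bij_betw_def by (metis inv_into_f_f)
    have "restrict (inv_into E \<sigma>) E \<in> ring_hom (R\<lparr>carrier := E\<rparr>) (R\<lparr>carrier := E\<rparr>)"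
      by (rule ring_hom_memI)
         (use Bij_inv_into_lemma[OF sa(1) B fs(1)] Bij_inv_into_lemma[OF sa(2) B fs(2)] iE Ec
          ifix[of \<one>] sa(3) in auto)
    then show "inv\<^bsub>BijGroup E\<^esub> \<sigma> \<in> ?H"
      using inv_BijGroup[OF B] restrict_inv_into_Bij[OF B] * E(2) ifix
      by (auto simp: subset_iff)
  qed
  then show ?thesis
    unfolding galois_group_def using subgroup.subgroup_is_group B.group_axioms by blast
qed

lemma (in field) galois_group_pow:
  assumes E: "subfield E R" "K \<subseteq> E" and \<rho>: "\<rho> \<in> carrier (galois_group R K E)" and x: "x \<in> E"
  shows "(\<rho> [^]\<^bsub>galois_group R K E\<^esub> (n::nat)) x = (\<rho> ^^ n) x"
  using x
proof (induct n arbitrary: x)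
  interpret G: group "galois_group R K E" using group_galois_group[OF E] .
  case 0 then show ?case by (simp add: galois_group_one)
next
  interpret G: group "galois_group R K E" using group_galois_group[OF E] .
  case (Suc n)
  have "\<rho> x \<in> E" using \<rho> Suc(2) Bij_imp_funcset unfolding galois_group_def by auto
  then have "(\<rho> [^]\<^bsub>galois_group R K E\<^esub> n) (\<rho> x) = (\<rho> ^^ n) (\<rho> x)" using Suc(1) by blast
  then show ?case
    using Suc(2) galois_group_mult[OF G.nat_pow_closed[OF \<rho>] \<rho>] by (simp add: compose_def funpow_swap1)
qed

section \<open>Separability from fixed fields, independence of characters, prime degree\<close>

lemma (in field) roots_finprod_linear:
  assumes E: "subfield E R" and A: "finite A" "A \<subseteq> E"
  shows "finprod (poly_ring R) (\<lambda>z. [\<one>, \<ominus> z]) A \<in> carrier (E[X]) \<and>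
    finprod (poly_ring R) (\<lambda>z. [\<one>, \<ominus> z]) A \<noteq> [] \<and>
    roots (finprod (poly_ring R) (\<lambda>z. [\<one>, \<ominus> z]) A) = mset_set A"
  using A
proof (induct A)
  interpret P: domain "poly_ring R" using univ_poly_is_domain[OF carrier_is_subring] .
  interpret EX: domain "E[X]" using univ_poly_is_domain[OF subfieldE(1)[OF E]] .
  case empty
  have "finprod (poly_ring R) (\<lambda>z. [\<one>, \<ominus> z]) {} = [\<one>]" by (simp add: univ_poly_one)
  moreover have "[\<one>] \<in> carrier (E[X])" using EX.one_closed by (simp add: univ_poly_one)
  moreover have "[\<one>] \<in> carrier (poly_ring R)" using P.one_closed by (simp add: univ_poly_one)
  ultimately show ?case using degree_zero_imp_empty_roots[of "[\<one>]"] by simp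
next
  interpret P: domain "poly_ring R" using univ_poly_is_domain[OF carrier_is_subring] .
  interpret EX: domain "E[X]" using univ_poly_is_domain[OF subfieldE(1)[OF E]] .
  case (insert z A)
  define Q where "Q = finprod (poly_ring R) (\<lambda>z. [\<one>, \<ominus> z]) A"
  have Q: "Q \<in> carrier (E[X])" "Q \<noteq> []" "roots Q = mset_set A" using insert unfolding Q_def by auto
  have Qc: "Q \<in> carrier (poly_ring R)" using carrier_polynomial_shell[OF subfieldE(1)[OF E] Q(1)] .
  have lin: "[\<one>, \<ominus> w] \<in> carrier (E[X])" if "w \<in> E" for w
    using that subfield_props[OF E] unfolding sym[OF univ_poly_carrier] polynomial_def by auto
  have linc: "[\<one>, \<ominus> w] \<in> carrier (poly_ring R)" if "w \<in> E" for w
    using carrier_polynomial_shell[OF subfieldE(1)[OF E] lin[OF that]] .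
  have eq: "finprod (poly_ring R) (\<lambda>z. [\<one>, \<ominus> z]) (insert z A) = [\<one>, \<ominus> z] \<otimes>\<^bsub>poly_ring R\<^esub> Q"
    unfolding Q_def using insert linc by (intro P.finprod_insert) auto
  have zc: "z \<in> carrier R" using insert(4) subfield_props(1)[OF E] by blast
  have "[\<one>, \<ominus> z] \<otimes>\<^bsub>poly_ring R\<^esub> Q \<in> carrier (E[X])"
    using EX.m_closed[OF lin Q(1)] insert(4) by (simp add: univ_poly_mult)
  moreover have "[\<one>, \<ominus> z] \<otimes>\<^bsub>poly_ring R\<^esub> Q \<noteq> []"
    using P.integral_iff[OF linc Qc] insert(4) Q(2) by (simp add: univ_poly_zero)
  moreover have "roots ([\<one>, \<ominus> z] \<otimes>\<^bsub>poly_ring R\<^esub> Q) = mset_set (insert z A)"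
    using poly_mult_degree_one_monic_imp_same_roots[OF zc Qc Q(2)] Q(3) insert by simp
  ultimately show ?case unfolding eq by blast
qed

text \<open>Artin's argument: the product of X - z over the orbit of x is invariant under all
  homomorphisms over M, so its coefficients lie in M. Its roots are simple and
  \<open>Irr M x\<close> divides it.\<close>

lemma (in algebraic_closure) separable_if_fixed:
  assumes M: "subfield M L" "K \<subseteq> M" and E: "subfield E L" "stable_over L M E"
    and fixd: "\<And>x. x \<in> E \<Longrightarrow> (\<And>h. h \<in> hom_over L M \<Longrightarrow> h x = x) \<Longrightarrow> x \<in> M"
    and x: "x \<in> E"
  shows "separable_over L M x"
proof -
  interpret P: domain "poly_ring L" using univ_poly_is_domain[OF carrier_is_subring] .
  define Z where "Z = {g x | g. g \<in> hom_over L M}"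
  define P where "P = finprod (poly_ring L) (\<lambda>z. [\<one>, \<ominus> z]) Z"
  note Ec = subfield_props[OF E(1)]
  have xc: "x \<in> carrier L" using x Ec(1) by blast
  have fin: "finite Z" unfolding Z_def using finite_orbit[OF M xc] .
  have ZE: "Z \<subseteq> E" unfolding Z_def using stable_overD[OF E(2)] x by blast
  have P: "P \<in> carrier (E[X])" "P \<noteq> []" "roots P = mset_set Z"
    using roots_finprod_linear[OF E(1) fin ZE] unfolding P_def by auto
  have Pc: "P \<in> carrier (poly_ring L)" using carrier_polynomial_shell[OF subfieldE(1)[OF E(1)] P(1)] .
  have "map h P = P" if h: "h \<in> hom_over L M" for h
  proof -
    note hh = self_hom[OF hom_overD(1)[OF h]]
    have zc: "z \<in> carrier L" if "z \<in> Z" for z using that ZE Ec(1) by blast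
    have hZ: "h ` Z \<subseteq> Z"
    proof
      fix z assume "z \<in> h ` Z"
      then obtain g where "g \<in> hom_over L M" "z = h (g x)" unfolding Z_def by blast
      then have "h \<circ> g \<in> hom_over L M" "z = (h \<circ> g) x" using hom_over_comp[OF h, of g] by auto
      then show "z \<in> Z" unfolding Z_def by blast
    qed
    have inj: "inj_on h Z"
      using hh(9) ZE Ec(1) by (meson inj_on_subset subset_trans)
    then have im: "h ` Z = Z" using endo_inj_surj[OF fin hZ] by blast
    have mh: "map h \<in> ring_hom (poly_ring L) (poly_ring L)"
      using map_poly_ring_hom[OF hom_overD(1)[OF h] field_axioms field_axioms] .
    interpret mh: ring_hom_cring "poly_ring L" "poly_ring L" "map h"
      using mh by unfold_locales
    have lin: "(\<lambda>z. [\<one>, \<ominus> z]) \<in> Z \<rightarrow> carrier (poly_ring L)"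
      using zc by (auto simp: sym[OF univ_poly_carrier] polynomial_def)
    have "map h P = finprod (poly_ring L) (\<lambda>z. map h [\<one>, \<ominus> z]) Z"
      unfolding P_def using mh.hom_finprod[OF lin] by (simp add: comp_def)
    also have "\<dots> = finprod (poly_ring L) (\<lambda>z. [\<one>, \<ominus> (h z)]) Z"
      using zc hh(3,6) lin hZ by (intro P.finprod_cong') auto
    also have "\<dots> = finprod (poly_ring L) (\<lambda>z. [\<one>, \<ominus> z]) (h ` Z)"
      using lin im inj by (subst P.finprod_reindex) auto
    finally show ?thesis using im P_def by simp
  qed
  then have hc: "h c = c" if "h \<in> hom_over L M" "c \<in> set P" for h c
    using that by (metis map_eq_conv map_ident)
  have "set P \<subseteq> E" using P(1) polynomial_incl[of E P] unfolding univ_poly_carrier by blast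
  then have "set P \<subseteq> M" using fixd hc by blast
  then have PM: "P \<in> carrier (M[X])"
    using P(1) unfolding sym[OF univ_poly_carrier] polynomial_def by auto
  have "x \<in> Z" unfolding Z_def mem_Collect_eq by (rule exI[of _ id]) (simp add: id_hom_over)
  then have "x \<in># roots P" using P(3) fin by simp
  then have "eval P x = \<zero>" using roots_mem_iff_is_root[OF Pc] unfolding is_root_def by blast
  then have "Irr M x pdivides P"
    using Irr_minimal[OF M(1) xc algebraic_over[OF M(2) xc] PM] by blast
  then have sub: "roots (Irr M x) \<subseteq># mset_set Z"
    using pdivides_imp_roots_incl[OF Irr_props(2)[OF M xc] Pc P(2)] P(3) by simp
  have "alg_mult (Irr M x) y = 1" if "is_root (Irr M x) y" for y
  proof -
    have "alg_mult (Irr M x) y \<le> count (mset_set Z) y"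
      using sub alg_mult_eq_count_roots[OF Irr_props(2)[OF M xc]] by (simp add: mset_subset_eq_count)
    also have "\<dots> \<le> 1" by (simp add: count_mset_set')
    finally have "alg_mult (Irr M x) y \<le> 1" .
    moreover have "alg_mult (Irr M x) y > 0"
      using alg_mult_gt_zero_iff_is_root[OF Irr_props(2)[OF M xc]] that by blast
    ultimately show ?thesis by simp
  qed
  then show ?thesis unfolding separable_over_def using algebraic_over[OF M(2) xc] by blast
qed

text \<open>Dedekind's induction on the number of characters: a relation is shortened by comparing
  its value at y x with a multiple of its value at x.\<close>

lemma (in field) dedekind_independence:
  assumes "finite I" and M: "M \<subseteq> carrier R" "\<one> \<in> M" "\<And>x y. x \<in> M \<Longrightarrow> y \<in> M \<Longrightarrow> x \<otimes> y \<in> M"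
    and f: "\<And>i x. i \<in> I \<Longrightarrow> x \<in> M \<Longrightarrow> f i x \<in> carrier R" "\<And>i. i \<in> I \<Longrightarrow> f i \<one> = \<one>"
      "\<And>i x y. i \<in> I \<Longrightarrow> x \<in> M \<Longrightarrow> y \<in> M \<Longrightarrow> f i (x \<otimes> y) = f i x \<otimes> f i y"
    and ne: "\<And>i j. i \<in> I \<Longrightarrow> j \<in> I \<Longrightarrow> i \<noteq> j \<Longrightarrow> \<exists>x\<in>M. f i x \<noteq> f j x"
    and c: "\<And>i. i \<in> I \<Longrightarrow> c i \<in> carrier R"
    and zero: "\<And>x. x \<in> M \<Longrightarrow> (\<Oplus>i\<in>I. c i \<otimes> f i x) = \<zero>"
    and i: "i \<in> I"
  shows "c i = \<zero>"
  using assms(1) f ne c zero i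
proof (induct I arbitrary: c i)
  case empty then show ?case by simp
next
  case (insert k I)
  note fI = insert(4-6) and neI = insert(7) and cI = insert(8) and zI = insert(9)
  have I0: "c i = \<zero>" if iI: "i \<in> I" for i
  proof -
    obtain y where y: "y \<in> M" "f i y \<noteq> f k y" using neI[of i k] iI insert(2) by blast
    \<comment> \<open>Coefficients of the relation at y x minus f k y times the relation at x: the
      k-th term cancels, while the i-th survives if c i is nonzero, since y separates f i from f
      k.\<close>
    define d where "d j = c j \<otimes> (f j y \<ominus> f k y)" for j
    have dc: "d j \<in> carrier R" if "j \<in> I" for j
      unfolding d_def using that cI fI(1) y(1) by simp
    have "(\<Oplus>j\<in>I. d j \<otimes> f j x) = \<zero>" if x: "x \<in> M" for x
    proof -
      have fx: "f j x \<in> carrier R" "f j y \<in> carrier R" if "j \<in> insert k I" for j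
        using that fI(1) x y by auto
      have t: "f j (y \<otimes> x) = f j y \<otimes> f j x" if "j \<in> insert k I" for j
        using that fI(3) x y by auto
      have "\<zero> = (\<Oplus>j\<in>insert k I. c j \<otimes> f j (y \<otimes> x)) \<oplus> (\<ominus> f k y) \<otimes> (\<Oplus>j\<in>insert k I. c j \<otimes> f j x)"
        using zI[OF x] zI[OF M(3)[OF y(1) x]] fx by simp
      also have "(\<ominus> f k y) \<otimes> (\<Oplus>j\<in>insert k I. c j \<otimes> f j x) = (\<Oplus>j\<in>insert k I. (\<ominus> f k y) \<otimes> (c j \<otimes> f j x))"
        using insert(1) fx cI by (intro finsum_rdistr) auto
      also have "(\<Oplus>j\<in>insert k I. c j \<otimes> f j (y \<otimes> x)) \<oplus> \<dots>
         = (\<Oplus>j\<in>insert k I. c j \<otimes> f j (y \<otimes> x) \<oplus> (\<ominus> f k y) \<otimes> (c j \<otimes> f j x))"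
        using fx cI t by (intro finsum_addf[symmetric]) auto
      also have "\<dots> = (\<Oplus>j\<in>insert k I. d j \<otimes> f j x)"
      proof (rule finsum_cong')
        fix j assume j: "j \<in> insert k I"
        note cc = fx[OF j] cI[OF j] fx[of k]
        show "c j \<otimes> f j (y \<otimes> x) \<oplus> (\<ominus> f k y) \<otimes> (c j \<otimes> f j x) = d j \<otimes> f j x"
          unfolding t[OF j] d_def using cc(1,2,3) cc(5)[OF insertI1] by algebra
      qed (use fx cI fI(1) y d_def in auto)
      also have "\<dots> = d k \<otimes> f k x \<oplus> (\<Oplus>j\<in>I. d j \<otimes> f j x)"
        using insert(1,2) dc fx cI unfolding d_def by (intro finsum_insert) auto
      also have "d k \<otimes> f k x = \<zero>"
        unfolding d_def using fx[of k] cI[of k] by (simp add: minus_eq r_neg)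
      finally show ?thesis using dc fx by simp
    qed
    then have "d i = \<zero>"
      using insert(3)[of d i] fI neI dc iI by auto
    then show ?thesis
      unfolding d_def using y cI[of i] fI(1)[of i y] fI(1)[of k y] iI
      by (metis insertI1 insertI2 integral minus_closed r_right_minus_eq)
  qed
  have ck: "c k \<in> carrier R" using cI by simp
  have "(\<Oplus>j\<in>insert k I. c j \<otimes> f j \<one>) = c k \<otimes> f k \<one> \<oplus> (\<Oplus>j\<in>I. c j \<otimes> f j \<one>)"
    using insert(1,2) cI fI(1) M(2) by (intro finsum_insert) auto
  also have "(\<Oplus>j\<in>I. c j \<otimes> f j \<one>) = (\<Oplus>j\<in>I. \<zero>)"
    using I0 fI(1) M(2) by (intro finsum_cong') auto
  finally have "c k = \<zero>" using zI[OF M(2)] fI(2)[of k] ck by simp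
  then show ?case using I0 insert(10) by blast
qed

lemma (in algebraic_closure) degree_Irr_one:
  assumes M: "subfield M L" "K \<subseteq> M" and a: "a \<in> carrier L" and "degree (Irr M a) = 1"
  shows "a \<in> M"
proof -
  note alg = algebraic_over[OF M(2) a]
  note I = Irr_props[OF M a]
  have "length (Irr M a) = 2" using I(3) assms(4) by simp
  then obtain u v where uv: "Irr M a = [u, v]" by (auto simp: numeral_2_eq_2 length_Suc_conv)
  then have "u = \<one>" using IrrE(3)[OF M(1) a alg] by simp
  moreover have v: "v \<in> M" using I(1) uv unfolding sym[OF univ_poly_carrier] polynomial_def by auto
  ultimately have "a \<oplus> v = \<zero>"
    using I(4) uv a subfieldE(3)[OF M(1)] by (auto simp: subset_iff)
  then have "a = \<ominus> v" using minus_equality[of a v] a v subfieldE(3)[OF M(1)] by auto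
  then show ?thesis using subfield_props(6)[OF M(1) v] by simp
qed

text \<open>By the tower law the degree of a divides the prime p, and it is not 1 since a is outside
  M. The p powers of a are then independent in a space of dimension p, so they span E.\<close>

lemma (in algebraic_closure) simple_extension_eq_of_prime_dimension:
  assumes M: "subfield M L" "K \<subseteq> M" and E: "subfield E L" "M \<subseteq> E"
    and dim: "dimension p M E" and p: "Factorial_Ring.prime p" and a: "a \<in> E" "a \<notin> M"
  shows "simple_extension M a = E" "degree (Irr M a) = p"
proof -
  note Ec = subfield_props[OF E(1)]
  have ac: "a \<in> carrier L" using a Ec(1) by blast
  note alg = algebraic_over[OF M(2) ac]
  let ?A = "simple_extension M a"
  have A: "subfield ?A L" using simple_extension_is_subfield[OF M(1) ac] alg by simp
  have AE: "?A \<subseteq> E" using simple_extension_subring_incl[OF subfieldE(1)[OF E(1)] E(2) a(1)] .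
  have MA: "M \<subseteq> ?A" using simple_extension_incl[OF subfieldE(3)[OF M(1)] ac] .
  obtain Us where Us: "set Us \<subseteq> carrier L" "Span M Us = E" using exists_base[OF M(1) dim] by blast
  have UE: "set Us \<subseteq> E" using Span_base_incl[OF M(1) Us(1)] Us(2) by simp
  have comb: "combine Ks Vs \<in> E" if "set Ks \<subseteq> E" "set Vs \<subseteq> E" for Ks Vs
    using that by (induct Ks Vs rule: combine.induct) (auto simp: Ec)
  have "Span ?A Us = E"
  proof
    show "Span ?A Us \<subseteq> E"
      using Span_eq_combine_set[OF A Us(1)] comb UE AE by auto
    show "E \<subseteq> Span ?A Us"
    proof
      fix y assume "y \<in> E"
      then obtain Ks where "set Ks \<subseteq> M" "y = combine Ks Us"
        using Span_eq_combine_set[OF M(1) Us(1)] Us(2) by blast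
      then show "y \<in> Span ?A Us" using Span_eq_combine_set[OF A Us(1)] MA by blast
    qed
  qed
  then have fin: "finite_dimension ?A E" using Span_finite_dimension[OF A Us(1)] by simp
  have dA: "dimension (degree (Irr M a)) M ?A" using dimension_simple_extension[OF M(1) ac alg] .
  have "dimension (degree (Irr M a) * ((dim over ?A) E)) M E"
    using telescopic_base[OF M(1) A dA finite_dimensionE[OF A fin]] .
  then have "degree (Irr M a) * ((dim over ?A) E) = p" using dimension_is_inj[OF M(1) dim] by simp
  then have "degree (Irr M a) dvd p" by (metis dvd_triv_left)
  then have "degree (Irr M a) = 1 \<or> degree (Irr M a) = p" using p by (metis prime_nat_iff)
  moreover have "degree (Irr M a) \<noteq> 1" using degree_Irr_one[OF M ac] a(2) by blast
  ultimately show deg: "degree (Irr M a) = p" by simp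
  have ind: "independent M (exp_base a p)" using exp_base_independent[OF M(1) ac alg] deg by simp
  have "set (exp_base a p) \<subseteq> E" using Ec(9)[OF a(1)] unfolding exp_base_def by auto
  moreover have "length (exp_base a p) = p" unfolding exp_base_def by simp
  ultimately have "Span M (exp_base a p) = E"
    using independent_length_eq_dimension[OF M(1) dim ind] by blast
  then show "?A = E" using Span_exp_base[OF M(1) ac alg] deg by simp
qed

lemma (in algebraic_closure) hom_over_simple_extension_eq:
  assumes "subfield M L" "x \<in> carrier L" "h \<in> hom_over L M" "g \<in> hom_over L M" "h x = g x"
    and "y \<in> simple_extension M x"
  shows "h y = g y"
proof -
  note hh = self_hom[OF hom_overD(1)[OF assms(3)]] and gg = self_hom[OF hom_overD(1)[OF assms(4)]]
  have Mc: "M \<subseteq> carrier L" using subfieldE(3)[OF assms(1)] .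
  have "y \<in> carrier L \<and> h y = g y" using assms(6)
  proof (induct rule: simple_extension.induct)
    case zero then show ?case by (simp only: hh(2) gg(2) zero_closed simp_thms)
  next
    case (lin k1 k2)
    then show ?case using hh gg Mc assms(2,5) hom_overD(2)[OF assms(3)] hom_overD(2)[OF assms(4)]
      by (auto simp: subset_iff)
  qed
  then show ?thesis by blast
qed

subsection \<open>Kummer extensions\<close>

lemma hom_over_le: "h \<in> hom_over L M \<Longrightarrow> K \<subseteq> M \<Longrightarrow> h \<in> hom_over L K"
  using hom_over_mono by blast

lemma (in field) nonzero_pow: "x \<in> carrier R \<Longrightarrow> x \<noteq> \<zero> \<Longrightarrow> x [^] (n::nat) \<noteq> \<zero>"
  by (induct n) (auto simp: integral_iff)

text \<open>The Kummer model of K^(2), free of any mention of cyclic extensions or separability;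
  \<open>second_ext_eq\<close> identifies it with the compositum.\<close>

definition root_adjunction :: "('a, 'b) ring_scheme \<Rightarrow> nat \<Rightarrow> 'a set \<Rightarrow> 'a set"
  where "root_adjunction L p K = generate_field L (K \<union> {x \<in> carrier L. x [^]\<^bsub>L\<^esub> p \<in> K})"

text \<open>Primitivity of \<zeta> also excludes characteristic p, where X^p - 1 = (X - 1)^p has the
  single root 1. Hence a nonzero p-th root has p distinct conjugates \<zeta>^i x, the source of
  separability.\<close>

locale kummer = algebraic_closure L F for L (structure) and F +
  fixes p :: nat and \<zeta>
  assumes prime: "Factorial_Ring.prime p" and zeta_F: "\<zeta> \<in> F" and zeta_pow: "\<zeta> [^] p = \<one>"
    and zeta_primitive: "\<And>k::nat. 0 < k \<Longrightarrow> k < p \<Longrightarrow> \<zeta> [^] k \<noteq> \<one>"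
begin

lemma F_subfield: "subfield F L" by (rule subfield_axioms)

lemma p_gt: "1 < p" "0 < p" using prime prime_gt_1_nat prime_gt_0_nat by auto

lemma zeta_closed [simp]: "\<zeta> \<in> carrier L" using zeta_F subfield_props(1)[OF F_subfield] by blast

lemma zeta_pow_mod: "\<zeta> [^] n = \<zeta> [^] (n mod p)"
proof -
  have "\<zeta> [^] n = \<zeta> [^] (p * (n div p) + n mod p)" by simp
  also have "\<dots> = (\<zeta> [^] p) [^] (n div p) \<otimes> \<zeta> [^] (n mod p)"
    by (simp only: nat_pow_mult[symmetric] nat_pow_pow zeta_closed)
  finally show ?thesis by (simp add: zeta_pow nat_pow_one)
qed

lemma zeta_pow_one_iff: "\<zeta> [^] (n::nat) = \<one> \<longleftrightarrow> p dvd n"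
proof -
  have "\<zeta> [^] n = \<one> \<longleftrightarrow> n mod p = 0"
    using zeta_pow_mod[of n] zeta_primitive[of "n mod p"] p_gt by (cases "n mod p = 0") auto
  then show ?thesis by (simp add: dvd_eq_mod_eq_0)
qed

lemma zeta_pow_nonzero: "\<zeta> [^] (n::nat) \<noteq> \<zero>"
proof -
  have "\<zeta> \<noteq> \<zero>"
    using zeta_pow p_gt by (metis nat_pow_zero neq0_conv zero_not_one)
  then show ?thesis using nonzero_pow by simp
qed

lemma zeta_pow_F: "\<zeta> [^] (n::nat) \<in> F" using subfield_props(9)[OF F_subfield] zeta_F by simp

lemma hom_zeta: "h \<in> hom_over L M \<Longrightarrow> F \<subseteq> M \<Longrightarrow> h (\<zeta> [^] (i::nat)) = \<zeta> [^] i"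
  by (rule hom_overD(2)) (use zeta_pow_F in auto)

lemma funpow_eigenvector:
  assumes h: "h \<in> hom_over L M" "F \<subseteq> M" and x: "x \<in> carrier L" "h x = \<zeta> [^] (j::nat) \<otimes> x"
  shows "(h ^^ n) x = \<zeta> [^] (j * n) \<otimes> x"
proof (induct n)
  case (Suc n)
  have "(h ^^ Suc n) x = \<zeta> [^] (j * n) \<otimes> (\<zeta> [^] j \<otimes> x)"
    using Suc x self_hom(5)[OF hom_overD(1)[OF h(1)], of "\<zeta> [^] (j * n)" x] hom_zeta[OF h] by simp
  also have "\<dots> = \<zeta> [^] (j * Suc n) \<otimes> x"
    using x(1) by (simp add: m_assoc[symmetric] nat_pow_mult add.commute)
  finally show ?case .
qed (use x in simp)

lemma inj_zeta_pow: "inj_on (\<lambda>i. \<zeta> [^] i) {..<p}"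
proof -
  have *: "i = j" if "i \<le> j" "j < p" "\<zeta> [^] i = \<zeta> [^] j" for i j
  proof -
    have "\<zeta> [^] j = \<zeta> [^] i \<otimes> \<zeta> [^] (j - i)" using that(1) by (simp add: nat_pow_mult)
    then have "\<zeta> [^] i \<otimes> \<zeta> [^] (j - i) = \<zeta> [^] i \<otimes> \<one>" using that(3) by simp
    then have "\<zeta> [^] (j - i) = \<one>"
      using m_lcancel[of "\<zeta> [^] i" "\<zeta> [^] (j - i)" \<one>] zeta_pow_nonzero by simp
    then have "p dvd j - i" using zeta_pow_one_iff by simp
    then show ?thesis using that(1,2) by (cases "j - i = 0") (auto dest: dvd_imp_le)
  qed
  show ?thesis
  proof (rule inj_onI)
    fix i j assume "i \<in> {..<p}" "j \<in> {..<p}" "\<zeta> [^] i = \<zeta> [^] j"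
    then show "i = j" using *[of i j] *[of j i] by (cases "i \<le> j") auto
  qed
qed

text \<open>The polynomial X^p - a, coefficients listed from the leading one down.\<close>

definition power_poly :: "'a \<Rightarrow> 'a list"
  where "power_poly a = \<one> # replicate (p - 1) \<zero> @ [\<ominus> a]"

lemma eval_power_poly:
  assumes "a \<in> carrier L" "x \<in> carrier L"
  shows "eval (power_poly a) x = x [^] p \<ominus> a"
proof -
  have "eval (replicate n \<zero> @ [b]) x = b" if "b \<in> carrier L" for n b
    using that assms(2) by (induct n) auto
  then show ?thesis unfolding power_poly_def using assms p_gt by (simp add: minus_eq)
qed

lemma power_poly_props:
  assumes "subfield M L" "a \<in> M"
  shows "power_poly a \<in> carrier (M[X])" "degree (power_poly a) = p" "power_poly a \<noteq> []"
  using subfield_props[OF assms(1)] assms(2) p_gt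
  unfolding sym[OF univ_poly_carrier] polynomial_def power_poly_def by auto

lemma inj_conjugates:
  assumes x: "x \<in> carrier L" "x \<noteq> \<zero>"
  shows "inj_on (\<lambda>i. \<zeta> [^] i \<otimes> x) {..<p}"
  using inj_zeta_pow x by (auto simp: inj_on_def m_rcancel)

lemma pow_conjugate: "x \<in> carrier L \<Longrightarrow> (\<zeta> [^] (i::nat) \<otimes> x) [^] p = x [^] p"
  by (simp add: nat_pow_distrib nat_pow_pow mult.commute[of i p])
     (simp add: nat_pow_pow[symmetric] zeta_pow nat_pow_one)

text \<open>The p distinct values \<zeta>^i x already exhaust the degree, so the inclusion of
  multisets is an equality and every root is simple.\<close>

lemma roots_power_poly:
  assumes x: "x \<in> carrier L" "x \<noteq> \<zero>"
  shows "roots (power_poly (x [^] p)) = mset_set ((\<lambda>i. \<zeta> [^] i \<otimes> x) ` {..<p})"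
proof -
  let ?P = "power_poly (x [^] p)" and ?Z = "(\<lambda>i. \<zeta> [^] i \<otimes> x) ` {..<p}"
  have P: "?P \<in> carrier (poly_ring L)" "degree ?P = p" "?P \<noteq> []"
    using power_poly_props[OF carrier_is_subfield] x by auto
  have "z \<in># roots ?P" if zZ: "z \<in> ?Z" for z
  proof -
    obtain i :: nat where "z = \<zeta> [^] i \<otimes> x" using zZ by auto
    then have "z \<in> carrier L" "z [^] p = x [^] p" using pow_conjugate[OF x(1)] x by auto
    then have "eval ?P z = \<zero>" using eval_power_poly[of "x [^] p" z] x(1) by (simp add: minus_eq r_neg)
    then show ?thesis
      unfolding roots_mem_iff_is_root[OF P(1)] is_root_def using P(3) \<open>z \<in> carrier L\<close> by simp
  qed
  then have sub: "mset_set ?Z \<subseteq># roots ?P"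
    by (intro mset_subset_eqI) (simp add: count_mset_set' Suc_leI)
  have "card ?Z = p" using card_image[OF inj_conjugates[OF x]] by simp
  then have "size (roots ?P) \<le> size (mset_set ?Z)"
    using size_roots_le_degree[OF P(1)] P(2) by simp
  then show ?thesis using sub by (metis mset_subset_size not_less subset_mset.le_imp_less_or_eq)
qed

lemma same_pow_imp_conjugate:
  assumes "x \<in> carrier L" "y \<in> carrier L" "y [^] p = x [^] p"
  obtains i where "i < p" "y = \<zeta> [^] i \<otimes> x"
proof (cases "x = \<zero>")
  case True
  then have "y [^] p = \<zero>" using assms p_gt by (simp add: nat_pow_zero)
  then have "y = \<zero>" using nonzero_pow assms(2) by blast
  then show thesis using that[of 0] True p_gt by simp
next
  case False
  let ?P = "power_poly (x [^] p)"
  have P: "?P \<in> carrier (poly_ring L)" "?P \<noteq> []"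
    using power_poly_props[OF carrier_is_subfield] assms(1) by auto
  have "eval ?P y = \<zero>" using eval_power_poly[of "x [^] p" y] assms by (simp add: minus_eq r_neg)
  then have "y \<in># roots ?P" unfolding roots_mem_iff_is_root[OF P(1)] is_root_def using P(2) assms(2) by simp
  then show thesis using that unfolding roots_power_poly[OF assms(1) False] by auto
qed

lemma root_exists:
  assumes "a \<in> carrier L"
  obtains x where "x \<in> carrier L" "x [^] p = a"
proof -
  have P: "power_poly a \<in> carrier (poly_ring L)" "degree (power_poly a) = p"
    using power_poly_props[OF carrier_is_subfield assms] by auto
  obtain x where x: "x \<in> carrier L" "eval (power_poly a) x = \<zero>"
    using poly_has_root[OF P(1)] P(2) p_gt by auto
  then have "x [^] p = a" using eval_power_poly[OF assms x(1)] assms by simp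
  then show thesis using that x(1) by blast
qed

text \<open>\<open>Irr M x\<close> divides X^p - x^p, whose roots are simple. Not being linear, it
  has a second root \<zeta>^j x with j prime to p; iterating a homomorphism that takes x there
  reaches every \<zeta>^i x, so all p of them are roots of \<open>Irr M x\<close>.\<close>

lemma kummer_simple:
  assumes M: "subfield M L" "F \<subseteq> M" and x: "x \<in> carrier L" "x [^] p \<in> M" "x \<notin> M"
  shows "degree (Irr M x) = p" "\<exists>h\<in>hom_over L M. h x = \<zeta> [^] (i::nat) \<otimes> x"
proof -
  note I = Irr_props[OF M x(1)]
  have x0: "x \<noteq> \<zero>" using x(3) subfield_props(2)[OF M(1)] by blast
  let ?P = "power_poly (x [^] p)" and ?Z = "(\<lambda>i. \<zeta> [^] i \<otimes> x) ` {..<p}"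
  have P: "?P \<in> carrier (M[X])" "degree ?P = p" "?P \<noteq> []"
    using power_poly_props[OF M(1) x(2)] by auto
  have Pc: "?P \<in> carrier (poly_ring L)" using carrier_polynomial_shell[OF subfieldE(1)[OF M(1)] P(1)] .
  have "eval ?P x = \<zero>" using eval_power_poly[of "x [^] p" x] x(1) by (simp add: minus_eq r_neg)
  then have "Irr M x pdivides ?P"
    using Irr_minimal[OF M(1) x(1) algebraic_over[OF M(2) x(1)] P(1)] by blast
  then have sub: "roots (Irr M x) \<subseteq># mset_set ?Z"
    using pdivides_imp_roots_incl[OF I(2) Pc P(3)] roots_power_poly[OF x(1) x0] by simp
  have size: "size (roots (Irr M x)) = degree (Irr M x)"
    using roots_over_carrier[OF I(2)] unfolding splitted_def by simp
  have "\<exists>y. is_root (Irr M x) y \<and> y \<noteq> x"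
  proof (rule ccontr)
    assume "\<not> ?thesis"
    then have "\<And>y. y \<in># roots (Irr M x) \<Longrightarrow> y = x" using roots_mem_iff_is_root[OF I(2)] by blast
    then have "set_mset (roots (Irr M x)) \<subseteq> {x}" by blast
    then have "roots (Irr M x) = replicate_mset (count (roots (Irr M x)) x) x"
      by (metis set_mset_subset_singletonD size_replicate_mset count_replicate_mset)
    then have "size (roots (Irr M x)) = count (roots (Irr M x)) x" by (metis size_replicate_mset)
    also have "\<dots> \<le> count (mset_set ?Z) x" using sub by (simp add: mset_subset_eq_count)
    also have "\<dots> \<le> 1" by (simp add: count_mset_set')
    finally have "degree (Irr M x) = 1" using size I(5) by simp
    then show False using degree_Irr_one[OF M x(1)] x(3) by blast
  qed
  then obtain y where y: "is_root (Irr M x) y" "y \<noteq> x" by blast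
  then have "y \<in># roots (Irr M x)" using roots_mem_iff_is_root[OF I(2)] by blast
  then have "y \<in># mset_set ?Z" using sub mset_subset_eqD by metis
  then obtain j where j: "j < p" "y = \<zeta> [^] j \<otimes> x" by auto
  have "j \<noteq> 0" using j(2) y(2) x(1) by (cases j) auto
  then have cop: "coprime j p"
    using j(1) prime by (metis coprime_commute nat_dvd_not_less not_gr_zero prime_imp_coprime)
  obtain h where h: "h \<in> hom_over L M" "h x = y" using root_hom[OF M x(1) y(1)] .
  have hk: "(h ^^ k) x = \<zeta> [^] (j * k) \<otimes> x" for k :: nat
    using funpow_eigenvector[OF h(1) M(2) x(1)] h(2) j(2) by simp
  have ex: "\<exists>h\<in>hom_over L M. h x = \<zeta> [^] i \<otimes> x" for i :: nat
  proof -
    \<comment> \<open>u inverts j modulo p; after u i iterations the exponent j u i is congruent to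
      i.\<close>
    obtain d u v where d: "d dvd j" "d dvd p" "j * u = p * v + d"
      using bezout_add_strong_nat[OF \<open>j \<noteq> 0\<close>, of p] by blast
    have "d = 1" using coprime_common_divisor_nat[OF cop] d(1,2) by simp
    then have "j * (u * i) = p * (v * i) + i" using d(3) by (metis add_mult_distrib mult.assoc mult_1)
    moreover define k where "k = u * i"
    ultimately have "\<zeta> [^] (j * k) = \<zeta> [^] i"
      using zeta_pow_mod[of "j * k"] zeta_pow_mod[of i] by simp
    then show ?thesis using hk[of k] hom_over_funpow[OF h(1), of k] by metis
  qed
  then show "\<exists>h\<in>hom_over L M. h x = \<zeta> [^] i \<otimes> x" .
  have "z \<in># roots (Irr M x)" if zZ: "z \<in> ?Z" for z
  proof -
    obtain i :: nat where i: "z = \<zeta> [^] i \<otimes> x" using zZ by auto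
    then obtain g where "g \<in> hom_over L M" "g x = z" using ex[of i] by metis
    then show ?thesis using hom_is_root[OF M x(1)] roots_mem_iff_is_root[OF I(2)] by metis
  qed
  then have "mset_set ?Z \<subseteq># roots (Irr M x)"
    by (intro mset_subset_eqI) (simp add: count_mset_set' Suc_leI)
  then have "roots (Irr M x) = mset_set ?Z" using sub by (simp add: subset_mset.antisym)
  then show "degree (Irr M x) = p" using size card_image[OF inj_conjugates[OF x(1) x0]] by simp
qed

lemma simple_kummer_subfield:
  assumes M: "subfield M L" "F \<subseteq> M" and x: "x \<in> carrier L"
  shows "subfield (simple_extension M x) L" "M \<subseteq> simple_extension M x" "x \<in> simple_extension M x"
  using simple_extension_is_subfield[OF M(1) x] algebraic_over[OF M(2) x]
    simple_extension_incl[OF subfieldE(3)[OF M(1)] x] simple_extension_mem[OF subfieldE(1)[OF M(1)] x]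
  by auto

text \<open>The degree is prime, so a y outside M would generate M(x). The homomorphism x -> \<zeta>
  x fixes y, hence would fix x as well, forcing \<zeta> = 1.\<close>

lemma kummer_fixed_simple:
  assumes M: "subfield M L" "F \<subseteq> M" and x: "x \<in> carrier L" "x [^] p \<in> M"
    and y: "y \<in> simple_extension M x" and fixd: "\<And>h. h \<in> hom_over L M \<Longrightarrow> h y = y"
  shows "y \<in> M"
proof (rule ccontr)
  assume yM: "y \<notin> M"
  note S = simple_kummer_subfield[OF M x(1)]
  have xM: "x \<notin> M"
  proof
    assume "x \<in> M"
    then have "simple_extension M x \<subseteq> M"
      using simple_extension_subring_incl[OF subfieldE(1)[OF M(1)] order.refl] by blast
    then show False using y yM by blast
  qed
  have yc: "y \<in> carrier L" using y subfield_props(1)[OF S(1)] by blast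
  have "dimension p M (simple_extension M x)"
    using dimension_simple_extension[OF M(1) x(1) algebraic_over[OF M(2) x(1)]]
      kummer_simple(1)[OF M x xM] by simp
  then have eq: "simple_extension M y = simple_extension M x"
    using simple_extension_eq_of_prime_dimension(1)[OF M S(1,2) _ prime y yM] by blast
  obtain h where h: "h \<in> hom_over L M" "h x = \<zeta> [^] (1::nat) \<otimes> x"
    using kummer_simple(2)[OF M x xM] by blast
  have "h x = id x"
    using hom_over_simple_extension_eq[OF M(1) yc h(1) id_hom_over] fixd[OF h(1)] S(3) eq by simp
  then have "\<zeta> \<otimes> x = \<one> \<otimes> x" using h(2) x(1) by simp
  moreover have "x \<noteq> \<zero>" using xM subfield_props(2)[OF M(1)] by blast
  ultimately have "\<zeta> = \<one>" using x(1) m_rcancel[of x \<zeta> \<one>] by simp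
  then show False using zeta_primitive[of 1] p_gt by simp
qed

text \<open>Each element is built by finitely many field operations; this reduces infinite
  adjunctions to finite ones.\<close>

lemma generate_field_finite_support:
  assumes "A \<subseteq> carrier L" "M \<subseteq> carrier L" "y \<in> generate_field L (M \<union> A)"
  shows "\<exists>B. finite B \<and> B \<subseteq> A \<and> y \<in> generate_field L (M \<union> B)"
  using assms(3)
proof (induct rule: generate_field.induct)
  case one show ?case by (intro exI[of _ "{}"]) (simp add: generate_field.one)
next
  case (incl h)
  show ?case
  proof (cases "h \<in> M")
    case True then show ?thesis by (intro exI[of _ "{}"]) (simp add: generate_field.incl)
  next
    case False then show ?thesis using incl by (intro exI[of _ "{h}"]) (simp add: generate_field.incl)
  qed
next
  case (a_inv h) then show ?case using generate_field.a_inv by metis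
next
  case (m_inv h) then show ?case using generate_field.m_inv by metis
next
  case (eng_add h1 h2)
  then obtain B1 B2 where B: "finite B1" "B1 \<subseteq> A" "h1 \<in> generate_field L (M \<union> B1)"
    "finite B2" "B2 \<subseteq> A" "h2 \<in> generate_field L (M \<union> B2)" by blast
  have "generate_field L (M \<union> B1) \<subseteq> generate_field L (M \<union> (B1 \<union> B2))"
    "generate_field L (M \<union> B2) \<subseteq> generate_field L (M \<union> (B1 \<union> B2))"
    using B(2,5) assms(1,2) by (intro mono_generate_field; blast)+
  then have "h1 \<oplus> h2 \<in> generate_field L (M \<union> (B1 \<union> B2))"
    using B(3,6) by (intro generate_field.eng_add) auto
  then show ?case using B by (intro exI[of _ "B1 \<union> B2"]) auto
next
  case (eng_mult h1 h2)
  then obtain B1 B2 where B: "finite B1" "B1 \<subseteq> A" "h1 \<in> generate_field L (M \<union> B1)"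
    "finite B2" "B2 \<subseteq> A" "h2 \<in> generate_field L (M \<union> B2)" by blast
  have "generate_field L (M \<union> B1) \<subseteq> generate_field L (M \<union> (B1 \<union> B2))"
    "generate_field L (M \<union> B2) \<subseteq> generate_field L (M \<union> (B1 \<union> B2))"
    using B(2,5) assms(1,2) by (intro mono_generate_field; blast)+
  then have "h1 \<otimes> h2 \<in> generate_field L (M \<union> (B1 \<union> B2))"
    using B(3,6) by (intro generate_field.eng_mult) auto
  then show ?case using B by (intro exI[of _ "B1 \<union> B2"]) auto
qed

text \<open>Roots are removed one at a time. A homomorphism over the larger field N = M(B) is also
  one over M, so y is fixed over N and lies in N by the simple case; the induction hypothesis then
  applies.\<close>

lemma kummer_fixed_finite:
  assumes "finite B" "B \<subseteq> {x \<in> carrier L. x [^] p \<in> M}" "subfield M L" "F \<subseteq> M"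
    "y \<in> generate_field L (M \<union> B)" "\<And>h. h \<in> hom_over L M \<Longrightarrow> h y = y"
  shows "y \<in> M"
  using assms
proof (induct B)
  case empty
  then show ?case using generate_field_min_subfield1[of M M] subfieldE(3)[OF empty(2)] by auto
next
  case (insert x B)
  define N where "N = generate_field L (M \<union> B)"
  have Mc: "M \<subseteq> carrier L" using subfieldE(3)[OF insert(5)] .
  have Bc: "M \<union> B \<subseteq> carrier L" using insert(4) Mc by auto
  have N: "subfield N L" unfolding N_def using generate_field_is_subfield[OF Bc] .
  have MN: "M \<union> B \<subseteq> N" unfolding N_def by (intro subsetI generate_field.incl)
  have xc: "x \<in> carrier L" "x [^] p \<in> N" using insert(4) MN by auto
  have FN: "F \<subseteq> N" using insert(6) MN by blast
  note S = simple_kummer_subfield[OF N FN xc(1)]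
  have "generate_field L (M \<union> insert x B) \<subseteq> simple_extension N x"
    using generate_field_min_subfield1[OF _ S(1), of "M \<union> insert x B"] Bc xc(1) S(2,3) MN
    by (metis Un_insert_right insert_subset subset_trans)
  then have "y \<in> simple_extension N x" using insert(7) by blast
  moreover have "h y = y" if "h \<in> hom_over L N" for h
    using insert(8) hom_over_le[OF that, of M] MN by blast
  ultimately have "y \<in> N" using kummer_fixed_simple[OF N FN xc] by blast
  then show ?case using insert(3)[OF _ insert(5,6)] insert(4,8) unfolding N_def by blast
qed

lemma kummer_fixed:
  assumes "B \<subseteq> {x \<in> carrier L. x [^] p \<in> M}" "subfield M L" "F \<subseteq> M"
    "y \<in> generate_field L (M \<union> B)" "\<And>h. h \<in> hom_over L M \<Longrightarrow> h y = y"
  shows "y \<in> M"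
proof -
  obtain A where A: "finite A" "A \<subseteq> B" "y \<in> generate_field L (M \<union> A)"
    using generate_field_finite_support[OF _ subfieldE(3)[OF assms(2)] assms(4)] assms(1) by auto
  have "A \<subseteq> {x \<in> carrier L. x [^] p \<in> M}" using A(2) assms(1) by blast
  from kummer_fixed_finite[OF A(1) this assms(2,3) A(3)] show ?thesis using assms(5) by blast
qed

section \<open>The tower of root adjunctions over F\<close>

abbreviation "kum \<equiv> root_adjunction L p"

lemma kum_props:
  assumes "subfield M L"
  shows "subfield (kum M) L" "M \<subseteq> kum M" "\<And>x. x \<in> carrier L \<Longrightarrow> x [^] p \<in> M \<Longrightarrow> x \<in> kum M"
proof -
  have "M \<union> {x \<in> carrier L. x [^] p \<in> M} \<subseteq> carrier L" using subfieldE(3)[OF assms] by auto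
  then show "subfield (kum M) L" unfolding root_adjunction_def using generate_field_is_subfield by blast
  have "M \<union> {x \<in> carrier L. x [^] p \<in> M} \<subseteq> kum M"
    unfolding root_adjunction_def by (intro subsetI generate_field.incl)
  then show "M \<subseteq> kum M" "\<And>x. x \<in> carrier L \<Longrightarrow> x [^] p \<in> M \<Longrightarrow> x \<in> kum M" by auto
qed

lemma kum_subset_iff:
  assumes "subfield M L" "subfield E L" "M \<subseteq> E" "\<And>x. x \<in> carrier L \<Longrightarrow> x [^] p \<in> M \<Longrightarrow> x \<in> E"
  shows "kum M \<subseteq> E"
  unfolding root_adjunction_def
  using assms subfieldE(3)[OF assms(1)] by (intro generate_field_min_subfield1) auto

lemma kum_mono:
  assumes "subfield M L" "subfield N L" "M \<subseteq> N"
  shows "kum M \<subseteq> kum N"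
  using assms kum_props[OF assms(2)] by (intro kum_subset_iff) auto

lemma kum_stable:
  assumes M: "subfield M L" and st: "stable_over L N M"
  shows "stable_over L N (kum M)"
  unfolding stable_over_def
proof (intro ballI image_subsetI)
  fix h y assume h: "h \<in> hom_over L N" and y: "y \<in> kum M"
  note hh = self_hom[OF hom_overD(1)[OF h]]
  have c: "M \<union> {x \<in> carrier L. x [^] p \<in> M} \<subseteq> carrier L" using subfieldE(3)[OF M] by auto
  show "h y \<in> kum M"
  proof (rule hom_generate_field[OF hom_overD(1)[OF h] c kum_props(1)[OF M] _ y[unfolded root_adjunction_def]])
    fix x assume "x \<in> M \<union> {x \<in> carrier L. x [^] p \<in> M}"
    then consider "x \<in> M" | "x \<in> carrier L" "x [^] p \<in> M" by blast
    then show "h x \<in> kum M"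
    proof cases
      case 1 then show ?thesis using stable_overD[OF st h] kum_props(2)[OF M] by blast
    next
      case 2
      have "h x [^] p \<in> M" using stable_overD[OF st h 2(2)] hh(7)[OF 2(1)] by simp
      then show ?thesis using kum_props(3)[OF M] hh(1)[OF 2(1)] by blast
    qed
  qed
qed

lemma kum_fixed:
  assumes "subfield M L" "F \<subseteq> M" "y \<in> kum M" "\<And>h. h \<in> hom_over L M \<Longrightarrow> h y = y"
  shows "y \<in> M"
  using kummer_fixed[OF order.refl assms(1,2) assms(3)[unfolded root_adjunction_def]] assms(4) by blast

text \<open>The paper's \<open>F^(2)\<close> and \<open>F^(2)^(2)\<close>, described by adjunction of roots.\<close>

definition "F2 = kum F"
definition "F22 = kum F2"

lemma self_stable: "stable_over L M M"
  unfolding stable_over_def using hom_overD(2) by force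

lemma F2_props: "subfield F2 L" "F \<subseteq> F2" "stable_over L F F2"
  "\<And>x. x \<in> carrier L \<Longrightarrow> x [^] p \<in> F \<Longrightarrow> x \<in> F2"
  unfolding F2_def using kum_props[OF F_subfield] kum_stable[OF F_subfield self_stable] by auto

lemma F22_props: "subfield F22 L" "F2 \<subseteq> F22" "F \<subseteq> F22" "stable_over L F F22"
  "\<And>x. x \<in> carrier L \<Longrightarrow> x [^] p \<in> F2 \<Longrightarrow> x \<in> F22"
  unfolding F22_def using kum_props[OF F2_props(1)] kum_stable[OF F2_props(1,3)] F2_props(2) by auto

lemma F22_fixed:
  assumes "y \<in> F22" "\<And>h. h \<in> hom_over L F \<Longrightarrow> h y = y"
  shows "y \<in> F"
proof -
  have "y \<in> F2"
    using kum_fixed[OF F2_props(1,2)] assms hom_over_le[OF _ F2_props(2)] unfolding F22_def by blast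
  then show ?thesis using kum_fixed[OF F_subfield order.refl] assms(2) unfolding F2_def by blast
qed

lemma F22_separable: "x \<in> F22 \<Longrightarrow> separable_over L F x"
  using separable_if_fixed[OF F_subfield order.refl F22_props(1,4)] F22_fixed by blast

text \<open>The minimal polynomial over M divides the one over \<open>F\<close>, so its roots stay
  simple.\<close>

lemma separable_over_mono:
  assumes M: "subfield M L" "F \<subseteq> M" and x: "x \<in> carrier L" "separable_over L F x"
  shows "separable_over L M x"
proof -
  note I = Irr_props[OF M x(1)] and J = Irr_props[OF F_subfield order.refl x(1)]
  have "Irr F x \<in> carrier (M[X])"
    using J(1) M(2) unfolding sym[OF univ_poly_carrier] polynomial_def by auto
  then have "Irr M x pdivides Irr F x"
    using Irr_minimal[OF M(1) x(1) algebraic_over[OF M(2) x(1)]] J(4) by blast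
  then have sub: "roots (Irr M x) \<subseteq># roots (Irr F x)"
    using pdivides_imp_roots_incl[OF I(2) J(2,3)] by blast
  have "alg_mult (Irr M x) y = 1" if y: "is_root (Irr M x) y" for y
  proof -
    have "y \<in># roots (Irr F x)"
      using sub y roots_mem_iff_is_root[OF I(2)] mset_subset_eqD by metis
    then have "alg_mult (Irr F x) y = 1"
      using x(2) roots_mem_iff_is_root[OF J(2)] unfolding separable_over_def by blast
    then have "alg_mult (Irr M x) y \<le> 1"
      using sub alg_mult_eq_count_roots[OF I(2)] alg_mult_eq_count_roots[OF J(2)]
      by (metis mset_subset_eq_count)
    moreover have "alg_mult (Irr M x) y > 0"
      using alg_mult_gt_zero_iff_is_root[OF I(2)] y by blast
    ultimately show ?thesis by simp
  qed
  then show ?thesis unfolding separable_over_def using algebraic_over[OF M(2) x(1)] by blast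
qed

abbreviation "sep \<equiv> separable_closure L F"

lemma F22_sep: "F22 \<subseteq> sep"
  unfolding separable_closure_def using F22_separable subfield_props(1)[OF F22_props(1)] by auto

text \<open>Containment in \<open>F22\<close> supplies separability; stability gives normality,
  because \<open>root_hom\<close> realises every conjugate by a homomorphism.\<close>

lemma galois_if_stable:
  assumes M: "subfield M L" "F \<subseteq> M" and E: "subfield E L" "M \<subseteq> E" "E \<subseteq> F22" "stable_over L M E"
  shows "galois_extension L M E"
  unfolding galois_extension_def
proof (intro conjI ballI allI impI M(1) E(1,2))
  fix x assume x: "x \<in> E"
  have xc: "x \<in> carrier L" using x subfield_props(1)[OF E(1)] by blast
  show "separable_over L M x" using separable_over_mono[OF M xc] F22_separable x E(3) by blast
  fix y assume "is_root (Irr M x) y"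
  then obtain h where "h \<in> hom_over L M" "h x = y" using root_hom[OF M xc] by blast
  then show "y \<in> E" using stable_overD[OF E(4)] x by blast
qed

end

lemma (in group) carrier_eq_nat_powers:
  assumes g: "g \<in> carrier G" and gen: "carrier G = range (\<lambda>n::int. g [^] n)" and n: "0 < n" "g [^] (n::nat) = \<one>"
  shows "carrier G = (\<lambda>i::nat. g [^] i) ` {..<n}"
proof
  show "(\<lambda>i::nat. g [^] i) ` {..<n} \<subseteq> carrier G" using g by auto
  show "carrier G \<subseteq> (\<lambda>i::nat. g [^] i) ` {..<n}"
  proof
    fix x assume "x \<in> carrier G"
    then obtain k :: int where k: "x = g [^] k" using gen by auto
    define r where "r = nat (k mod int n)"
    have r: "r < n" "int r = k mod int n" unfolding r_def using n(1) by (simp_all add: nat_less_iff)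
    have "x = g [^] (int n * (k div int n) + int r)" using k r(2) by simp
    also have "\<dots> = (g [^] int n) [^] (k div int n) \<otimes> g [^] int r"
      by (simp only: int_pow_mult[OF g] int_pow_pow[OF g])
    also have "\<dots> = g [^] r" using n(2) g by (simp add: int_pow_int)
    finally show "x \<in> (\<lambda>i::nat. g [^] i) ` {..<n}" using r(1) by blast
  qed
qed

section \<open>Cyclic extensions of degree p are simple Kummer extensions\<close>

context kummer
begin

lemma hom_root:
  assumes "h \<in> hom_over L M" "x \<in> carrier L" "x [^] p \<in> M"
  obtains i where "i < p" "h x = \<zeta> [^] i \<otimes> x"
proof -
  note hh = self_hom[OF hom_overD(1)[OF assms(1)]]
  have "h x [^] p = x [^] p" using hh(7)[OF assms(2), of p] hom_overD(2)[OF assms(1,3)] by simp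
  then show thesis using same_pow_imp_conjugate[OF assms(2) hh(1)[OF assms(2)]] that by blast
qed

lemma stable_simple_extension:
  assumes M: "subfield M L" "F \<subseteq> M" "stable_over L N M" and x: "x \<in> carrier L"
    and hx: "\<And>h. h \<in> hom_over L N \<Longrightarrow> h x \<in> simple_extension M x"
  shows "stable_over L N (simple_extension M x)"
  unfolding stable_over_def
proof (intro ballI image_subsetI)
  fix h y assume h: "h \<in> hom_over L N" and y: "y \<in> simple_extension M x"
  note S = simple_kummer_subfield[OF M(1,2) x]
  have T: "subfield {z \<in> carrier L. h z \<in> simple_extension M x} L"
    using image_subfield[OF hom_overD(1)[OF h] S(1)] .
  have "M \<subseteq> {z \<in> carrier L. h z \<in> simple_extension M x}"
    using subfieldE(3)[OF M(1)] stable_overD[OF M(3) h] S(2) by blast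
  then have "simple_extension M x \<subseteq> {z \<in> carrier L. h z \<in> simple_extension M x}"
    using simple_extension_subring_incl[OF subfieldE(1)[OF T]] hx[OF h] x by simp
  then show "h y \<in> simple_extension M x" using y by blast
qed

text \<open>The automorphism x -> \<zeta> x generates: every other one multiplies x by some
  \<zeta>^i and is determined by its value at x, so it is the i-th power.\<close>

lemma kummer_cyclic:
  assumes M: "subfield M L" "F \<subseteq> M" "M \<subseteq> F22" and x: "x \<in> F22" "x [^] p \<in> M" "x \<notin> M"
  shows "cyclic_extension L p M (simple_extension M x)" "simple_extension M x \<subseteq> F22"
proof -
  let ?E = "simple_extension M x"
  have xc: "x \<in> carrier L" using x(1) subfield_props(1)[OF F22_props(1)] by blast
  note S = simple_kummer_subfield[OF M(1,2) xc]
  note Sc = subfield_props[OF S(1)]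
  show E22: "?E \<subseteq> F22"
    using simple_extension_subring_incl[OF subfieldE(1)[OF F22_props(1)] M(3) x(1)] .
  have st: "stable_over L M ?E"
  proof (rule stable_simple_extension[OF M(1,2) self_stable xc])
    fix h assume "h \<in> hom_over L M"
    then obtain i where i: "h x = \<zeta> [^] (i::nat) \<otimes> x" using hom_root[OF _ xc x(2)] by metis
    have "\<zeta> [^] i \<in> ?E" using S(2) M(2) zeta_pow_F by (meson subsetD)
    then show "h x \<in> ?E" using Sc(5)[OF _ S(3)] i by simp
  qed
  have gal: "galois_extension L M ?E" using galois_if_stable[OF M(1,2) S(1,2) E22 st] .
  have dim: "dimension p M ?E"
    using dimension_simple_extension[OF M(1) xc algebraic_over[OF M(2) xc]]
      kummer_simple(1)[OF M(1,2) xc x(2,3)] by simp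
  interpret G: group "galois_group L M ?E" using group_galois_group[OF S(1,2)] .
  obtain h where h: "h \<in> hom_over L M" "h x = \<zeta> [^] (1::nat) \<otimes> x"
    using kummer_simple(2)[OF M(1,2) xc x(2,3)] by blast
  define g where "g = restrict h ?E"
  have g: "g \<in> carrier (galois_group L M ?E)"
    unfolding g_def using restrict_in_galois_group[OF M(1,2) S(2,1) st h(1)] .
  have hk: "(h ^^ k) x = \<zeta> [^] k \<otimes> x" for k :: nat
    using funpow_eigenvector[OF h(1) M(2) xc h(2), of k] by simp
  have hE: "(g ^^ k) y = (h ^^ k) y \<and> (h ^^ k) y \<in> ?E" if "y \<in> ?E" for k y
    using that stable_overD[OF st h(1)] by (induct k) (auto simp: g_def)
  have "\<tau> \<in> range (\<lambda>n::int. g [^]\<^bsub>galois_group L M ?E\<^esub> n)" if \<tau>: "\<tau> \<in> carrier (galois_group L M ?E)" for \<tau>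
  proof -
    obtain k where k: "k \<in> hom_over L M" "\<tau> = restrict k ?E"
      using galois_group_lift[OF M(2) S(2,1) \<tau>] by blast
    obtain i where i: "k x = \<zeta> [^] (i::nat) \<otimes> x" using hom_root[OF k(1) xc x(2)] by metis
    have "\<tau> = g [^]\<^bsub>galois_group L M ?E\<^esub> i"
    proof (rule galois_group_ext[OF \<tau> G.nat_pow_closed[OF g]])
      fix y assume y: "y \<in> ?E"
      have "k y = (h ^^ i) y"
        using hom_over_simple_extension_eq[OF M(1) xc k(1) hom_over_funpow[OF h(1)] _ y] i hk by simp
      then show "\<tau> y = (g [^]\<^bsub>galois_group L M ?E\<^esub> i) y"
        using y k(2) hE[OF y, of i] galois_group_pow[OF S(1,2) g y, of i] by simp
    qed
    then have "\<tau> = g [^]\<^bsub>galois_group L M ?E\<^esub> (int i)" by (simp add: int_pow_int)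
    then show ?thesis by blast
  qed
  then have "carrier (galois_group L M ?E) = range (\<lambda>n::int. g [^]\<^bsub>galois_group L M ?E\<^esub> n)"
    using g by auto
  then have "cyclic_group (galois_group L M ?E)" unfolding G.cyclic_group using g by blast
  then show "cyclic_extension L p M ?E" unfolding cyclic_extension_def using gal dim by blast
qed

text \<open>Cyclic reindexing of a sum whose summands have period n; it is what makes the Lagrange
  resolvent an eigenvector.\<close>

lemma finsum_shift:
  assumes "f \<in> UNIV \<rightarrow> carrier L" "f 0 = f n"
  shows "(\<Oplus>i\<in>{..<n}. f (Suc i)) = (\<Oplus>i\<in>{..<n::nat}. f i)"
proof (cases n)
  case (Suc m)
  have "(\<Oplus>i\<in>{..<Suc m}. f (Suc i)) = (\<Oplus>i\<in>{..m}. f (Suc i))" by (simp add: lessThan_Suc_atMost)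
  also have "\<dots> \<oplus> f 0 = (\<Oplus>i\<in>{..Suc m}. f i)"
    using assms(1) by (intro finsum_Suc2[symmetric]) auto
  also have "\<dots> = f (Suc m) \<oplus> (\<Oplus>i\<in>{..m}. f i)" using assms(1) by (intro finsum_Suc) auto
  finally have "(\<Oplus>i\<in>{..<n}. f (Suc i)) \<oplus> f 0 = (\<Oplus>i\<in>{..<n}. f i) \<oplus> f 0"
    using assms Suc by (simp add: lessThan_Suc_atMost a_comm Pi_def)
  then show ?thesis using assms(1) by (simp add: Pi_def)
qed simp

text \<open>A fixed y is its own only conjugate; separability makes that root simple, so
  \<open>Irr M y\<close> is linear.\<close>

lemma galois_fixed:
  assumes M: "subfield M L" "F \<subseteq> M" and gal: "galois_extension L M E" and y: "y \<in> E"
    and fixd: "\<And>h. h \<in> hom_over L M \<Longrightarrow> h y = y"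
  shows "y \<in> M"
proof -
  have E: "subfield E L" using gal unfolding galois_extension_def by blast
  have yc: "y \<in> carrier L" using y subfield_props(1)[OF E] by blast
  note I = Irr_props[OF M yc]
  have "z = y" if "z \<in># roots (Irr M y)" for z
  proof -
    have "is_root (Irr M y) z" using that roots_mem_iff_is_root[OF I(2)] by blast
    then obtain h where "h \<in> hom_over L M" "h y = z" using root_hom[OF M yc] by blast
    then show ?thesis using fixd by blast
  qed
  then have "set_mset (roots (Irr M y)) \<subseteq> {y}" by blast
  then have r: "roots (Irr M y) = replicate_mset (count (roots (Irr M y)) y) y"
    by (metis set_mset_subset_singletonD size_replicate_mset count_replicate_mset)
  have "is_root (Irr M y) y" unfolding is_root_def using I(3,4) yc by simp
  then have "count (roots (Irr M y)) y = 1"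
    using gal y alg_mult_eq_count_roots[OF I(2)]
    unfolding galois_extension_def separable_over_def by metis
  then have "degree (Irr M y) = 1"
    using r roots_over_carrier[OF I(2)] unfolding splitted_def by (metis size_replicate_mset)
  then show ?thesis using degree_Irr_one[OF M yc] by blast
qed

text \<open>Evaluation at the generator a is a bijection from the group onto the roots of
  \<open>Irr M a\<close>, and there are p of these because they are simple.\<close>

lemma card_galois_group_prime:
  assumes M: "subfield M L" "F \<subseteq> M" and gal: "galois_extension L M E"
    and dim: "dimension p M E" and a: "a \<in> E" "a \<notin> M"
  shows "card (carrier (galois_group L M E)) = p"
proof -
  have E: "subfield E L" "M \<subseteq> E" using gal unfolding galois_extension_def by blast+
  have ac: "a \<in> carrier L" using a(1) subfield_props(1)[OF E(1)] by blast
  note I = Irr_props[OF M ac]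
  note st = galois_stable[OF gal M(2)]
  note deg = simple_extension_eq_of_prime_dimension[OF M E dim prime a]
  let ?R = "{y. is_root (Irr M a) y}"
  have "bij_betw (\<lambda>\<tau>. \<tau> a) (carrier (galois_group L M E)) ?R"
  proof (rule bij_betwI')
    fix \<sigma> \<tau> assume s: "\<sigma> \<in> carrier (galois_group L M E)" and t: "\<tau> \<in> carrier (galois_group L M E)"
    obtain g where g: "g \<in> hom_over L M" "\<sigma> = restrict g E" using galois_group_lift[OF M(2) E(2,1) s] by blast
    obtain h where h: "h \<in> hom_over L M" "\<tau> = restrict h E" using galois_group_lift[OF M(2) E(2,1) t] by blast
    show "(\<sigma> a = \<tau> a) = (\<sigma> = \<tau>)"
    proof
      assume "\<sigma> a = \<tau> a"
      then have "g a = h a" using g h a(1) by simp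
      then have "g y = h y" if "y \<in> E" for y
        using hom_over_simple_extension_eq[OF M(1) ac g(1) h(1)] that deg(1) by blast
      then show "\<sigma> = \<tau>" unfolding g h by (intro restrict_ext) simp
    qed simp
  next
    fix \<tau> assume "\<tau> \<in> carrier (galois_group L M E)"
    then obtain h where "h \<in> hom_over L M" "\<tau> = restrict h E" using galois_group_lift[OF M(2) E(2,1)] by blast
    then show "\<tau> a \<in> ?R" using hom_is_root[OF M ac] a(1) by simp
  next
    fix y assume "y \<in> ?R"
    then obtain h where h: "h \<in> hom_over L M" "h a = y" using root_hom[OF M ac] by blast
    then show "\<exists>\<tau>\<in>carrier (galois_group L M E). y = \<tau> a"
      using restrict_in_galois_group[OF M E(2,1) st h(1)] a(1) by (intro bexI[of _ "restrict h E"]) auto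
  qed
  then have "card (carrier (galois_group L M E)) = card ?R" by (rule bij_betw_same_card)
  moreover have "roots (Irr M a) = mset_set ?R"
  proof (rule multiset_eqI)
    fix y
    have fin: "finite ?R" using finite_number_of_roots[OF I(2)] .
    show "count (roots (Irr M a)) y = count (mset_set ?R) y"
    proof (cases "is_root (Irr M a) y")
      case True
      then have "alg_mult (Irr M a) y = 1"
        using gal a(1) unfolding galois_extension_def separable_over_def by blast
      then show ?thesis using True fin alg_mult_eq_count_roots[OF I(2)] by simp
    next
      case False
      then have "alg_mult (Irr M a) y = 0" using alg_mult_gt_zero_iff_is_root[OF I(2)] by blast
      then show ?thesis using False fin alg_mult_eq_count_roots[OF I(2)] by simp
    qed
  qed
  ultimately show ?thesis
    using roots_over_carrier[OF I(2)] deg(2) unfolding splitted_def by simp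
qed

text \<open>With h a lift of a generator, the Lagrange resolvent r, the sum of \<zeta>^i h^i(y) for
  i < p, satisfies \<zeta> h(r) = r. So a nonzero r is moved by h while r^p is fixed. Some y gives r
  \<noteq> 0 by independence of the p distinct characters h^i on E.\<close>

lemma cyclic_is_kummer:
  assumes M: "subfield M L" "F \<subseteq> M" and cyc: "cyclic_extension L p M E"
  obtains x where "x \<in> E" "x \<notin> M" "x [^] p \<in> M" "E = simple_extension M x"
proof -
  have gal: "galois_extension L M E" and cg: "cyclic_group (galois_group L M E)"
    and dim: "dimension p M E" using cyc unfolding cyclic_extension_def by auto
  have E: "subfield E L" "M \<subseteq> E" using gal unfolding galois_extension_def by blast+
  note Ec = subfield_props[OF E(1)]
  note st = galois_stable[OF gal M(2)]
  interpret G: group "galois_group L M E" using group_galois_group[OF E] .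
  have "E \<noteq> M" using dimension_is_inj[OF M(1) dim] dimension_one[OF M(1)] p_gt by auto
  then obtain a where a: "a \<in> E" "a \<notin> M" using E(2) by blast
  have card: "card (carrier (galois_group L M E)) = p" using card_galois_group_prime[OF M gal dim a] .
  obtain g where g: "g \<in> carrier (galois_group L M E)"
    and gen: "carrier (galois_group L M E) = range (\<lambda>n::int. g [^]\<^bsub>galois_group L M E\<^esub> n)"
    using cg unfolding G.cyclic_group by blast
  have gp: "g [^]\<^bsub>galois_group L M E\<^esub> p = \<one>\<^bsub>galois_group L M E\<^esub>"
    using G.pow_order_eq_1[OF g] card unfolding order_def by simp
  have powers: "carrier (galois_group L M E) = (\<lambda>i::nat. g [^]\<^bsub>galois_group L M E\<^esub> i) ` {..<p}"
    using G.carrier_eq_nat_powers[OF g gen p_gt(2) gp] .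
  then have inj: "inj_on (\<lambda>i::nat. g [^]\<^bsub>galois_group L M E\<^esub> i) {..<p}"
    using card by (intro eq_card_imp_inj_on) auto
  obtain h where h: "h \<in> hom_over L M" "g = restrict h E" using galois_group_lift[OF M(2) E(2,1) g] by blast
  note hh = self_hom[OF hom_overD(1)[OF h(1)]]
  have hE: "(g ^^ k) y = (h ^^ k) y \<and> (h ^^ k) y \<in> E" if "y \<in> E" for k y
    using that stable_overD[OF st h(1)] h(2) by (induct k) auto
  have gh: "(g [^]\<^bsub>galois_group L M E\<^esub> k) y = (h ^^ k) y" if "y \<in> E" for k :: nat and y
    using galois_group_pow[OF E g that] hE[OF that] by simp
  have hp: "(h ^^ p) y = y" if "y \<in> E" for y
    using gh[OF that, of p] gp that by (simp add: galois_group_one)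
  have hfix: "y \<in> M" if y: "y \<in> E" "h y = y" for y
  proof (rule galois_fixed[OF M gal y(1)])
    fix k assume k: "k \<in> hom_over L M"
    then have "restrict k E \<in> carrier (galois_group L M E)" using restrict_in_galois_group[OF M E(2,1) st] by blast
    then obtain i where i: "restrict k E = g [^]\<^bsub>galois_group L M E\<^esub> (i::nat)" using powers by auto
    have "(h ^^ i) y = y" by (induct i) (auto simp: y(2))
    then show "k y = y" using gh[OF y(1), of i] i y(1) by (metis restrict_apply')
  qed
  have "\<exists>y\<in>E. (\<Oplus>i\<in>{..<p}. \<zeta> [^] i \<otimes> (h ^^ i) y) \<noteq> \<zero>"
  proof (rule ccontr)
    assume n: "\<not> ?thesis"
    have "\<zeta> [^] (0::nat) = \<zero>"
    proof (rule dedekind_independence[of "{..<p}" E "\<lambda>i. h ^^ i" "\<lambda>i. \<zeta> [^] i"])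
      show "(h ^^ i) x \<in> carrier L" if "x \<in> E" for i x using hE[OF that] Ec(1) by blast
      show "(h ^^ i) \<one> = \<one>" for i
        using self_hom(3)[OF hom_overD(1)[OF hom_over_funpow[OF h(1)]]] .
      show "(h ^^ i) (x \<otimes> y) = (h ^^ i) x \<otimes> (h ^^ i) y" if "x \<in> E" "y \<in> E" for i x y
        using self_hom(5)[OF hom_overD(1)[OF hom_over_funpow[OF h(1)]]] that Ec(1) by blast
      show "\<exists>x\<in>E. (h ^^ i) x \<noteq> (h ^^ j) x" if ij: "i \<in> {..<p}" "j \<in> {..<p}" "i \<noteq> j" for i j
      proof (rule ccontr)
        assume "\<not> ?thesis"
        then have "g [^]\<^bsub>galois_group L M E\<^esub> i = g [^]\<^bsub>galois_group L M E\<^esub> j"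
          by (intro galois_group_ext[of _ L M E]) (use g gh in auto)
        then show False using inj ij by (auto simp: inj_on_def)
      qed
    qed (use Ec n p_gt in auto)
    then show False using zeta_pow_nonzero by blast
  qed
  then obtain y where y: "y \<in> E" and nz: "(\<Oplus>i\<in>{..<p}. \<zeta> [^] i \<otimes> (h ^^ i) y) \<noteq> \<zero>" by blast
  define r where "r = (\<Oplus>i\<in>{..<p}. \<zeta> [^] i \<otimes> (h ^^ i) y)"
  have yi: "(h ^^ i) y \<in> E" for i using hE[OF y] by blast
  have yc: "(h ^^ i) y \<in> carrier L" for i using yi Ec(1) by blast
  have zE: "\<zeta> [^] (i::nat) \<in> E" for i using zeta_pow_F M(2) E(2) by blast
  have rE: "r \<in> E"
  proof -
    have "(\<Oplus>i\<in>A. \<zeta> [^] i \<otimes> (h ^^ i) y) \<in> E" if "finite A" for A :: "nat set"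
      using that by (induct A) (use yi yc zE Ec in auto)
    then show ?thesis unfolding r_def by blast
  qed
  have rc: "r \<in> carrier L" using rE Ec(1) by blast
  have zr: "\<zeta> \<otimes> h r = r"
  proof -
    interpret hc: ring_hom_cring L L h
      using hom_overD(1)[OF h(1)] by unfold_locales
    have "h r = (\<Oplus>i\<in>{..<p}. h (\<zeta> [^] i \<otimes> (h ^^ i) y))"
      unfolding r_def using yc by (subst hc.hom_finsum) (auto simp: comp_def)
    then have "\<zeta> \<otimes> h r = \<zeta> \<otimes> (\<Oplus>i\<in>{..<p}. h (\<zeta> [^] i \<otimes> (h ^^ i) y))" by simp
    also have "\<dots> = (\<Oplus>i\<in>{..<p}. \<zeta> \<otimes> h (\<zeta> [^] i \<otimes> (h ^^ i) y))"
      using yc hh by (intro finsum_rdistr) auto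
    also have "\<dots> = (\<Oplus>i\<in>{..<p}. \<zeta> [^] Suc i \<otimes> (h ^^ Suc i) y)"
    proof (rule finsum_cong')
      fix i :: nat
      have "h (\<zeta> [^] i) = \<zeta> [^] i" using hom_zeta[OF h(1) M(2)] .
      then have "\<zeta> \<otimes> h (\<zeta> [^] i \<otimes> (h ^^ i) y) = \<zeta> \<otimes> (\<zeta> [^] i \<otimes> h ((h ^^ i) y))"
        using yc hh(5) by simp
      also have "\<dots> = \<zeta> [^] Suc i \<otimes> h ((h ^^ i) y)"
        using m_assoc[OF zeta_closed _ hh(1)[OF yc], of "\<zeta> [^] i" i] nat_pow_Suc2[OF zeta_closed, of i] by simp
      finally show "\<zeta> \<otimes> h (\<zeta> [^] i \<otimes> (h ^^ i) y) = \<zeta> [^] Suc i \<otimes> (h ^^ Suc i) y" by simp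
    qed (use yc hh in auto)
    \<comment> \<open>The summand of index p wraps around to index 0, since \<zeta>^p = 1 and h^p y
      = y.\<close>
    also have "\<dots> = r"
      unfolding r_def
      by (rule finsum_shift[of "\<lambda>i. \<zeta> [^] i \<otimes> (h ^^ i) y"])
         (use yc yc[of 0] hp[OF y] in \<open>auto simp: zeta_pow\<close>)
    finally show ?thesis .
  qed
  have hrc: "h r \<in> carrier L" using hh(1)[OF rc] .
  have r0: "r \<noteq> \<zero>" using nz unfolding r_def .
  have rM: "r \<notin> M"
  proof
    assume "r \<in> M"
    then have "\<zeta> \<otimes> r = \<one> \<otimes> r" using zr hom_overD(2)[OF h(1)] rc by simp
    then have "\<zeta> = \<one>" using m_rcancel[of r \<zeta> \<one>] rc r0 by simp
    then show False using zeta_primitive[of 1] p_gt by simp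
  qed
  have "r [^] p = (\<zeta> \<otimes> h r) [^] p" using zr by simp
  also have "\<dots> = h (r [^] p)" using hrc hh(7)[OF rc] by (simp add: nat_pow_distrib zeta_pow)
  finally have rp: "r [^] p \<in> M" using hfix[of "r [^] p"] Ec(9)[OF rE] by simp
  show thesis
    using that[OF rE rM rp] simple_extension_eq_of_prime_dimension(1)[OF M E dim prime rE rM] by simp
qed

lemma cyclic_subset_kum:
  assumes M: "subfield M L" "F \<subseteq> M" and cyc: "cyclic_extension L p M E"
  shows "E \<subseteq> kum M"
proof -
  have "subfield E L" using cyc unfolding cyclic_extension_def galois_extension_def by blast
  then have Ec: "E \<subseteq> carrier L" using subfieldE(3) by blast
  obtain x where x: "x \<in> E" "x [^] p \<in> M" "E = simple_extension M x" using cyclic_is_kummer[OF assms] by blast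
  have "x \<in> kum M" using kum_props(3)[OF M(1)] x Ec by blast
  then show ?thesis
    unfolding x(3) using simple_extension_subring_incl[OF subfieldE(1)[OF kum_props(1)[OF M(1)]] kum_props(2)[OF M(1)]]
    by blast
qed

text \<open>One inclusion is \<open>cyclic_is_kummer\<close>, the other
  \<open>kummer_cyclic\<close>. The bound by \<open>F22\<close> places the simple Kummer extensions
  inside the separable closure, as the family in \<open>second_ext\<close> demands.\<close>

lemma second_ext_eq:
  assumes M: "subfield M L" "F \<subseteq> M" "kum M \<subseteq> F22"
  shows "second_ext L sep p M = kum M"
proof
  let ?\<E> = "{E. E \<subseteq> sep \<and> cyclic_extension L p M E}"
  have sub: "\<Union>?\<E> \<subseteq> kum M" using cyclic_subset_kum[OF M(1,2)] by blast
  have c: "M \<union> \<Union>?\<E> \<subseteq> carrier L"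
    by (rule Un_least[OF subfieldE(3)[OF M(1)] order_trans[OF sub subfieldE(3)[OF kum_props(1)[OF M(1)]]]])
  show "second_ext L sep p M \<subseteq> kum M"
    unfolding second_ext_def compositum_def
    using generate_field_min_subfield1[OF c kum_props(1)[OF M(1)]] kum_props(2)[OF M(1)] sub by blast
  have S: "subfield (second_ext L sep p M) L" "M \<union> \<Union>?\<E> \<subseteq> second_ext L sep p M"
    unfolding second_ext_def compositum_def
    using generate_field_is_subfield[OF c] by (auto intro: generate_field.incl)
  show "kum M \<subseteq> second_ext L sep p M"
  proof (rule kum_subset_iff[OF M(1) S(1)])
    show "M \<subseteq> second_ext L sep p M" using S(2) by blast
    fix x assume x: "x \<in> carrier L" "x [^] p \<in> M"
    show "x \<in> second_ext L sep p M"
    proof (cases "x \<in> M")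
      case False
      have M22: "M \<subseteq> F22" "x \<in> F22" using kum_props[OF M(1)] M(3) x by blast+
      note kc = kummer_cyclic[OF M(1,2) M22 x(2) False]
      have "simple_extension M x \<in> ?\<E>" using kc F22_sep by blast
      then show ?thesis using S(2) simple_kummer_subfield(3)[OF M(1,2) x(1)] by blast
    qed (use S(2) in blast)
  qed
qed

end

subsection \<open>Maximal subgroups of extensions of elementary abelian groups\<close>

lemma (in group) inv_mult_cancel:
  assumes "x \<in> carrier G" "y \<in> carrier G"
  shows "inv x \<otimes> (x \<otimes> y) = y" "x \<otimes> (inv x \<otimes> y) = y"
  using assms by (simp_all add: m_assoc[symmetric])

text \<open>The binomial expansion of (1 + T)^k in multiplicative notation, T being the shift of the
  sequence s; the recursion for u is Pascal's rule.\<close>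

lemma (in comm_monoid) binomial_sequence:
  assumes s: "\<And>i. s i \<in> carrier G" and u0: "\<And>i. u 0 i = s i"
    and u: "\<And>k i. u (Suc k) i = u k (Suc i) \<otimes> u k i"
  shows "u k i = (\<Otimes>j\<in>{..k::nat}. s (i + j) [^] (k choose j))"
proof (induct k arbitrary: i)
  case 0 then show ?case using s u0 by simp
next
  case (Suc k)
  \<comment> \<open>The exponents are k choose (j - 1), with value 0 at j = 0, so both products run
    over the same index set and multiply factor by factor.\<close>
  let ?a = "\<lambda>j. s (i + j) [^] (case j of 0 \<Rightarrow> 0 | Suc j' \<Rightarrow> k choose j')"
  have "u k i = (\<Otimes>j\<in>{..Suc k}. s (i + j) [^] (k choose j))"
    using Suc[of i] s by (subst finprod_Suc) (auto simp: binomial_eq_0)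
  moreover have "u k (Suc i) = (\<Otimes>j\<in>{..Suc k}. ?a j)"
    using Suc[of "Suc i"] s by (subst finprod_Suc2) auto
  ultimately have "u (Suc k) i = (\<Otimes>j\<in>{..Suc k}. ?a j) \<otimes> (\<Otimes>j\<in>{..Suc k}. s (i + j) [^] (k choose j))"
    unfolding u[of k i] by (rule arg_cong2[rotated])
  also have "\<dots> = (\<Otimes>j\<in>{..Suc k}. ?a j \<otimes> s (i + j) [^] (k choose j))"
    using s by (intro finprod_multf[symmetric]) auto
  also have "\<dots> = (\<Otimes>j\<in>{..Suc k}. s (i + j) [^] (Suc k choose j))"
    using s by (intro finprod_cong') (auto simp: nat_pow_mult split: nat.split)
  finally show ?case .
qed

text \<open>All inner binomial coefficients are divisible by p, so in exponent p only the two outer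
  factors survive: (1 + T)^p = 1 + T^p.\<close>

lemma (in comm_monoid) binomial_sequence_prime:
  assumes p: "Factorial_Ring.prime (p::nat)" and s: "\<And>i. s i \<in> carrier G" "\<And>i. s i [^] p = \<one>"
    and u: "\<And>i. u 0 i = s i" "\<And>k i. u (Suc k) i = u k (Suc i) \<otimes> u k i"
  shows "u p i = s (i + p) \<otimes> s i"
proof -
  obtain q where q: "p = Suc q" using prime_gt_0_nat[OF p] by (metis Suc_pred)
  have one: "s (i + j) [^] (p choose j) = \<one>" if "0 < j" "j < p" for j
  proof -
    have "p dvd p choose j" using dvd_choose_prime p that by auto
    then obtain m where "p choose j = p * m" by blast
    then show ?thesis using s by (simp add: nat_pow_pow[symmetric])
  qed
  have "u p i = (\<Otimes>j\<in>{..Suc q}. s (i + j) [^] (p choose j))"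
    using binomial_sequence[where s = s and u = u and k = p and i = i] s(1) u q by simp
  also have "\<dots> = s (i + p) \<otimes> (\<Otimes>j\<in>{..q}. s (i + j) [^] (p choose j))"
    using s(1) q by (subst finprod_Suc) auto
  also have "(\<Otimes>j\<in>{..q}. s (i + j) [^] (p choose j)) = (\<Otimes>j\<in>{..q}. if j = 0 then s i else \<one>)"
    using s(1) one q by (intro finprod_cong') auto
  also have "\<dots> = s i" using s(1) finprod_singleton[of 0 "{..q}" "\<lambda>j. s i"] by (simp add: eq_commute)
  finally show ?thesis .
qed

definition (in group) conj_by :: "'a \<Rightarrow> 'a \<Rightarrow> 'a"
  where "conj_by g x = g \<otimes> x \<otimes> inv g"

lemma (in group) conj_by_simps:
  assumes "g \<in> carrier G" "x \<in> carrier G" 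
  shows "conj_by g x \<in> carrier G" "conj_by g (inv x) = inv (conj_by g x)" "conj_by \<one> x = x"
    and "y \<in> carrier G \<Longrightarrow> conj_by g (x \<otimes> y) = conj_by g x \<otimes> conj_by g y"
    and "h \<in> carrier G \<Longrightarrow> conj_by (g \<otimes> h) x = conj_by g (conj_by h x)"
    and "g \<otimes> x = conj_by g x \<otimes> g"
  using assms by (auto simp: conj_by_def m_assoc inv_mult_group inv_mult_cancel)

text \<open>Let \<open>N\<close> be normal with \<open>N\<close> and \<open>G/N\<close> abelian of exponent \<open>p\<close>.  For \<open>h \<in> G\<close>, conjugation by \<open>h\<close> is
  an operator on the vector space \<open>N\<close> over the field with \<open>p\<close> elements with \<open>(h - 1)^p = h^p - 1 = 0\<close>, and
  any two such operators commute.\<close>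

locale elementary_tower = group G for G (structure) +
  fixes N :: "'a set" and p :: nat
  assumes p: "Factorial_Ring.prime p" and N: "subgroup N G"
    and N_normal: "\<And>g x. g \<in> carrier G \<Longrightarrow> x \<in> N \<Longrightarrow> conj_by g x \<in> N"
    and N_comm: "\<And>x y. x \<in> N \<Longrightarrow> y \<in> N \<Longrightarrow> x \<otimes> y = y \<otimes> x"
    and N_exp: "\<And>x. x \<in> N \<Longrightarrow> x [^] p = \<one>"
    and quot_comm: "\<And>g h. g \<in> carrier G \<Longrightarrow> h \<in> carrier G \<Longrightarrow> g \<otimes> h \<otimes> inv (h \<otimes> g) \<in> N"
    and quot_exp: "\<And>g. g \<in> carrier G \<Longrightarrow> g [^] p \<in> N"
begin

lemma N_closed: "x \<in> N \<Longrightarrow> x \<in> carrier G" using subgroup.mem_carrier[OF N] .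

sublocale Nc: comm_group "G\<lparr>carrier := N\<rparr>"
proof -
  interpret NG: group "G\<lparr>carrier := N\<rparr>" using subgroup.subgroup_is_group[OF N is_group] .
  show "comm_group (G\<lparr>carrier := N\<rparr>)"
    by (rule NG.group_comm_groupI) (use N_comm in simp)
qed

lemma conj_by_N: "x \<in> N \<Longrightarrow> y \<in> N \<Longrightarrow> conj_by x y = y"
  using N_comm[of x y] N_closed unfolding conj_by_def by (simp add: m_assoc)

text \<open>The commutator of g and h lies in N, and N, being abelian, acts trivially on itself by
  conjugation.\<close>

lemma conj_by_commute:
  assumes g: "g \<in> carrier G" and h: "h \<in> carrier G" and x: "x \<in> N"
  shows "conj_by g (conj_by h x) = conj_by h (conj_by g x)"
proof -
  define c where "c = g \<otimes> h \<otimes> inv (h \<otimes> g)"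
  have c: "c \<in> N" "c \<in> carrier G" unfolding c_def using quot_comm[OF g h] N_closed by auto
  have xc: "x \<in> carrier G" using x N_closed by blast
  have hg: "h \<otimes> g \<in> carrier G" using g h by blast
  have "c \<otimes> (h \<otimes> g) = g \<otimes> h" unfolding c_def using g h by (simp add: m_assoc)
  then have "conj_by g (conj_by h x) = conj_by (c \<otimes> (h \<otimes> g)) x" using g h xc conj_by_simps(5) by metis
  also have "\<dots> = conj_by c (conj_by (h \<otimes> g) x)" using conj_by_simps(5)[OF c(2) xc hg] .
  also have "\<dots> = conj_by (h \<otimes> g) x" using conj_by_N[OF c(1) N_normal[OF hg x]] .
  also have "\<dots> = conj_by h (conj_by g x)" using conj_by_simps(5)[OF h xc g] .
  finally show ?thesis .
qed

text \<open>The operator h - 1 of the group ring, written multiplicatively.\<close>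

definition delta :: "'a \<Rightarrow> 'a \<Rightarrow> 'a" where "delta h x = conj_by h x \<otimes> inv x"

lemma delta_N: "h \<in> carrier G \<Longrightarrow> x \<in> N \<Longrightarrow> delta h x \<in> N"
  unfolding delta_def using N_normal subgroup.m_closed[OF N] subgroup.m_inv_closed[OF N] by blast

lemma N_mult_ac: "x \<in> N \<Longrightarrow> y \<in> N \<Longrightarrow> z \<in> N \<Longrightarrow> w \<in> N \<Longrightarrow> (x \<otimes> y) \<otimes> (z \<otimes> w) = (x \<otimes> z) \<otimes> (y \<otimes> w)"
  using Nc.m_assoc Nc.m_comm Nc.m_closed by simp

lemma delta_mult:
  assumes h: "h \<in> carrier G" and x: "x \<in> N" and y: "y \<in> N"
  shows "delta h (x \<otimes> y) = delta h x \<otimes> delta h y"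
proof -
  have i: "inv x \<in> N" "inv y \<in> N" using x y subgroup.m_inv_closed[OF N] by auto
  have "delta h (x \<otimes> y) = (conj_by h x \<otimes> conj_by h y) \<otimes> (inv x \<otimes> inv y)"
    unfolding delta_def using conj_by_simps(4)[OF h] x y N_closed inv_mult_group N_comm[OF i] by simp
  also have "\<dots> = (conj_by h x \<otimes> inv x) \<otimes> (conj_by h y \<otimes> inv y)"
    using N_mult_ac[OF N_normal[OF h x] N_normal[OF h y] i] .
  finally show ?thesis unfolding delta_def .
qed

lemma delta_conj_by:
  assumes h: "h \<in> carrier G" and k: "k \<in> carrier G" and x: "x \<in> N"
  shows "delta h (conj_by k x) = conj_by k (delta h x)"
proof -
  have xc: "x \<in> carrier G" "conj_by h x \<in> carrier G" using x N_closed conj_by_simps(1)[OF h] by auto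
  show ?thesis
    unfolding delta_def using conj_by_simps(2,4)[OF k] xc conj_by_commute[OF h k x] by simp
qed

text \<open>Conjugation by h is 1 + \<open>delta h\<close>, so conjugation by h^p is 1 +
  (\<open>delta h\<close>)^p by the binomial formula. But h^p lies in N and acts trivially on
  N.\<close>

lemma delta_nilpotent:
  assumes h: "h \<in> carrier G" and x: "x \<in> N"
  shows "(delta h ^^ p) x = \<one>"
proof -
  define s where "s i = (delta h ^^ i) x" for i
  define u where "u k i = conj_by (h [^] k) (s i)" for k :: nat and i
  have sN: "s i \<in> N" for i unfolding s_def by (induct i) (use x delta_N[OF h] in auto)
  have sc: "s i \<in> carrier G" for i using sN N_closed by blast
  have hk: "h [^] (k::nat) \<in> carrier G" for k using h by blast
  \<comment> \<open>On the iterates of \<open>delta h\<close> the operator \<open>delta h\<close> is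
    the shift, which matches the recursion of \<open>binomial_sequence\<close>.\<close>
  have step: "conj_by h (s i) = s (Suc i) \<otimes> s i" for i
    using sc[of i] h conj_by_simps(1)[OF h sc[of i]] unfolding s_def by (simp add: delta_def m_assoc)
  have us: "u (Suc k) i = u k (Suc i) \<otimes> u k i" for k i
    unfolding u_def
    using conj_by_simps(5)[OF hk sc h, of k i] step[of i] conj_by_simps(4)[OF hk sc sc, of k "Suc i" i] by simp
  have "u p 0 = s (0 + p) \<otimes> s 0"
    using Nc.binomial_sequence_prime[OF p, of s u 0] sN N_exp us sc
    by (simp add: u_def conj_by_simps(3)[OF one_closed] nat_pow_consistent[symmetric])
  moreover have "u p 0 = s 0" unfolding u_def using conj_by_N[OF quot_exp[OF h] sN] .
  ultimately have "s p \<otimes> s 0 = \<one> \<otimes> s 0" using sc by simp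
  then have "s p = \<one>" using right_cancel[OF sc sc one_closed] by blast
  then show ?thesis unfolding s_def .
qed

end

text \<open>\<open>H\<close> is maximal but not known to be normal. Normality is the content of what
  follows: N normalises \<open>H\<close> (\<open>conj_by_N_H\<close>), and the powers of s, which
  lie in N, together with \<open>H\<close> fill the group (\<open>decompose\<close>).\<close>

locale elementary_tower_maximal = elementary_tower +
  fixes H s
  assumes H: "subgroup H G" and max: "\<And>H'. subgroup H' G \<Longrightarrow> H \<subseteq> H' \<Longrightarrow> H' = H \<or> H' = carrier G"
    and s: "s \<in> N" "s \<notin> H"
begin

lemma H_closed: "x \<in> H \<Longrightarrow> x \<in> carrier G" using subgroup.mem_carrier[OF H] .

lemmas H_props = subgroup.m_closed[OF H] subgroup.m_inv_closed[OF H] subgroup.one_closed[OF H]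
lemmas N_props = subgroup.m_closed[OF N] subgroup.m_inv_closed[OF N] subgroup.one_closed[OF N]

lemma conj_by_H: "h \<in> H \<Longrightarrow> x \<in> H \<Longrightarrow> conj_by h x \<in> H"
  unfolding conj_by_def using H_props by blast

lemma subgroup_product:
  assumes K: "K \<subseteq> N" "\<one> \<in> K" "\<And>x y. x \<in> K \<Longrightarrow> y \<in> K \<Longrightarrow> x \<otimes> y \<in> K" "\<And>x. x \<in> K \<Longrightarrow> inv x \<in> K"
    and conj: "\<And>h x. h \<in> H \<Longrightarrow> x \<in> K \<Longrightarrow> conj_by h x \<in> K"
  shows "subgroup {x \<otimes> h | x h. x \<in> K \<and> h \<in> H} G"
proof (rule subgroupI)
  have Kc: "x \<in> carrier G" if "x \<in> K" for x using that K(1) N_closed by blast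
  show "{x \<otimes> h | x h. x \<in> K \<and> h \<in> H} \<subseteq> carrier G" using Kc H_closed by blast
  show "{x \<otimes> h | x h. x \<in> K \<and> h \<in> H} \<noteq> {}" using K(2) H_props(3) by blast
  fix a assume "a \<in> {x \<otimes> h | x h. x \<in> K \<and> h \<in> H}"
  then obtain x h where a: "a = x \<otimes> h" "x \<in> K" "h \<in> H" by blast
  have "inv a = inv h \<otimes> inv x" using a Kc H_closed inv_mult_group by simp
  also have "\<dots> = conj_by (inv h) (inv x) \<otimes> inv h"
    using conj_by_simps(6)[of "inv h" "inv x"] a Kc H_closed by simp
  finally show "inv a \<in> {x \<otimes> h | x h. x \<in> K \<and> h \<in> H}"
    using conj[OF H_props(2)[OF a(3)] K(4)[OF a(2)]] H_props(2)[OF a(3)] by blast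
  fix b assume "b \<in> {x \<otimes> h | x h. x \<in> K \<and> h \<in> H}"
  then obtain y k where b: "b = y \<otimes> k" "y \<in> K" "k \<in> H" by blast
  have "a \<otimes> b = x \<otimes> (h \<otimes> y) \<otimes> k" using a b Kc H_closed by (simp add: m_assoc)
  also have "h \<otimes> y = conj_by h y \<otimes> h" using conj_by_simps(6) a b Kc H_closed by blast
  also have "x \<otimes> (conj_by h y \<otimes> h) \<otimes> k = (x \<otimes> conj_by h y) \<otimes> (h \<otimes> k)"
    using a b Kc H_closed conj_by_simps(1) by (simp add: m_assoc)
  finally show "a \<otimes> b \<in> {x \<otimes> h | x h. x \<in> K \<and> h \<in> H}"
    using K(3)[OF a(2) conj[OF a(3) b(2)]] H_props(1)[OF a(3) b(3)] by blast
qed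

text \<open>The set K of all y in N with \<open>delta h y\<close> in \<open>H\<close> is stable
  under conjugation by \<open>H\<close>, because \<open>delta h\<close> commutes with conjugation.
  So K H is a subgroup above \<open>H\<close>, equal to \<open>H\<close> or to everything. In the
  second case x = y k with y in K and k in both N and \<open>H\<close>, and \<open>delta h\<close>
  maps both factors into \<open>H\<close>.\<close>

lemma delta_in_H:
  assumes h: "h \<in> H" and x: "x \<in> N"
  shows "delta h x \<in> H"
proof -
  have hc: "h \<in> carrier G" using h H_closed by blast
  define K where "K = {y \<in> N. delta h y \<in> H}"
  let ?P = "{x \<otimes> h | x h. x \<in> K \<and> h \<in> H}"
  have dinv: "delta h (inv y) = inv (delta h y)" if "y \<in> N" for y
  proof -
    have "delta h (inv y) \<otimes> delta h y = delta h \<one>"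
      using delta_mult[OF hc N_props(2)[OF that] that] that N_closed by simp
    also have "\<dots> = \<one>" unfolding delta_def conj_by_def using hc by simp
    finally show ?thesis
      using inv_equality delta_N[OF hc] that N_props(2) N_closed by metis
  qed
  have d1: "delta h \<one> = \<one>" unfolding delta_def conj_by_def using hc by simp
  have "subgroup ?P G"
  proof (rule subgroup_product)
    show "K \<subseteq> N" unfolding K_def by blast
    show "\<one> \<in> K" unfolding K_def using N_props(3) H_props(3) d1 by simp
    show "x \<otimes> y \<in> K" if "x \<in> K" "y \<in> K" for x y
      using that delta_mult[OF hc] N_props(1) H_props(1) unfolding K_def by simp
    show "inv x \<in> K" if "x \<in> K" for x
      using that dinv N_props(2) H_props(2) unfolding K_def by simp
    show "conj_by k x \<in> K" if "k \<in> H" "x \<in> K" for k x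
      using that delta_conj_by[OF hc H_closed] N_normal[OF H_closed] conj_by_H unfolding K_def by simp
  qed
  moreover have "H \<subseteq> ?P"
  proof
    fix k assume k: "k \<in> H"
    have "\<one> \<in> K" unfolding K_def using N_props(3) H_props(3) d1 by simp
    moreover have "k = \<one> \<otimes> k" using k H_closed by simp
    ultimately show "k \<in> ?P" using k by blast
  qed
  ultimately consider "?P = H" | "?P = carrier G" using max by blast
  then show ?thesis
  proof cases
    case 1
    have KH: "y \<in> H" if y: "y \<in> K" for y
    proof -
      have "y = y \<otimes> \<one>" using y N_closed unfolding K_def by simp
      then have "y \<in> ?P" using y H_props(3) by blast
      then show ?thesis using 1 by simp
    qed
    \<comment> \<open>If K H = H then K \<subseteq> H, so \<open>delta h\<close> never carries an
      element of N outside \<open>H\<close> into \<open>H\<close>. Starting from s this contradicts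
      nilpotency at i = p.\<close>
    have "(delta h ^^ i) s \<in> N \<and> (delta h ^^ i) s \<notin> H" for i
    proof (induct i)
      case (Suc i)
      then have "(delta h ^^ i) s \<notin> K" using KH by blast
      then show ?case using Suc delta_N[OF hc] unfolding K_def by simp
    qed (use s in simp)
    then have "(delta h ^^ p) s \<notin> H" by blast
    then show ?thesis using delta_nilpotent[OF hc s(1)] H_props(3) by simp
  next
    case 2
    then have "x \<in> ?P" using x N_closed by blast
    then obtain y k where y: "x = y \<otimes> k" "y \<in> N" "delta h y \<in> H" "k \<in> H" unfolding K_def by blast
    have "k = inv y \<otimes> x" using y N_closed H_closed by (simp add: m_assoc[symmetric])
    then have kN: "k \<in> N" using N_props x y(2) by simp
    have "delta h k \<in> H" unfolding delta_def using conj_by_H[OF h y(4)] H_props y(4) by blast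
    then show ?thesis using delta_mult[OF hc y(2) kN] y H_props(1) by simp
  qed
qed

text \<open>x h x^-1 equals h times \<open>delta (inv h) x\<close>, and the second factor is in
  \<open>H\<close> by \<open>delta_in_H\<close>.\<close>

lemma conj_by_N_H:
  assumes x: "x \<in> N" and h: "h \<in> H"
  shows "conj_by x h \<in> H"
proof -
  have c: "x \<in> carrier G" "h \<in> carrier G" using x h N_closed H_closed by auto
  have "delta (inv h) x \<in> H" using delta_in_H[OF H_props(2)[OF h] x] .
  then have "h \<otimes> delta (inv h) x \<in> H" using H_props(1)[OF h] by blast
  moreover have "h \<otimes> delta (inv h) x = conj_by x h"
    unfolding delta_def conj_by_def using c by (simp add: m_assoc[symmetric])
  ultimately show ?thesis by simp
qed

lemma s_pow_N: "s [^] (i::nat) \<in> N"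
  by (induct i) (use s N_props in auto)

lemma s_pow_in_H_iff: "s [^] (i::nat) \<in> H \<longleftrightarrow> p dvd i"
proof
  have sc: "s \<in> carrier G" using s N_closed by blast
  show "s [^] i \<in> H" if pi: "p dvd i"
  proof -
    obtain m where "i = p * m" using pi by blast
    then have "s [^] i = \<one>" using sc N_exp[OF s(1)] by (simp add: nat_pow_pow[symmetric] nat_pow_one)
    then show ?thesis using H_props(3) by simp
  qed
  show "p dvd i" if iH: "s [^] i \<in> H"
  proof (rule ccontr)
    assume n: "\<not> p dvd i"
    then have cop: "coprime i p" using p by (metis coprime_commute prime_imp_coprime)
    have "i \<noteq> 0" using n by (metis dvd_0_right)
    then obtain d u v where d: "d dvd i" "d dvd p" "i * u = p * v + d"
      using bezout_add_strong_nat[of i p] by blast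
    have "d = 1" using coprime_common_divisor_nat[OF cop] d(1,2) by simp
    then have e: "i * u = p * v + 1" using d(3) by simp
    have "(s [^] i) [^] u \<in> H" by (induct u) (use iH H_props in auto)
    moreover have "(s [^] i) [^] u = s [^] (p * v) \<otimes> s" using e sc by (simp add: nat_pow_pow)
    moreover have "s [^] (p * v) = \<one>" using sc N_exp[OF s(1)] by (simp add: nat_pow_pow[symmetric] nat_pow_one)
    ultimately show False using s(2) sc by simp
  qed
qed

text \<open>Since N normalises \<open>H\<close>, the products of powers of s with elements of
  \<open>H\<close> form a subgroup. It strictly contains \<open>H\<close>, so maximality makes it
  everything.\<close>

lemma decompose:
  assumes "g \<in> carrier G"
  shows "\<exists>i::nat. \<exists>h\<in>H. g = s [^] i \<otimes> h"
proof -
  have sc: "s \<in> carrier G" using s N_closed by blast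
  let ?K = "range (\<lambda>i::nat. s [^] i)"
  let ?P = "{x \<otimes> h | x h. x \<in> ?K \<and> h \<in> H}"
  have sp: "s [^] p = \<one>" using N_exp[OF s(1)] .
  have P: "subgroup ?P G"
  proof (rule subgroupI)
    show "?P \<subseteq> carrier G" using sc H_closed by auto
    show "?P \<noteq> {}" using H_props(3) by blast
    fix a assume "a \<in> ?P"
    then obtain i h where a: "a = s [^] (i::nat) \<otimes> h" "h \<in> H" by auto
    have hc: "h \<in> carrier G" using a H_closed by blast
    \<comment> \<open>Only natural exponents are in play; the inverse of s^i is written s^(i (p -
      1)), using s^p = 1.\<close>
    have "s [^] (i * (p - 1)) \<otimes> s [^] i = s [^] (p * i)"
      using sc prime_gt_0_nat[OF p] by (simp add: nat_pow_mult algebra_simps)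
    also have "\<dots> = \<one>" using sc sp by (simp add: nat_pow_pow[symmetric] nat_pow_one)
    finally have iv: "inv (s [^] i) = s [^] (i * (p - 1))" using inv_equality sc by simp
    have "inv a = inv h \<otimes> inv (s [^] i)" using a sc hc inv_mult_group by simp
    also have "\<dots> = s [^] (i * (p - 1)) \<otimes> conj_by (s [^] i) (inv h)"
      unfolding conj_by_def iv[symmetric] using sc hc by (simp add: m_assoc[symmetric])
    finally show "inv a \<in> ?P" using conj_by_N_H[OF s_pow_N H_props(2)[OF a(2)]] by blast
    fix b assume "b \<in> ?P"
    then obtain j k where b: "b = s [^] (j::nat) \<otimes> k" "k \<in> H" by auto
    have kc: "k \<in> carrier G" using b H_closed by blast
    have "a \<otimes> b = s [^] i \<otimes> (s [^] j \<otimes> inv (s [^] j)) \<otimes> h \<otimes> s [^] j \<otimes> k"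
      using a b sc hc kc by (simp add: m_assoc inv_mult_cancel)
    also have "\<dots> = s [^] (i + j) \<otimes> (conj_by (inv (s [^] j)) h \<otimes> k)"
      unfolding conj_by_def using sc hc kc by (simp add: m_assoc nat_pow_mult[symmetric] inv_mult_cancel)
    finally show "a \<otimes> b \<in> ?P"
      using conj_by_N_H[OF N_props(2)[OF s_pow_N] a(2)] H_props(1) b(2) by blast
  qed
  have "h \<in> ?P" if "h \<in> H" for h
  proof -
    have "h = s [^] (0::nat) \<otimes> h" using that H_closed by simp
    then show ?thesis using that by blast
  qed
  moreover have "s \<in> ?P"
  proof -
    have "s = s [^] (1::nat) \<otimes> \<one>" using sc by simp
    then show ?thesis using H_props(3) by blast
  qed
  ultimately have "?P = carrier G" using max[OF P] s(2) by blast
  then show ?thesis using assms by blast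
qed

text \<open>\<chi> is the exponent of s in \<open>decompose\<close>, in effect the projection onto
  the quotient by \<open>H\<close>. It is well defined modulo p by \<open>s_pow_in_H_iff\<close> and
  additive because powers of s normalise \<open>H\<close>. Natural numbers read modulo p serve
  directly as exponents of \<zeta> later.\<close>

lemma exists_character:
  obtains \<chi> :: "'a \<Rightarrow> nat" where
    "\<And>g h. g \<in> carrier G \<Longrightarrow> h \<in> carrier G \<Longrightarrow> \<chi> (g \<otimes> h) mod p = (\<chi> g + \<chi> h) mod p"
    "\<And>h. h \<in> H \<Longrightarrow> \<chi> h mod p = 0" "\<chi> s mod p = 1"
proof -
  have sc: "s \<in> carrier G" using s N_closed by blast
  define \<chi> where "\<chi> g = (SOME i::nat. \<exists>h\<in>H. g = s [^] i \<otimes> h)" for g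
  have ex: "\<exists>h\<in>H. g = s [^] (\<chi> g) \<otimes> h" if "g \<in> carrier G" for g
    unfolding \<chi>_def using someI_ex[OF decompose[OF that]] .
  have le: "i mod p = j mod p" if "s [^] i \<otimes> h = s [^] j \<otimes> k" "h \<in> H" "k \<in> H" "i \<le> j" for i j :: nat and h k
  proof -
    have c: "h \<in> carrier G" "k \<in> carrier G" using that H_closed by auto
    have e: "s [^] i \<otimes> h = s [^] i \<otimes> (s [^] (j - i) \<otimes> k)"
      using that(1,4) sc c by (simp add: m_assoc[symmetric] nat_pow_mult)
    have "s [^] i \<in> carrier G" "s [^] (j - i) \<otimes> k \<in> carrier G" using sc c by auto
    then have "h = s [^] (j - i) \<otimes> k" using e c(1) Units_l_cancel Units_eq by blast
    then have "s [^] (j - i) = h \<otimes> inv k" using sc c by (simp add: m_assoc)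
    then have "s [^] (j - i) \<in> H" using that H_props by simp
    then have "p dvd j - i" using s_pow_in_H_iff by blast
    then show ?thesis using that(4) by (metis mod_eq_dvd_iff_nat)
  qed
  have uniq: "i mod p = j mod p" if "s [^] i \<otimes> h = s [^] j \<otimes> k" "h \<in> H" "k \<in> H" for i j :: nat and h k
  proof (cases "i \<le> j")
    case True show ?thesis by (rule le[OF that True])
  next
    case False then show ?thesis by (intro le[OF that(1)[symmetric] that(3,2), symmetric]) simp
  qed
  show thesis
  proof (rule that)
    fix g h assume gh: "g \<in> carrier G" "h \<in> carrier G"
    obtain a where a: "a \<in> H" "g = s [^] (\<chi> g) \<otimes> a" using ex[OF gh(1)] by blast
    obtain b where b: "b \<in> H" "h = s [^] (\<chi> h) \<otimes> b" using ex[OF gh(2)] by blast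
    obtain c where c: "c \<in> H" "g \<otimes> h = s [^] (\<chi> (g \<otimes> h)) \<otimes> c" using ex gh by blast
    have ac: "a \<in> carrier G" "b \<in> carrier G" using a b H_closed by auto
    let ?i = "\<chi> g" and ?j = "\<chi> h"
    have "g \<otimes> h = (s [^] ?i \<otimes> a) \<otimes> (s [^] ?j \<otimes> b)" using a b by simp
    also have "\<dots> = s [^] ?i \<otimes> (s [^] ?j \<otimes> inv (s [^] ?j)) \<otimes> a \<otimes> s [^] ?j \<otimes> b"
      using sc ac by (simp add: m_assoc inv_mult_cancel)
    also have "\<dots> = s [^] (?i + ?j) \<otimes> (conj_by (inv (s [^] ?j)) a \<otimes> b)"
      unfolding conj_by_def using sc ac by (simp add: m_assoc nat_pow_mult[symmetric] inv_mult_cancel)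
    finally have e: "s [^] (\<chi> (g \<otimes> h)) \<otimes> c = s [^] (?i + ?j) \<otimes> (conj_by (inv (s [^] ?j)) a \<otimes> b)"
      using c(2) by simp
    show "\<chi> (g \<otimes> h) mod p = (?i + ?j) mod p"
      by (rule uniq[OF e c(1) H_props(1)[OF conj_by_N_H[OF N_props(2)[OF s_pow_N] a(1)] b(1)]])
  next
    fix h assume h: "h \<in> H"
    obtain a where a: "a \<in> H" "h = s [^] (\<chi> h) \<otimes> a" using ex[OF H_closed[OF h]] by blast
    have "s [^] (\<chi> h) \<otimes> a = s [^] (0::nat) \<otimes> h" using a h H_closed by simp
    from uniq[OF this a(1) h] show "\<chi> h mod p = 0" by simp
  next
    obtain a where a: "a \<in> H" "s = s [^] (\<chi> s) \<otimes> a" using ex[OF sc] by blast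
    have "s [^] (\<chi> s) \<otimes> a = s [^] (1::nat) \<otimes> \<one>" using a sc by simp
    from uniq[OF this a(1) H_props(3)] have "\<chi> s mod p = 1 mod p" .
    then show "\<chi> s mod p = 1" using prime_gt_1_nat[OF p] by simp
  qed
qed

end

subsection \<open>The Frattini subgroup and Kummer generators\<close>

lemma (in field) hom_agree_on_generate_field:
  assumes g: "g \<in> ring_hom R R" and h: "h \<in> ring_hom R R" and A: "A \<subseteq> carrier R"
    and eq: "\<And>x. x \<in> A \<Longrightarrow> g x = h x" and y: "y \<in> generate_field R A"
  shows "g y = h y"
proof -
  note gg = self_hom[OF g] and hh = self_hom[OF h]
  have "subfield {x \<in> carrier R. g x = h x} R"
  proof (rule subfieldI')
    show "subring {x \<in> carrier R. g x = h x} R"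
      by (rule subringI) (use gg(3-6) hh(3-6) in auto)
    show "inv k \<in> {x \<in> carrier R. g x = h x}" if "k \<in> {x \<in> carrier R. g x = h x} - {\<zero>}" for k
      using that gg(8)[of k] hh(8)[of k] field_Units by auto
  qed
  moreover have "A \<subseteq> {x \<in> carrier R. g x = h x}" using A eq by auto
  ultimately have "generate_field R A \<subseteq> {x \<in> carrier R. g x = h x}"
    using generate_field_min_subfield1[OF A] by simp
  then show ?thesis using y by auto
qed

lemma galois_group_mem:
  assumes "\<sigma> \<in> carrier (galois_group L K E)"
  shows "x \<in> E \<Longrightarrow> \<sigma> x \<in> E" "x \<in> K \<Longrightarrow> \<sigma> x = x"
  using assms Bij_imp_funcset unfolding galois_group_def by auto

lemma galois_group_mult_apply:
  assumes "\<sigma> \<in> carrier (galois_group L K E)" "\<tau> \<in> carrier (galois_group L K E)" "x \<in> E"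
  shows "(\<sigma> \<otimes>\<^bsub>galois_group L K E\<^esub> \<tau>) x = \<sigma> (\<tau> x)"
  unfolding galois_group_mult[OF assms(1,2)] using assms(3) by (simp add: compose_def)

lemma (in field) galois_group_inv_apply:
  assumes E: "subfield E R" "K \<subseteq> E" and s: "s \<in> carrier (galois_group R K E)" and x: "x \<in> E"
  shows "(inv\<^bsub>galois_group R K E\<^esub> s) (s x) = x" "s ((inv\<^bsub>galois_group R K E\<^esub> s) x) = x"
proof -
  interpret G: group "galois_group R K E" using group_galois_group[OF E] .
  have i: "inv\<^bsub>galois_group R K E\<^esub> s \<in> carrier (galois_group R K E)" using s by simp
  show "(inv\<^bsub>galois_group R K E\<^esub> s) (s x) = x"
    using galois_group_mult_apply[OF i s x] G.l_inv[OF s] x by (simp add: galois_group_one)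
  show "s ((inv\<^bsub>galois_group R K E\<^esub> s) x) = x"
    using galois_group_mult_apply[OF s i x] G.r_inv[OF s] x by (simp add: galois_group_one)
qed

lemma (in field) hom_agree_on_Span:
  assumes K: "subfield K R" and g: "g \<in> ring_hom R R" and h: "h \<in> ring_hom R R"
    and Us: "set Us \<subseteq> carrier R"
    and eq: "\<And>x. x \<in> K \<Longrightarrow> g x = h x" "\<And>x. x \<in> set Us \<Longrightarrow> g x = h x" and y: "y \<in> Span K Us"
  shows "g y = h y"
proof -
  note gg = self_hom[OF g] and hh = self_hom[OF h]
  obtain Ks where Ks: "set Ks \<subseteq> K" "y = combine Ks Us"
    using y Span_eq_combine_set[OF K Us] by blast
  have "combine Ks Us \<in> carrier R \<and> g (combine Ks Us) = h (combine Ks Us)"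
    using Ks(1) Us eq(2)
  proof (induct Ks Us rule: combine.induct)
    case (1 k Ks u Us)
    then have "k \<in> carrier R" "g k = h k" "u \<in> carrier R" "g u = h u"
      using subfieldE(3)[OF K] eq(1) by auto
    then show ?case using 1 gg(4,5) hh(4,5) by simp
  qed (simp_all only: combine.simps zero_closed gg(2) hh(2) simp_thms)
  then show ?thesis using Ks(2) by simp
qed

text \<open>Membership in a basic coset of Gal(E/M) depends only on the values at a finite spanning
  list of M over K, and finite intersections and unions preserve this finiteness around a given
  point. The lifts in \<open>lift\<close> spread agreement from the list to all of M by
  linearity.\<close>

lemma krull_open_finite_agreement:
  assumes E: "field L" "subfield E L" "K \<subseteq> E" and K: "subfield K L"
    and lift: "\<And>\<tau>. \<tau> \<in> carrier (galois_group L K E) \<Longrightarrow> \<exists>h\<in>ring_hom L L. \<forall>x\<in>E. \<tau> x = h x"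
    and op: "openin (krull_topology L K E) H" and t: "\<tau> \<in> H" "\<tau> \<in> carrier (galois_group L K E)"
  shows "\<exists>A. finite A \<and> A \<subseteq> E \<and> (\<forall>\<rho>\<in>carrier (galois_group L K E). (\<forall>x\<in>A. \<rho> x = \<tau> x) \<longrightarrow> \<rho> \<in> H)"
proof -
  interpret L: field L by fact
  let ?G = "galois_group L K E"
  interpret G: group ?G using L.group_galois_group[OF E(2,3)] .
  have "generate_topology_on {\<sigma> <#\<^bsub>?G\<^esub> carrier (galois_group L M E) | \<sigma> M.
      \<sigma> \<in> carrier ?G \<and> subfield M L \<and> K \<subseteq> M \<and> M \<subseteq> E \<and> ring.finite_dimension L K M} H"
    using op openin_topology_generated_by unfolding krull_topology_def by blast
  then show ?thesis using t(1)
  proof (induct rule: generate_topology_on.induct)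
    case Empty then show ?case by blast
  next
    case (Int a b)
    obtain A where A: "finite A" "A \<subseteq> E" "\<forall>\<rho>\<in>carrier ?G. (\<forall>x\<in>A. \<rho> x = \<tau> x) \<longrightarrow> \<rho> \<in> a"
      using Int by blast
    obtain B where B: "finite B" "B \<subseteq> E" "\<forall>\<rho>\<in>carrier ?G. (\<forall>x\<in>B. \<rho> x = \<tau> x) \<longrightarrow> \<rho> \<in> b"
      using Int by blast
    show ?case using A B by (intro exI[of _ "A \<union> B"]) auto
  next
    case (UN K)
    then obtain k where k: "k \<in> K" "\<tau> \<in> k" by blast
    then show ?case using UN(2)[OF k] by blast
  next
    case (Basis s)
    then obtain \<sigma> M where s: "s = \<sigma> <#\<^bsub>?G\<^esub> carrier (galois_group L M E)" and \<sigma>: "\<sigma> \<in> carrier ?G"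
      and M: "subfield M L" "K \<subseteq> M" "M \<subseteq> E" "L.finite_dimension K M" by blast
    obtain Us where Us: "set Us \<subseteq> carrier L" "L.Span K Us = M"
      using L.exists_base[OF K L.finite_dimensionE[OF K M(4)]] by blast
    have UsE: "set Us \<subseteq> E" using L.Span_base_incl[OF K Us(1)] Us(2) M(3) by blast
    obtain \<kappa> where \<kappa>: "\<kappa> \<in> carrier (galois_group L M E)" "\<tau> = \<sigma> \<otimes>\<^bsub>?G\<^esub> \<kappa>"
      using Basis(2) unfolding s l_coset_def by blast
    have kG: "\<kappa> \<in> carrier ?G" using \<kappa>(1) M(2) unfolding galois_group_def by auto
    have "\<rho> \<in> s" if \<rho>: "\<rho> \<in> carrier ?G" and eq: "\<forall>x\<in>set Us. \<rho> x = \<tau> x" for \<rho>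
    proof -
      obtain g where g: "g \<in> ring_hom L L" "\<forall>x\<in>E. \<rho> x = g x" using lift[OF \<rho>] by blast
      obtain h where h: "h \<in> ring_hom L L" "\<forall>x\<in>E. \<tau> x = h x" using lift[OF t(2)] by blast
      have "g x = h x" if "x \<in> K" for x
        using galois_group_mem(2)[OF \<rho> that] galois_group_mem(2)[OF t(2) that] g(2) h(2) that E(3) by force
      moreover have "g x = h x" if "x \<in> set Us" for x
        using that eq g(2) h(2) UsE by force
      ultimately have gh: "g m = h m" if "m \<in> M" for m
        using L.hom_agree_on_Span[OF K g(1) h(1) Us(1)] that Us(2) by blast
      \<comment> \<open>\<rho>, \<tau> and \<sigma> agree on M, so this quotient fixes M pointwise
        and \<rho> lies in the coset of \<sigma>.\<close>
      define \<mu> where "\<mu> = inv\<^bsub>?G\<^esub> \<sigma> \<otimes>\<^bsub>?G\<^esub> \<rho>"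
      have \<mu>: "\<mu> \<in> carrier ?G" unfolding \<mu>_def using \<sigma> \<rho> by simp
      have "\<mu> m = m" if m: "m \<in> M" for m
      proof -
        have mE: "m \<in> E" using m M(3) by blast
        have "\<rho> m = \<tau> m" using gh[OF m] g(2) h(2) mE by simp
        also have "\<dots> = \<sigma> m"
          using galois_group_mult_apply[OF \<sigma> kG mE] \<kappa>(2) galois_group_mem(2)[OF \<kappa>(1) m] by simp
        finally show ?thesis
          using galois_group_mult_apply[OF _ \<rho> mE, of "inv\<^bsub>?G\<^esub> \<sigma>"] \<sigma>
            L.galois_group_inv_apply(1)[OF E(2,3) \<sigma> mE] unfolding \<mu>_def by simp
      qed
      then have "\<mu> \<in> carrier (galois_group L M E)" using \<mu> unfolding galois_group_def by auto
      moreover have "\<rho> = \<sigma> \<otimes>\<^bsub>?G\<^esub> \<mu>"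
        unfolding \<mu>_def using \<sigma> \<rho> by (simp add: G.m_assoc[symmetric])
      ultimately show ?thesis unfolding s l_coset_def by blast
    qed
    then show ?case using UsE by (intro exI[of _ "set Us"]) auto
  qed
qed

text \<open>On each generating root a homomorphism over M multiplies by a power of \<zeta>, which
  lies in M. Such multiplications commute and have trivial p-th power, and agreement on generators
  extends to the generated field.\<close>

lemma (in kummer) kummer_hom_commute:
  assumes M: "subfield M L" "F \<subseteq> M" and A: "A \<subseteq> {x \<in> carrier L. x [^] p \<in> M}"
    and g: "g \<in> hom_over L M" and h: "h \<in> hom_over L M" and y: "y \<in> generate_field L (M \<union> A)"
  shows "g (h y) = h (g y)" "(h ^^ p) y = y"
proof -
  note gg = self_hom[OF hom_overD(1)[OF g]] and hh = self_hom[OF hom_overD(1)[OF h]]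
  have c: "M \<union> A \<subseteq> carrier L" using A subfieldE(3)[OF M(1)] by blast
  have comm: "g (h x) = h (g x) \<and> (h ^^ p) x = x" if "x \<in> M \<union> A" for x
  proof (cases "x \<in> M")
    case True
    have "(h ^^ n) x = x" for n by (induct n) (simp_all add: hom_overD(2)[OF h True])
    then show ?thesis using hom_overD(2)[OF g True] hom_overD(2)[OF h True] by simp
  next
    case False
    then have x: "x \<in> carrier L" "x [^] p \<in> M" using that A by auto
    obtain i where i: "h x = \<zeta> [^] (i::nat) \<otimes> x" using hom_root[OF h x] by metis
    obtain j where j: "g x = \<zeta> [^] (j::nat) \<otimes> x" using hom_root[OF g x] by metis
    have "g (h x) = \<zeta> [^] i \<otimes> (\<zeta> [^] j \<otimes> x)"
      using i j gg(5)[of "\<zeta> [^] i" x] x(1) hom_zeta[OF g M(2)] by simp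
    also have "\<dots> = \<zeta> [^] j \<otimes> (\<zeta> [^] i \<otimes> x)" using x(1) by (simp add: m_lcomm)
    also have "\<dots> = h (g x)"
      using i j hh(5)[of "\<zeta> [^] j" x] x(1) hom_zeta[OF h M(2)] by simp
    finally have 1: "g (h x) = h (g x)" .
    have "\<zeta> [^] (i * p) = \<one>" using zeta_pow_one_iff by simp
    then show ?thesis using 1 x(1) funpow_eigenvector[OF h M(2) x(1) i, of p] by simp
  qed
  show "g (h y) = h (g y)"
    using hom_agree_on_generate_field[OF hom_overD(1)[OF hom_over_comp[OF g h]]
      hom_overD(1)[OF hom_over_comp[OF h g]] c _ y] comm by simp
  show "(h ^^ p) y = y"
    using hom_agree_on_generate_field[OF hom_overD(1)[OF hom_over_funpow[OF h, of p]]
      hom_overD(1)[OF id_hom_over[of L M]] c _ y] comm by simp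
qed

text \<open>\<open>U\<close> will be \<open>F22\<close> or \<open>F3\<close>.\<close>

locale kummer_layer = kummer +
  fixes U A
  assumes U: "subfield U L" "F2 \<subseteq> U" "U \<subseteq> F22" "stable_over L F U"
    and A: "A \<subseteq> {x \<in> carrier L. x [^] p \<in> F2}" and U_gen: "U = generate_field L (F2 \<union> A)"
begin

abbreviation "Gal \<equiv> galois_group L F U"

definition "GalN = {\<tau> \<in> carrier Gal. \<forall>x\<in>F2. \<tau> x = x}"

lemma FU: "F \<subseteq> U" using F2_props(2) U(2) by blast

lemma Uc: "x \<in> U \<Longrightarrow> x \<in> carrier L" using subfield_props(1)[OF U(1)] by blast

sublocale Gal: group Gal using group_galois_group[OF U(1) FU] .

lemma Gal_lift:
  assumes "\<tau> \<in> carrier Gal"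
  obtains h where "h \<in> hom_over L F" "\<And>x. x \<in> U \<Longrightarrow> \<tau> x = h x"
  using galois_group_lift[OF order.refl FU U(1) assms] by (metis restrict_apply')

lemma Gal_restrict: "h \<in> hom_over L F \<Longrightarrow> restrict h U \<in> carrier Gal"
  using restrict_in_galois_group[OF F_subfield order.refl FU U(1,4)] .

lemmas Gal_mult = galois_group_mult_apply[where L = L and K = F and E = U]
lemmas Gal_inv = galois_group_inv_apply[OF U(1) FU]
lemmas Gal_mem = galois_group_mem[where L = L and K = F and E = U]

lemma Gal_F2: "\<tau> \<in> carrier Gal \<Longrightarrow> x \<in> F2 \<Longrightarrow> \<tau> x \<in> F2"
proof -
  assume t: "\<tau> \<in> carrier Gal" and x: "x \<in> F2"
  obtain h where h: "h \<in> hom_over L F" "\<And>x. x \<in> U \<Longrightarrow> \<tau> x = h x" by (rule Gal_lift[OF t], rule that)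
  have "h x \<in> F2" using stable_overD[OF F2_props(3) h(1) x] .
  moreover have "\<tau> x = h x" using h(2) x U(2) by blast
  ultimately show "\<tau> x \<in> F2" by simp
qed

lemma GalN_lift:
  assumes "\<tau> \<in> GalN"
  obtains h where "h \<in> hom_over L F2" "\<And>x. x \<in> U \<Longrightarrow> \<tau> x = h x"
proof -
  have t: "\<tau> \<in> carrier Gal" "\<forall>x\<in>F2. \<tau> x = x" using assms unfolding GalN_def by auto
  obtain h where h: "h \<in> hom_over L F" "\<And>x. x \<in> U \<Longrightarrow> \<tau> x = h x" by (rule Gal_lift[OF t(1)], rule that)
  have "h x = x" if "x \<in> F2" for x using h(2)[of x] t(2) that U(2) by auto
  then have "h \<in> hom_over L F2" using hom_overD(1)[OF h(1)] unfolding hom_over_def by blast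
  then show thesis using that h(2) by blast
qed

lemma Gal_F2_commute:
  assumes "\<rho> \<in> carrier Gal" "\<tau> \<in> carrier Gal" "x \<in> F2"
  shows "\<rho> (\<tau> x) = \<tau> (\<rho> x)" "(\<tau> ^^ p) x = x"
proof -
  obtain g where g: "g \<in> hom_over L F" "\<And>x. x \<in> U \<Longrightarrow> \<rho> x = g x" by (rule Gal_lift[OF assms(1)], rule that)
  obtain h where h: "h \<in> hom_over L F" "\<And>x. x \<in> U \<Longrightarrow> \<tau> x = h x" by (rule Gal_lift[OF assms(2)], rule that)
  have x: "x \<in> generate_field L (F \<union> {x \<in> carrier L. x [^] p \<in> F})"
    using assms(3) unfolding F2_def root_adjunction_def .
  have eq: "\<rho> y = g y" "\<tau> y = h y" if "y \<in> F2" for y using g(2) h(2) that U(2) by auto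
  note comm = kummer_hom_commute[OF F_subfield order.refl order.refl g(1) h(1) x]
  show "\<rho> (\<tau> x) = \<tau> (\<rho> x)"
    using comm(1) eq assms(3) Gal_F2[OF assms(1)] Gal_F2[OF assms(2)] by metis
  have "(\<tau> ^^ n) x = (h ^^ n) x \<and> (\<tau> ^^ n) x \<in> F2" for n
    using assms(3) eq(2) Gal_F2[OF assms(2)] by (induct n) auto
  then show "(\<tau> ^^ p) x = x" using comm(2) by simp
qed

text \<open>Both layers are Kummer, hence elementary abelian by \<open>kummer_hom_commute\<close>:
  \<open>U\<close> over \<open>F2\<close> gives the conditions on \<open>GalN\<close>, and
  \<open>F2\<close> over \<open>F\<close> those on the quotient, which are tested by acting on
  \<open>F2\<close>.\<close>

lemma elementary_tower_Gal: "elementary_tower Gal GalN p"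
proof (intro elementary_tower.intro elementary_tower_axioms.intro)
  show "group Gal" by (rule Gal.is_group)
  show "Factorial_Ring.prime p" by (rule prime)
  have NG: "x \<in> carrier Gal" if "x \<in> GalN" for x using that unfolding GalN_def by blast
  have Nf: "\<tau> x = x" if "\<tau> \<in> GalN" "x \<in> F2" for \<tau> x using that unfolding GalN_def by blast
  have F2U: "x \<in> U" if "x \<in> F2" for x using that U(2) by blast
  have NI: "\<tau> \<in> GalN" if "\<tau> \<in> carrier Gal" "\<And>x. x \<in> F2 \<Longrightarrow> \<tau> x = x" for \<tau>
    using that unfolding GalN_def by blast
  have Ninv: "inv\<^bsub>Gal\<^esub> \<tau> \<in> GalN" if t: "\<tau> \<in> GalN" for \<tau>
  proof (rule NI)
    fix x assume x: "x \<in> F2"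
    then show "(inv\<^bsub>Gal\<^esub> \<tau>) x = x" using Gal_inv(1)[OF NG[OF t] F2U[OF x]] Nf[OF t x] by simp
  qed (use NG t in simp)
  show "subgroup GalN Gal"
  proof (rule Gal.subgroupI)
    show "GalN \<subseteq> carrier Gal" using NG by blast
    have "\<one>\<^bsub>Gal\<^esub> \<in> GalN" by (rule NI[OF Gal.one_closed]) (use F2U in \<open>auto simp: galois_group_one\<close>)
    then show "GalN \<noteq> {}" by blast
    show "inv\<^bsub>Gal\<^esub> \<tau> \<in> GalN" if "\<tau> \<in> GalN" for \<tau> using Ninv that .
    show "\<sigma> \<otimes>\<^bsub>Gal\<^esub> \<tau> \<in> GalN" if "\<sigma> \<in> GalN" "\<tau> \<in> GalN" for \<sigma> \<tau>
      by (rule NI) (use that NG Nf[OF that(1)] Nf[OF that(2)] Gal_mult[OF NG[OF that(1)] NG[OF that(2)] F2U] in auto)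
  qed
  show "Gal.conj_by \<sigma> \<tau> \<in> GalN" if s: "\<sigma> \<in> carrier Gal" and t: "\<tau> \<in> GalN" for \<sigma> \<tau>
  proof (rule NI)
    have i: "inv\<^bsub>Gal\<^esub> \<sigma> \<in> carrier Gal" using s by simp
    show "Gal.conj_by \<sigma> \<tau> \<in> carrier Gal" using Gal.conj_by_simps(1) s NG[OF t] by blast
    fix x assume x: "x \<in> F2"
    have "(inv\<^bsub>Gal\<^esub> \<sigma>) x \<in> F2" using Gal_F2[OF i x] .
    then show "Gal.conj_by \<sigma> \<tau> x = x"
      unfolding Gal.conj_by_def
      using Gal_mult[OF Gal.m_closed[OF s NG[OF t]] i F2U[OF x]] Gal_mult[OF s NG[OF t]]
        Nf[OF t] F2U Gal_inv(2)[OF s F2U[OF x]] by simp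
  qed
  show "\<sigma> \<otimes>\<^bsub>Gal\<^esub> \<tau> = \<tau> \<otimes>\<^bsub>Gal\<^esub> \<sigma>" if s: "\<sigma> \<in> GalN" and t: "\<tau> \<in> GalN" for \<sigma> \<tau>
  proof (rule galois_group_ext)
    fix x assume x: "x \<in> U"
    obtain g where g: "g \<in> hom_over L F2" "\<And>x. x \<in> U \<Longrightarrow> \<sigma> x = g x" by (rule GalN_lift[OF s], rule that)
    obtain h where h: "h \<in> hom_over L F2" "\<And>x. x \<in> U \<Longrightarrow> \<tau> x = h x" by (rule GalN_lift[OF t], rule that)
    have "g (h x) = h (g x)"
      using kummer_hom_commute(1)[OF F2_props(1,2) A g(1) h(1)] x U_gen by simp
    then show "(\<sigma> \<otimes>\<^bsub>Gal\<^esub> \<tau>) x = (\<tau> \<otimes>\<^bsub>Gal\<^esub> \<sigma>) x"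
      using Gal_mult[OF NG[OF s] NG[OF t] x] Gal_mult[OF NG[OF t] NG[OF s] x] g(2) h(2)
        Gal_mem(1)[OF NG[OF s] x] Gal_mem(1)[OF NG[OF t] x] x by simp
  qed (use NG s t in auto)
  show "\<tau> [^]\<^bsub>Gal\<^esub> p = \<one>\<^bsub>Gal\<^esub>" if t: "\<tau> \<in> GalN" for \<tau>
  proof (rule galois_group_ext)
    fix x assume x: "x \<in> U"
    obtain h where h: "h \<in> hom_over L F2" "\<And>x. x \<in> U \<Longrightarrow> \<tau> x = h x" by (rule GalN_lift[OF t], rule that)
    have "(\<tau> ^^ n) x = (h ^^ n) x \<and> (\<tau> ^^ n) x \<in> U" for n
      using x h(2) Gal_mem(1)[OF NG[OF t]] by (induct n) auto
    then have "(\<tau> ^^ p) x = x"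
      using kummer_hom_commute(2)[OF F2_props(1,2) A h(1,1)] x U_gen by simp
    then show "(\<tau> [^]\<^bsub>Gal\<^esub> p) x = \<one>\<^bsub>Gal\<^esub> x"
      using galois_group_pow[OF U(1) FU NG[OF t] x] x by (simp add: galois_group_one)
  qed (use NG t in auto)
  show "\<sigma> \<otimes>\<^bsub>Gal\<^esub> \<tau> \<otimes>\<^bsub>Gal\<^esub> inv\<^bsub>Gal\<^esub> (\<tau> \<otimes>\<^bsub>Gal\<^esub> \<sigma>) \<in> GalN"
    if s: "\<sigma> \<in> carrier Gal" and t: "\<tau> \<in> carrier Gal" for \<sigma> \<tau>
  proof (rule NI)
    have ts: "\<tau> \<otimes>\<^bsub>Gal\<^esub> \<sigma> \<in> carrier Gal" "\<sigma> \<otimes>\<^bsub>Gal\<^esub> \<tau> \<in> carrier Gal" using s t by auto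
    have i: "inv\<^bsub>Gal\<^esub> (\<tau> \<otimes>\<^bsub>Gal\<^esub> \<sigma>) \<in> carrier Gal" using ts by simp
    show "\<sigma> \<otimes>\<^bsub>Gal\<^esub> \<tau> \<otimes>\<^bsub>Gal\<^esub> inv\<^bsub>Gal\<^esub> (\<tau> \<otimes>\<^bsub>Gal\<^esub> \<sigma>) \<in> carrier Gal" using ts i by blast
    fix x assume x: "x \<in> F2"
    define y where "y = (inv\<^bsub>Gal\<^esub> (\<tau> \<otimes>\<^bsub>Gal\<^esub> \<sigma>)) x"
    have y: "y \<in> F2" unfolding y_def using Gal_F2[OF i x] .
    have "(\<sigma> \<otimes>\<^bsub>Gal\<^esub> \<tau> \<otimes>\<^bsub>Gal\<^esub> inv\<^bsub>Gal\<^esub> (\<tau> \<otimes>\<^bsub>Gal\<^esub> \<sigma>)) x = \<sigma> (\<tau> y)"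
      unfolding y_def using Gal_mult[OF ts(2) i F2U[OF x]] Gal_mult[OF s t] Gal_mem(1)[OF i F2U[OF x]] by simp
    also have "\<dots> = \<tau> (\<sigma> y)" using Gal_F2_commute(1)[OF s t y] .
    also have "\<dots> = (\<tau> \<otimes>\<^bsub>Gal\<^esub> \<sigma>) y" using Gal_mult[OF t s F2U[OF y]] by simp
    also have "\<dots> = x" unfolding y_def using Gal_inv(2)[OF ts(1) F2U[OF x]] .
    finally show "(\<sigma> \<otimes>\<^bsub>Gal\<^esub> \<tau> \<otimes>\<^bsub>Gal\<^esub> inv\<^bsub>Gal\<^esub> (\<tau> \<otimes>\<^bsub>Gal\<^esub> \<sigma>)) x = x" .
  qed
  show "\<tau> [^]\<^bsub>Gal\<^esub> p \<in> GalN" if t: "\<tau> \<in> carrier Gal" for \<tau>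
    by (rule NI) (use t galois_group_pow[OF U(1) FU t F2U] Gal_F2_commute(2)[OF t t] in auto)
qed

end

section \<open>Twisted traces, maximal open subgroups and moved roots\<close>

context kummer_layer
begin

text \<open>A restriction to F(B) is determined by its values on the finite set B, and each value
  lies in a finite orbit.\<close>

lemma finite_restrictions:
  assumes A: "finite B" "B \<subseteq> U"
  shows "finite ((\<lambda>\<tau>. restrict \<tau> (generate_field L (F \<union> B))) ` carrier Gal)"
proof -
  let ?M = "generate_field L (F \<union> B)"
  let ?O = "\<lambda>x. {h x | h. h \<in> hom_over L F}"
  have Bc: "B \<subseteq> carrier L" using A(2) Uc by blast
  have c: "F \<union> B \<subseteq> carrier L" using Bc subfieldE(3)[OF F_subfield] by blast
  have MU: "?M \<subseteq> U" using generate_field_min_subfield1[OF c U(1)] FU A(2) by blast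
  have BM: "x \<in> ?M" if "x \<in> B" for x using that by (intro generate_field.incl) blast
  have "finite (\<Pi>\<^sub>E x\<in>B. ?O x)"
    using A(1) finite_orbit[OF F_subfield order.refl] Bc by (intro finite_PiE) auto
  moreover have "(\<lambda>f. restrict f B) ` ((\<lambda>\<tau>. restrict \<tau> ?M) ` carrier Gal) \<subseteq> (\<Pi>\<^sub>E x\<in>B. ?O x)"
  proof (intro image_subsetI)
    fix f assume "f \<in> (\<lambda>\<tau>. restrict \<tau> ?M) ` carrier Gal"
    then obtain \<tau> where t: "\<tau> \<in> carrier Gal" "f = restrict \<tau> ?M" by blast
    obtain h where h: "h \<in> hom_over L F" "\<And>x. x \<in> U \<Longrightarrow> \<tau> x = h x" by (rule Gal_lift[OF t(1)], rule that)
    have "f x = h x" if "x \<in> B" for x using t(2) h(2)[of x] BM[OF that] MU by auto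
    then have "f x \<in> ?O x" if "x \<in> B" for x using h(1) that by auto
    then show "restrict f B \<in> (\<Pi>\<^sub>E x\<in>B. ?O x)" by (intro restrict_PiE_iff[THEN iffD2]) blast
  qed
  ultimately have fin: "finite ((\<lambda>f. restrict f B) ` ((\<lambda>\<tau>. restrict \<tau> ?M) ` carrier Gal))"
    using finite_subset by blast
  have "inj_on (\<lambda>f. restrict f B) ((\<lambda>\<tau>. restrict \<tau> ?M) ` carrier Gal)"
  proof (rule inj_onI)
    fix f g assume "f \<in> (\<lambda>\<tau>. restrict \<tau> ?M) ` carrier Gal" "g \<in> (\<lambda>\<tau>. restrict \<tau> ?M) ` carrier Gal"
      and eq: "restrict f B = restrict g B"
    then obtain \<tau> \<rho> where t: "\<tau> \<in> carrier Gal" "f = restrict \<tau> ?M" "\<rho> \<in> carrier Gal" "g = restrict \<rho> ?M"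
      by blast
    obtain h where h: "h \<in> hom_over L F" "\<And>x. x \<in> U \<Longrightarrow> \<tau> x = h x" by (rule Gal_lift[OF t(1)], rule that)
    obtain k where k: "k \<in> hom_over L F" "\<And>x. x \<in> U \<Longrightarrow> \<rho> x = k x" by (rule Gal_lift[OF t(3)], rule that)
    have "h x = k x" if "x \<in> F \<union> B" for x
    proof (cases "x \<in> B")
      case True
      then have "restrict f B x = f x" "restrict g B x = g x" by auto
      then have "f x = g x" using eq by simp
      then show ?thesis using t(2,4) h(2)[of x] k(2)[of x] BM[OF True] MU by auto
    next
      case False
      then show ?thesis using that hom_overD(2)[OF h(1)] hom_overD(2)[OF k(1)] by simp
    qed
    then have "h y = k y" if "y \<in> ?M" for y
      using hom_agree_on_generate_field[OF hom_overD(1)[OF h(1)] hom_overD(1)[OF k(1)] c _ that] by blast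
    then show "f = g" unfolding t(2,4) using h(2) k(2) MU by (intro restrict_ext) auto
  qed
  then show ?thesis using finite_imageD[OF fin] by blast
qed

text \<open>\<open>\<alpha>\<close> is a twisted trace \<open>\<Sum> \<zeta>^(-\<chi>(\<tau>)) \<tau>(x)\<close>, nonzero for some \<open>x\<close> by independence of characters;
  the sum is finite because \<open>\<tau>\<close> only matters through its restriction to \<open>F(B)\<close>.\<close>

lemma character_eigenvector:
  assumes chi: "\<And>g h. g \<in> carrier Gal \<Longrightarrow> h \<in> carrier Gal \<Longrightarrow> \<chi> (g \<otimes>\<^bsub>Gal\<^esub> h) mod p = (\<chi> g + \<chi> h) mod p"
    and B: "finite B" "B \<subseteq> U" "\<And>\<tau>. \<tau> \<in> carrier Gal \<Longrightarrow> \<forall>x\<in>B. \<tau> x = x \<Longrightarrow> \<chi> \<tau> mod p = 0"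
  obtains \<alpha> where "\<alpha> \<in> U" "\<alpha> \<noteq> \<zero>" "\<And>\<tau>. \<tau> \<in> carrier Gal \<Longrightarrow> \<zeta> [^] ((p - 1) * \<chi> \<tau>) \<otimes> \<tau> \<alpha> = \<alpha>"
proof -
  define M where "M = generate_field L (F \<union> B)"
  define I where "I = (\<lambda>\<tau>. restrict \<tau> M) ` carrier Gal"
  \<comment> \<open>(p - 1) n represents -n modulo p, so this is the inverse of \<zeta>^n without
    negative exponents.\<close>
  define e where "e n = \<zeta> [^] ((p - 1) * n)" for n :: nat
  have fin: "finite I" unfolding I_def M_def using finite_restrictions[OF B(1,2)] .
  have c: "F \<union> B \<subseteq> carrier L" using B(2) Uc subfieldE(3)[OF F_subfield] by blast
  have M: "subfield M L" unfolding M_def using generate_field_is_subfield[OF c] .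
  note Mp = subfield_props[OF M]
  have MU: "M \<subseteq> U" unfolding M_def using generate_field_min_subfield1[OF c U(1)] FU B(2) by blast
  have BM: "B \<subseteq> M" unfolding M_def by (intro subsetI generate_field.incl) blast
  have e_mod: "e m = e n" if "m mod p = n mod p" for m n
    unfolding e_def using zeta_pow_mod[of "(p - 1) * m"] zeta_pow_mod[of "(p - 1) * n"] that
    by (metis mod_mult_right_eq)
  have e_add: "e (m + n) = e m \<otimes> e n" for m n
    unfolding e_def by (simp add: nat_pow_mult distrib_left)
  have e_F: "e n \<in> F" "e n \<in> carrier L" "e n \<noteq> \<zero>" for n
    unfolding e_def using zeta_pow_F zeta_pow_nonzero by auto
  have chi_eq: "\<chi> \<tau> mod p = \<chi> \<rho> mod p"
    if t: "\<tau> \<in> carrier Gal" and r: "\<rho> \<in> carrier Gal" and eq: "restrict \<tau> M = restrict \<rho> M" for \<tau> \<rho>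
  proof -
    have i: "inv\<^bsub>Gal\<^esub> \<rho> \<in> carrier Gal" using r by simp
    define \<kappa> where "\<kappa> = inv\<^bsub>Gal\<^esub> \<rho> \<otimes>\<^bsub>Gal\<^esub> \<tau>"
    have k: "\<kappa> \<in> carrier Gal" unfolding \<kappa>_def using i t by blast
    have "\<kappa> x = x" if "x \<in> B" for x
    proof -
      have x: "x \<in> M" "x \<in> U" using that BM MU by auto
      have "\<tau> x = \<rho> x" using eq x(1) by (metis restrict_apply')
      then show ?thesis unfolding \<kappa>_def using Gal_mult[OF i t x(2)] Gal_inv(1)[OF r x(2)] by simp
    qed
    then have "\<chi> \<kappa> mod p = 0" using B(3)[OF k] by blast
    moreover have "\<tau> = \<rho> \<otimes>\<^bsub>Gal\<^esub> \<kappa>" unfolding \<kappa>_def using r t by (simp add: Gal.inv_mult_cancel)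
    then have "\<chi> \<tau> mod p = (\<chi> \<rho> + \<chi> \<kappa>) mod p" using chi[OF r k] by simp
    ultimately show ?thesis by (metis add_0_right mod_add_right_eq)
  qed
  \<comment> \<open>A restriction does not remember its automorphism; by \<open>chi_eq\<close> every
    preimage yields the same coefficient.\<close>
  define rep where "rep f = (SOME \<tau>. \<tau> \<in> carrier Gal \<and> f = restrict \<tau> M)" for f
  define d where "d f = e (\<chi> (rep f))" for f
  have rep: "rep f \<in> carrier Gal \<and> f = restrict (rep f) M" if "f \<in> I" for f
  proof -
    have "\<exists>\<tau>. \<tau> \<in> carrier Gal \<and> f = restrict \<tau> M" using that unfolding I_def by blast
    then show ?thesis unfolding rep_def by (rule someI_ex)
  qed
  have d: "d (restrict \<tau> M) = e (\<chi> \<tau>)" if t: "\<tau> \<in> carrier Gal" for \<tau>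
  proof -
    have "restrict \<tau> M \<in> I" unfolding I_def using t by blast
    from rep[OF this] have "\<chi> (rep (restrict \<tau> M)) mod p = \<chi> \<tau> mod p"
      using chi_eq[OF _ t] by metis
    then show ?thesis unfolding d_def using e_mod by blast
  qed
  have dc: "d f \<in> carrier L" "d f \<noteq> \<zero>" "d f \<in> U" for f
    unfolding d_def using e_F FU by auto
  have IU: "f x \<in> U" if "f \<in> I" "x \<in> M" for f x
    using that Gal_mem(1)[of _ x] MU unfolding I_def by auto
  have one_I: "restrict \<one>\<^bsub>Gal\<^esub> M \<in> I" unfolding I_def by simp
  have I_lift: "\<exists>h\<in>hom_over L F. \<forall>x\<in>M. f x = h x" if fI: "f \<in> I" for f
  proof -
    obtain \<tau> where t: "\<tau> \<in> carrier Gal" "f = restrict \<tau> M" using fI unfolding I_def by blast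
    obtain h where h: "h \<in> hom_over L F" "\<And>x. x \<in> U \<Longrightarrow> \<tau> x = h x" by (rule Gal_lift[OF t(1)], rule that)
    show ?thesis using h t(2) MU by (intro bexI[OF _ h(1)]) auto
  qed
  have "\<exists>x\<in>M. (\<Oplus>f\<in>I. d f \<otimes> f x) \<noteq> \<zero>"
  proof (rule ccontr)
    assume n: "\<not> ?thesis"
    have "d (restrict \<one>\<^bsub>Gal\<^esub> M) = \<zero>"
    proof (rule dedekind_independence[of I M "\<lambda>f. f" d])
      show "f x \<in> carrier L" if "f \<in> I" "x \<in> M" for f x using IU[OF that] Uc by blast
      show "f \<one> = \<one>" if "f \<in> I" for f
      proof -
        obtain h where h: "h \<in> hom_over L F" "\<forall>x\<in>M. f x = h x" using I_lift[OF \<open>f \<in> I\<close>] by blast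
        have "f \<one> = h \<one>" using h(2) Mp(3) by blast
        then show ?thesis using self_hom(3)[OF hom_overD(1)[OF h(1)]] by simp
      qed
      show "f (x \<otimes> y) = f x \<otimes> f y" if "f \<in> I" "x \<in> M" "y \<in> M" for f x y
      proof -
        obtain h where h: "h \<in> hom_over L F" "\<forall>x\<in>M. f x = h x" using I_lift[OF \<open>f \<in> I\<close>] by blast
        then show ?thesis using self_hom(5)[OF hom_overD(1)[OF h(1)], of x y] Mp(1,5) that(2,3) by auto
      qed
      show "\<exists>x\<in>M. f x \<noteq> g x" if "f \<in> I" "g \<in> I" "f \<noteq> g" for f g
      proof (rule ccontr)
        assume "\<not> ?thesis"
        moreover have "f \<in> extensional M" "g \<in> extensional M" using that unfolding I_def by auto
        ultimately have "f = g" using extensionalityI by blast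
        then show False using that(3) by blast
      qed
    qed (use fin Mp dc n one_I in auto)
    then show False using dc(2) by blast
  qed
  then obtain x where x: "x \<in> M" and nz: "(\<Oplus>f\<in>I. d f \<otimes> f x) \<noteq> \<zero>" by blast
  define \<alpha> where "\<alpha> = (\<Oplus>f\<in>I. d f \<otimes> f x)"
  have fx: "f x \<in> carrier L" if "f \<in> I" for f using IU[OF that x] Uc by blast
  have aU: "\<alpha> \<in> U"
  proof -
    have "(\<Oplus>f\<in>J. d f \<otimes> f x) \<in> U" if "J \<subseteq> I" for J
      using finite_subset[OF that fin] that
    proof (induct J)
      case empty then show ?case using subfield_props(2)[OF U(1)] by simp
    next
      case (insert f J)
      then have "(\<Oplus>f\<in>insert f J. d f \<otimes> f x) = d f \<otimes> f x \<oplus> (\<Oplus>f\<in>J. d f \<otimes> f x)"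
        using dc(1) fx by (intro finsum_insert) auto
      then show ?case using insert IU[of f x] x dc(3) subfield_props(4,5)[OF U(1)] by auto
    qed
    then show ?thesis unfolding \<alpha>_def by blast
  qed
  have "e (\<chi> \<tau>) \<otimes> \<tau> \<alpha> = \<alpha>" if t: "\<tau> \<in> carrier Gal" for \<tau>
  proof -
    obtain h where h: "h \<in> hom_over L F" "\<And>x. x \<in> U \<Longrightarrow> \<tau> x = h x" by (rule Gal_lift[OF t], rule that)
    note hh = self_hom[OF hom_overD(1)[OF h(1)]]
    interpret hc: ring_hom_cring L L h using hom_overD(1)[OF h(1)] by unfold_locales
    \<comment> \<open>Left multiplication by \<tau> permutes the restrictions and multiplies each
      coefficient by \<open>e (\<chi> \<tau>)\<close>; reindexing the sum along it gives the
      eigenvector equation.\<close>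
    define T where "T f = restrict (\<lambda>y. \<tau> (f y)) M" for f
    have T: "T f \<in> I" "d (T f) = e (\<chi> \<tau>) \<otimes> d f" if f: "f \<in> I" for f
    proof -
      have r: "rep f \<in> carrier Gal" "f = restrict (rep f) M" using rep[OF f] by auto
      have "T f = restrict (\<tau> \<otimes>\<^bsub>Gal\<^esub> rep f) M"
        unfolding T_def
      proof (rule restrict_ext)
        fix y assume y: "y \<in> M"
        then have "f y = rep f y" using r(2) by (metis restrict_apply')
        then show "\<tau> (f y) = (\<tau> \<otimes>\<^bsub>Gal\<^esub> rep f) y" using Gal_mult[OF t r(1)] y MU by auto
      qed
      moreover have tr: "\<tau> \<otimes>\<^bsub>Gal\<^esub> rep f \<in> carrier Gal" using t r by blast
      ultimately show "T f \<in> I" "d (T f) = e (\<chi> \<tau>) \<otimes> d f"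
        using d[OF tr] e_mod[OF chi[OF t r(1)]] e_add unfolding I_def d_def by auto
    qed
    have "inj_on T I"
    proof (rule inj_onI)
      fix f g assume fg: "f \<in> I" "g \<in> I" "T f = T g"
      show "f = g"
      proof (rule extensionalityI)
        show "f \<in> extensional M" "g \<in> extensional M" using fg unfolding I_def by auto
        fix y assume y: "y \<in> M"
        have "\<tau> (f y) = \<tau> (g y)" using fg(3) y unfolding T_def by (metis (no_types, lifting) restrict_apply')
        then show "f y = g y" using Gal_inv(1)[OF t] IU[OF fg(1) y] IU[OF fg(2) y] by metis
      qed
    qed
    moreover have "T ` I = I" using endo_inj_surj[OF fin _ \<open>inj_on T I\<close>] T(1) by blast
    ultimately have "\<alpha> = (\<Oplus>f\<in>I. d (T f) \<otimes> T f x)"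
      unfolding \<alpha>_def using finsum_reindex[of "\<lambda>f. d f \<otimes> f x" T I] dc(1) fx T(1) by auto
    also have "\<dots> = (\<Oplus>f\<in>I. e (\<chi> \<tau>) \<otimes> h (d f \<otimes> f x))"
    proof (rule finsum_cong')
      fix f assume f: "f \<in> I"
      have "h (d f \<otimes> f x) = h (d f) \<otimes> h (f x)" using hh(5) dc(1) fx[OF f] by blast
      also have "h (d f) = d f" unfolding d_def by (rule hom_overD(2)[OF h(1) e_F(1)])
      finally have "h (d f \<otimes> f x) = d f \<otimes> h (f x)" .
      moreover have "T f x = h (f x)" unfolding T_def using x h(2)[OF IU[OF f x]] by simp
      ultimately show "d (T f) \<otimes> T f x = e (\<chi> \<tau>) \<otimes> h (d f \<otimes> f x)"
        using T(2)[OF f] m_assoc[OF e_F(2) dc(1)] hh(1)[OF fx[OF f]] by simp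
    qed (use e_F(2) dc(1) fx hh(1) in auto)
    also have "\<dots> = e (\<chi> \<tau>) \<otimes> (\<Oplus>f\<in>I. h (d f \<otimes> f x))"
      using fin e_F(2) dc(1) fx hh(1) by (intro finsum_rdistr[symmetric]) auto
    also have "(\<Oplus>f\<in>I. h (d f \<otimes> f x)) = h \<alpha>"
      unfolding \<alpha>_def using dc(1) fx by (subst hc.hom_finsum) (auto simp: comp_def)
    finally show ?thesis using h(2)[OF aU] by simp
  qed
  then show thesis using that[OF aU] nz unfolding e_def \<alpha>_def by blast
qed

text \<open>If s fixed all p-th roots of elements of \<open>F\<close>, it would lie in
  \<open>GalN\<close>, and a maximal open subgroup missing s would give a character with value 1 at
  s. Its eigenvector \<alpha> has a p-th power fixed by everything, so \<alpha> is such a root, yet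
  s multiplies it by a nontrivial root of unity.\<close>

lemma not_frattini_moves_root:
  assumes s: "s \<in> carrier Gal" "s \<notin> frattini Gal (krull_topology L F U)"
  shows "\<exists>\<alpha>\<in>carrier L. \<alpha> [^] p \<in> F \<and> s \<alpha> \<noteq> \<alpha>"
proof (rule ccontr)
  assume "\<not> ?thesis"
  then have fixd: "s \<alpha> = \<alpha>" if "\<alpha> \<in> carrier L" "\<alpha> [^] p \<in> F" for \<alpha> using that by blast
  obtain H where H: "maximal_open_subgroup Gal (krull_topology L F U) H" "s \<notin> H"
    using s unfolding frattini_def by blast
  obtain g where g: "g \<in> hom_over L F" "\<And>x. x \<in> U \<Longrightarrow> s x = g x" by (rule Gal_lift[OF s(1)], rule that)
  have c: "F \<union> {x \<in> carrier L. x [^] p \<in> F} \<subseteq> carrier L" using subfieldE(3)[OF F_subfield] by blast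
  have "g x = x" if "x \<in> F2" for x
  proof (rule hom_eq_on_generate_field[OF hom_overD(1)[OF g(1)] c])
    show "x \<in> generate_field L (F \<union> {x \<in> carrier L. x [^] p \<in> F})"
      using that unfolding F2_def root_adjunction_def .
    fix y assume y: "y \<in> F \<union> {x \<in> carrier L. x [^] p \<in> F}"
    show "g y = y"
    proof (cases "y \<in> F")
      case False
      then have "y \<in> carrier L" "y [^] p \<in> F" using y by auto
      then show ?thesis using fixd g(2)[of y] F2_props(4)[of y] U(2) by auto
    qed (rule hom_overD(2)[OF g(1)])
  qed
  then have sN: "s \<in> GalN" unfolding GalN_def using s(1) g(2) U(2) by auto
  have Hm: "subgroup H Gal" "openin (krull_topology L F U) H"
    "\<And>H'. subgroup H' Gal \<Longrightarrow> H \<subseteq> H' \<Longrightarrow> H' = H \<or> H' = carrier Gal"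
    using H(1) unfolding maximal_open_subgroup_def by blast+
  interpret T: elementary_tower_maximal Gal GalN p H s
    by (intro elementary_tower_maximal.intro elementary_tower_maximal_axioms.intro elementary_tower_Gal Hm sN H(2))
  obtain \<chi> :: "('a \<Rightarrow> 'a) \<Rightarrow> nat" where chi:
    "\<And>g h. g \<in> carrier Gal \<Longrightarrow> h \<in> carrier Gal \<Longrightarrow> \<chi> (g \<otimes>\<^bsub>Gal\<^esub> h) mod p = (\<chi> g + \<chi> h) mod p"
    "\<And>h. h \<in> H \<Longrightarrow> \<chi> h mod p = 0" "\<chi> s mod p = 1"
    using T.exists_character by blast
  have lift: "\<exists>h\<in>ring_hom L L. \<forall>x\<in>U. \<tau> x = h x" if "\<tau> \<in> carrier Gal" for \<tau>
    using Gal_lift[OF that] hom_overD(1) by metis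
  \<comment> \<open>Openness of \<open>H\<close> at the identity makes the character depend on
    finitely many values only, which is what keeps the twisted trace a finite sum.\<close>
  have "\<exists>B. finite B \<and> B \<subseteq> U \<and> (\<forall>\<rho>\<in>carrier Gal. (\<forall>x\<in>B. \<rho> x = \<one>\<^bsub>Gal\<^esub> x) \<longrightarrow> \<rho> \<in> H)"
    by (rule krull_open_finite_agreement[OF field_axioms U(1) FU F_subfield lift Hm(2)
        subgroup.one_closed[OF Hm(1)] Gal.one_closed])
  then obtain B where B: "finite B" "B \<subseteq> U"
    "\<forall>\<rho>\<in>carrier Gal. (\<forall>x\<in>B. \<rho> x = \<one>\<^bsub>Gal\<^esub> x) \<longrightarrow> \<rho> \<in> H"
    by (elim exE conjE)
  have "\<chi> \<tau> mod p = 0" if t: "\<tau> \<in> carrier Gal" "\<forall>x\<in>B. \<tau> x = x" for \<tau>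
  proof -
    have "\<tau> x = \<one>\<^bsub>Gal\<^esub> x" if xB: "x \<in> B" for x
    proof -
      have "x \<in> U" using xB B(2) by blast
      then show ?thesis using t(2) xB by (simp add: galois_group_one)
    qed
    then have "\<tau> \<in> H" using B(3) t(1) by blast
    then show ?thesis by (rule chi(2))
  qed
  then obtain \<alpha> where a: "\<alpha> \<in> U" "\<alpha> \<noteq> \<zero>" "\<And>\<tau>. \<tau> \<in> carrier Gal \<Longrightarrow> \<zeta> [^] ((p - 1) * \<chi> \<tau>) \<otimes> \<tau> \<alpha> = \<alpha>"
    using character_eigenvector[OF chi(1) B(1,2)] by blast
  have ac: "\<alpha> \<in> carrier L" using Uc[OF a(1)] .
  have "\<alpha> [^] p \<in> F"
  proof (rule F22_fixed)
    show "\<alpha> [^] p \<in> F22" using subfield_props(9)[OF U(1) a(1)] U(3) by blast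
    fix h assume h: "h \<in> hom_over L F"
    note hh = self_hom[OF hom_overD(1)[OF h]]
    have "\<zeta> [^] ((p - 1) * \<chi> (restrict h U)) \<otimes> h \<alpha> = \<alpha>" using a(3)[OF Gal_restrict[OF h]] a(1) by simp
    then have "\<alpha> [^] p = h \<alpha> [^] p" using pow_conjugate[OF hh(1)[OF ac]] by metis
    with hh(7)[OF ac, of p] show "h (\<alpha> [^] p) = \<alpha> [^] p" by (rule trans[OF _ sym])
  qed
  then have "s \<alpha> = \<alpha>" using fixd ac by blast
  then have "\<zeta> [^] ((p - 1) * \<chi> s) \<otimes> \<alpha> = \<one> \<otimes> \<alpha>" using a(3)[OF s(1)] ac by simp
  then have "\<zeta> [^] ((p - 1) * \<chi> s) = \<one>" using m_rcancel[of \<alpha> "\<zeta> [^] ((p - 1) * \<chi> s)" \<one>] ac a(2) by simp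
  then have "p dvd (p - 1) * \<chi> s" using zeta_pow_one_iff by blast
  then have "p dvd p - 1 \<or> p dvd \<chi> s" using prime prime_dvd_mult_iff by blast
  moreover have "\<not> p dvd p - 1" using p_gt by (metis One_nat_def Suc_pred diff_less dvd_imp_le linorder_not_less zero_less_diff zero_less_one)
  moreover have "\<not> p dvd \<chi> s" using chi(3) by auto
  ultimately show False by blast
qed

text \<open>The stabiliser of \<alpha> is Gal(U/F(\<alpha>)). It is open because F(\<alpha>) is
  finite over \<open>F\<close>, and maximal because it has index 2.\<close>

lemma moves_square_root_not_frattini:
  assumes p2: "p = 2" and s: "s \<in> carrier Gal" and \<alpha>: "\<alpha> \<in> carrier L" "\<alpha> [^] p \<in> F" "s \<alpha> \<noteq> \<alpha>"
  shows "s \<notin> frattini Gal (krull_topology L F U)"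
proof -
  let ?M = "simple_extension F \<alpha>"
  let ?H = "carrier (galois_group L ?M U)"
  note S = simple_kummer_subfield[OF F_subfield order.refl \<alpha>(1)]
  have aU: "\<alpha> \<in> U" using F2_props(4)[OF \<alpha>(1,2)] U(2) by blast
  have MU: "?M \<subseteq> U" using simple_extension_subring_incl[OF subfieldE(1)[OF U(1)] FU aU] .
  have H: "\<tau> \<in> ?H \<longleftrightarrow> \<tau> \<alpha> = \<alpha>" if t: "\<tau> \<in> carrier Gal" for \<tau>
  proof
    show "\<tau> \<alpha> = \<alpha>" if "\<tau> \<in> ?H" using galois_group_mem(2)[OF that S(3)] .
    assume fixd: "\<tau> \<alpha> = \<alpha>"
    obtain h where h: "h \<in> hom_over L F" "\<And>x. x \<in> U \<Longrightarrow> \<tau> x = h x" by (rule Gal_lift[OF t], rule that)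
    have "\<tau> y = y" if "y \<in> ?M" for y
      using hom_over_simple_extension_eq[OF F_subfield \<alpha>(1) h(1) id_hom_over _ that] h(2)[OF aU] fixd
        h(2)[of y] that MU by auto
    then show "\<tau> \<in> ?H" using t unfolding galois_group_def by auto
  qed
  have HG: "?H \<subseteq> carrier Gal" using S(2) unfolding galois_group_def by auto
  have sub: "subgroup ?H Gal"
  proof (rule Gal.subgroupI[OF HG])
    have "\<one>\<^bsub>Gal\<^esub> \<alpha> = \<alpha>" using aU by (simp add: galois_group_one)
    then show "?H \<noteq> {}" using H[OF Gal.one_closed] by blast
    show "inv\<^bsub>Gal\<^esub> \<tau> \<in> ?H" if "\<tau> \<in> ?H" for \<tau>
    proof -
      have t: "\<tau> \<in> carrier Gal" using that HG by blast
      have "(inv\<^bsub>Gal\<^esub> \<tau>) \<alpha> = \<alpha>" using Gal_inv(1)[OF t aU] H[OF t] that by simp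
      then show ?thesis using H[OF Gal.inv_closed[OF t]] by blast
    qed
    show "\<sigma> \<otimes>\<^bsub>Gal\<^esub> \<tau> \<in> ?H" if "\<sigma> \<in> ?H" "\<tau> \<in> ?H" for \<sigma> \<tau>
    proof -
      have t: "\<tau> \<in> carrier Gal" "\<sigma> \<in> carrier Gal" using that HG by auto
      have "(\<sigma> \<otimes>\<^bsub>Gal\<^esub> \<tau>) \<alpha> = \<alpha>" using Gal_mult[OF t(2,1) aU] H[OF t(1)] H[OF t(2)] that by simp
      then show ?thesis using H[OF Gal.m_closed[OF t(2,1)]] by blast
    qed
  qed
  have fd: "finite_dimension F ?M"
    using finite_dimension_simple_extension[OF F_subfield \<alpha>(1)] algebraic_over[OF order.refl \<alpha>(1)] by simp
  have "openin (krull_topology L F U) ?H"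
  proof -
    have "\<one>\<^bsub>Gal\<^esub> <#\<^bsub>Gal\<^esub> ?H = ?H" using Gal.lcos_mult_one[OF HG] .
    then have "?H \<in> {\<sigma> <#\<^bsub>Gal\<^esub> carrier (galois_group L M U) | \<sigma> M.
      \<sigma> \<in> carrier Gal \<and> subfield M L \<and> F \<subseteq> M \<and> M \<subseteq> U \<and> finite_dimension F M}"
      using S(1,2) MU fd Gal.one_closed by blast
    then show ?thesis unfolding krull_topology_def by (rule topology_generated_by_Basis)
  qed
  moreover have "?H \<noteq> carrier Gal" using H[OF s] s \<alpha>(3) by blast
  moreover have "H' = ?H \<or> H' = carrier Gal" if H': "subgroup H' Gal" "?H \<subseteq> H'" for H'
  proof (rule ccontr)
    assume n: "\<not> ?thesis"
    then obtain \<tau> where t: "\<tau> \<in> H'" "\<tau> \<notin> ?H" using H'(2) by blast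
    have tG: "\<tau> \<in> carrier Gal" using t(1) subgroup.mem_carrier[OF H'(1)] by blast
    \<comment> \<open>For p = 2 there is only one conjugate besides \<alpha>, so two elements
      outside the stabiliser differ by an element of it.\<close>
    have flip: "\<rho> \<alpha> = \<zeta> \<otimes> \<alpha>" if r: "\<rho> \<in> carrier Gal" "\<rho> \<notin> ?H" for \<rho>
    proof -
      obtain h where h: "h \<in> hom_over L F" "\<And>x. x \<in> U \<Longrightarrow> \<rho> x = h x" by (rule Gal_lift[OF r(1)], rule that)
      obtain i where i: "i < p" "h \<alpha> = \<zeta> [^] (i::nat) \<otimes> \<alpha>" using hom_root[OF h(1) \<alpha>(1,2)] .
      have "i \<noteq> 0"
      proof
        assume "i = 0"
        then have "\<rho> \<alpha> = \<alpha>" using i(2) h(2)[OF aU] \<alpha>(1) by simp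
        then show False using H[OF r(1)] r(2) by blast
      qed
      then have "i = 1" using i(1) p2 by simp
      then show ?thesis using i(2) h(2)[OF aU] by simp
    qed
    have "\<rho> \<in> H'" if r: "\<rho> \<in> carrier Gal" for \<rho>
    proof (cases "\<rho> \<in> ?H")
      case False
      define \<kappa> where "\<kappa> = inv\<^bsub>Gal\<^esub> \<tau> \<otimes>\<^bsub>Gal\<^esub> \<rho>"
      have i: "inv\<^bsub>Gal\<^esub> \<tau> \<in> carrier Gal" using tG by simp
      have k: "\<kappa> \<in> carrier Gal" unfolding \<kappa>_def using i r by blast
      have "\<kappa> \<alpha> = (inv\<^bsub>Gal\<^esub> \<tau>) (\<tau> \<alpha>)" unfolding \<kappa>_def Gal_mult[OF i r aU] flip[OF r False] flip[OF tG t(2)] ..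
      then have "\<kappa> \<in> ?H" using H[OF k] Gal_inv(1)[OF tG aU] by simp
      then have "\<tau> \<otimes>\<^bsub>Gal\<^esub> \<kappa> \<in> H'" using subgroup.m_closed[OF H'(1) t(1)] H'(2) by blast
      then show ?thesis unfolding \<kappa>_def using tG r by (simp add: Gal.inv_mult_cancel)
    qed (use H'(2) in blast)
    then have "H' = carrier Gal" using subgroup.subset[OF H'(1)] by blast
    then show False using n by blast
  qed
  ultimately have "maximal_open_subgroup Gal (krull_topology L F U) ?H"
    unfolding maximal_open_subgroup_def using sub by blast
  then show ?thesis using H[OF s] \<alpha>(3) unfolding frattini_def by blast
qed

end

text \<open>For nonzero y one of y and -y is in P, so y^2 is in P. Sums of squares are therefore in
  P or zero, while -1 is neither.\<close>

lemma (in field) field_ordering_formally_real: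
  assumes E: "subfield E R" and P: "field_ordering R E P"
  shows "formally_real R E"
  unfolding formally_real_def
proof (intro allI impI)
  note Ep = subfield_props[OF E]
  have Pp: "P \<subseteq> E - {\<zero>}" "\<And>a b. a \<in> P \<Longrightarrow> b \<in> P \<Longrightarrow> a \<oplus> b \<in> P"
    "\<And>a b. a \<in> P \<Longrightarrow> b \<in> P \<Longrightarrow> a \<otimes> b \<in> P" "\<And>a. a \<in> E \<Longrightarrow> a \<noteq> \<zero> \<Longrightarrow> (a \<in> P) \<noteq> (\<ominus> a \<in> P)"
    using P unfolding field_ordering_def by auto
  have sq: "y \<otimes> y \<in> P" if y: "y \<in> E" "y \<noteq> \<zero>" for y
  proof (cases "y \<in> P")
    case False
    then have "\<ominus> y \<in> P" using Pp(4)[OF y] by blast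
    then have "(\<ominus> y) \<otimes> (\<ominus> y) \<in> P" using Pp(3) by blast
    moreover have "y \<in> carrier R" using y(1) Ep(1) by blast
    then have "(\<ominus> y) \<otimes> (\<ominus> y) = y \<otimes> y" by algebra
    ultimately show ?thesis by simp
  qed (use Pp(3) in blast)
  fix n :: nat and x assume x: "x \<in> {..<n} \<rightarrow> E"
  have "(\<Oplus>i\<in>{..<m}. x i \<otimes> x i) \<in> P \<union> {\<zero>}" if "m \<le> n" for m
    using that
  proof (induct m)
    case (Suc m)
    have xE: "x i \<in> E" if "i < Suc m" for i using x Suc(2) that by auto
    have xc: "x i \<in> carrier R" if "i < Suc m" for i using xE[OF that] Ep(1) by blast
    have "(\<Oplus>i\<in>{..<Suc m}. x i \<otimes> x i) = x m \<otimes> x m \<oplus> (\<Oplus>i\<in>{..<m}. x i \<otimes> x i)"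
      unfolding lessThan_Suc using xc by (intro finsum_insert) auto
    moreover have "x m \<otimes> x m \<in> P \<union> {\<zero>}"
      using sq[of "x m"] xE[of m] by (cases "x m = \<zero>") auto
    moreover have "a \<oplus> b \<in> P \<union> {\<zero>}" if "a \<in> P \<union> {\<zero>}" "b \<in> P \<union> {\<zero>}" for a b
      using that Pp(1,2) Ep(1) by auto
    ultimately show ?case using Suc by auto
  qed simp
  then have s: "(\<Oplus>i\<in>{..<n}. x i \<otimes> x i) \<in> P \<union> {\<zero>}" by blast
  have "\<one> \<in> P" using sq[of \<one>] Ep(3) by simp
  then have "\<ominus> \<one> \<notin> P" using Pp(4)[of \<one>] Ep(3) by simp
  moreover have "\<ominus> \<one> \<noteq> \<zero>" using \<open>\<one> \<in> P\<close> by simp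
  ultimately show "(\<Oplus>i\<in>{..<n}. x i \<otimes> x i) \<noteq> \<ominus> \<one>" using s by (metis Un_iff singletonD)
qed

lemma (in group) ord_eq_prime_iff:
  assumes "Factorial_Ring.prime p" "x \<in> carrier G"
  shows "ord x = p \<longleftrightarrow> x [^] p = \<one> \<and> x \<noteq> \<one>"
proof -
  have "ord x = 1 \<longleftrightarrow> x = \<one>" using pow_eq_id[OF assms(2), of 1] assms(2) by simp
  moreover have "ord x dvd p \<longleftrightarrow> x [^] p = \<one>" using pow_eq_id[OF assms(2)] by simp
  moreover have "d dvd p \<longleftrightarrow> d = 1 \<or> d = p" for d using assms(1) by (auto simp: prime_nat_iff)
  moreover have "p \<noteq> 1" using assms(1) by auto
  ultimately show ?thesis by metis
qed

section \<open>F^(2)^(2) and F^(3) as Kummer layers, and the roots that they contain\<close>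

context kummer
begin

lemma layer_F22: "kummer_layer L F p \<zeta> F22 {x \<in> carrier L. x [^] p \<in> F2}"
proof (intro kummer_layer.intro kummer_layer_axioms.intro kummer_axioms F22_props order.refl)
  show "F22 = generate_field L (F2 \<union> {x \<in> carrier L. x [^] p \<in> F2})"
    unfolding F22_def root_adjunction_def ..
qed

lemma second_ext_F: "second_ext L sep p F = F2"
  unfolding F2_def using second_ext_eq[OF F_subfield order.refl] F22_props(2) unfolding F2_def by blast

lemma second_second_ext_F: "second_second_ext L sep p F = F22"
  unfolding second_second_ext_def second_ext_F
  using second_ext_eq[OF F2_props(1,2)] unfolding F22_def by blast

definition "F3 = third_ext L sep p F"

abbreviation "third_family \<equiv> {E. E \<subseteq> sep \<and> cyclic_extension L p F2 E \<and> galois_extension L F E}"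

text \<open>By \<open>cyclic_is_kummer\<close> each member of the family is generated over
  \<open>F2\<close> by one of these elements, which brings \<open>F3\<close> into the form required
  by \<open>kummer_layer\<close>.\<close>

definition "third_roots = {x \<in> \<Union>third_family. x [^] p \<in> F2}"

lemma F3_eq: "F3 = generate_field L (F2 \<union> third_roots)"
  and third_family_sub: "\<Union>third_family \<subseteq> F22"
  and F3_sub: "F2 \<subseteq> F3" "\<Union>third_family \<subseteq> F3" "F3 \<subseteq> F22" "subfield F3 L"
proof -
  show sub: "\<Union>third_family \<subseteq> F22"
    using cyclic_subset_kum[OF F2_props(1,2)] unfolding F22_def by blast
  have c: "F2 \<union> \<Union>third_family \<subseteq> carrier L"
    by (rule Un_least[OF subfieldE(3)[OF F2_props(1)] order_trans[OF sub subfieldE(3)[OF F22_props(1)]]])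
  have c': "F2 \<union> third_roots \<subseteq> carrier L" using c unfolding third_roots_def by auto
  have F3: "F3 = generate_field L (F2 \<union> \<Union>third_family)"
    unfolding F3_def third_ext_def compositum_def second_ext_F ..
  show "subfield F3 L" unfolding F3 using generate_field_is_subfield[OF c] .
  show "F3 \<subseteq> F22" unfolding F3 by (rule generate_field_min_subfield1[OF c F22_props(1) Un_least[OF F22_props(2) sub]])
  have "F2 \<union> \<Union>third_family \<subseteq> F3" unfolding F3 by (intro subsetI generate_field.incl)
  then show "F2 \<subseteq> F3" "\<Union>third_family \<subseteq> F3" by auto
  let ?G = "generate_field L (F2 \<union> third_roots)"
  have G: "subfield ?G L" using generate_field_is_subfield[OF c'] .
  have GI: "F2 \<union> third_roots \<subseteq> ?G" by (intro subsetI generate_field.incl)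
  show "F3 = ?G"
  proof
    show "?G \<subseteq> F3" unfolding F3 using c unfolding third_roots_def by (intro mono_generate_field) auto
    have "E \<subseteq> ?G" if E: "E \<in> third_family" for E
    proof -
      obtain x where x: "x \<in> E" "x [^] p \<in> F2" "E = simple_extension F2 x"
        using cyclic_is_kummer[OF F2_props(1,2)] E by blast
      have "x \<in> third_roots" unfolding third_roots_def using x(1,2) E by blast
      then have "x \<in> ?G" "F2 \<subseteq> ?G" using GI by auto
      then show ?thesis unfolding x(3) using simple_extension_subring_incl[OF subfieldE(1)[OF G]] by blast
    qed
    then have "F2 \<union> \<Union>third_family \<subseteq> ?G" using GI by blast
    then show "F3 \<subseteq> ?G" unfolding F3 by (rule generate_field_min_subfield1[OF c G])
  qed
qed

lemma F3_stable: "stable_over L F F3"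
  unfolding stable_over_def
proof (intro ballI image_subsetI)
  fix h y assume h: "h \<in> hom_over L F" and y: "y \<in> F3"
  have c: "F2 \<union> third_roots \<subseteq> carrier L"
  proof (rule Un_least[OF subfieldE(3)[OF F2_props(1)]])
    have "third_roots \<subseteq> \<Union>third_family" unfolding third_roots_def by (rule Collect_restrict)
    then show "third_roots \<subseteq> carrier L"
      using order_trans[OF third_family_sub subfieldE(3)[OF F22_props(1)]] by (rule order_trans)
  qed
  show "h y \<in> F3"
  proof (rule hom_generate_field[OF hom_overD(1)[OF h] c F3_sub(4) _ y[unfolded F3_eq]])
    fix x assume "x \<in> F2 \<union> third_roots"
    then consider "x \<in> F2" | E where "E \<in> third_family" "x \<in> E" unfolding third_roots_def by blast
    then show "h x \<in> F3"
    proof cases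
      case 1 then show ?thesis using stable_overD[OF F2_props(3) h] F3_sub(1) by blast
    next
      case 2
      then have "stable_over L F E" using galois_stable by blast
      then show ?thesis using stable_overD[OF _ h 2(2)] 2(1) F3_sub(2) by blast
    qed
  qed
qed

lemma layer_F3: "kummer_layer L F p \<zeta> F3 third_roots"
proof (intro kummer_layer.intro kummer_layer_axioms.intro kummer_axioms F3_sub F3_stable F3_eq)
  show "third_roots \<subseteq> {x \<in> carrier L. x [^] p \<in> F2}"
  proof
    fix x assume "x \<in> third_roots"
    then have x: "x \<in> \<Union>third_family" "x [^] p \<in> F2" unfolding third_roots_def by auto
    from x(1) have "x \<in> F3" by (rule subsetD[OF F3_sub(2)])
    then show "x \<in> {x \<in> carrier L. x [^] p \<in> F2}" using x(2) subsetD[OF subfieldE(3)[OF F3_sub(4)]] by simp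
  qed
qed

text \<open>The assumption on conjugates makes F2(\<beta>) stable, hence Galois, over
  \<open>F\<close>; being cyclic of degree p over \<open>F2\<close> unless trivial, it belongs to
  the family defining \<open>F3\<close>.\<close>

lemma F3_root:
  assumes b: "\<beta> \<in> carrier L" "\<beta> [^] p \<in> F2"
    and st: "\<And>h. h \<in> hom_over L F \<Longrightarrow> h \<beta> \<in> simple_extension F2 \<beta>"
  shows "\<beta> \<in> F3"
proof (cases "\<beta> \<in> F2")
  case False
  have b22: "\<beta> \<in> F22" using F22_props(5)[OF b] .
  note kc = kummer_cyclic[OF F2_props(1,2) F22_props(2) b22 b(2) False]
  note S = simple_kummer_subfield[OF F2_props(1,2) b(1)]
  have "stable_over L F (simple_extension F2 \<beta>)"
    using st by (rule stable_simple_extension[OF F2_props(1,2,3) b(1)])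
  then have "galois_extension L F (simple_extension F2 \<beta>)"
    using galois_if_stable[OF F_subfield order.refl S(1) _ kc(2)] S(2) F2_props(2) by blast
  then have "simple_extension F2 \<beta> \<in> third_family" using kc F22_sep by blast
  then show ?thesis using F3_sub(2) S(3) by blast
qed (use F3_sub(1) in blast)

lemma square: "x \<in> carrier L \<Longrightarrow> x [^] (2::nat) = x \<otimes> x"
  by (simp add: numeral_2_eq_2)

text \<open>If h \<alpha> = \<zeta>^j \<alpha>, then h \<beta> has the same p-th power as \<omega>
  \<beta>, where \<omega> is a p-th root of \<zeta>^j and so lies in \<open>F2\<close>. Thus h
  \<beta> stays in F2(\<beta>).\<close>

lemma root_of_root_in_F3:
  assumes a: "\<alpha> \<in> carrier L" "\<alpha> [^] p \<in> F" and b: "\<beta> \<in> carrier L" "\<beta> [^] p = \<alpha>"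
  shows "\<beta> \<in> F3"
proof (rule F3_root[OF b(1)])
  show "\<beta> [^] p \<in> F2" using F2_props(4)[OF a] b(2) by simp
  fix h assume h: "h \<in> hom_over L F"
  note hh = self_hom[OF hom_overD(1)[OF h]]
  note S = simple_kummer_subfield[OF F2_props(1,2) b(1)]
  obtain j where j: "h \<alpha> = \<zeta> [^] (j::nat) \<otimes> \<alpha>" using hom_root[OF h a] by metis
  obtain \<omega> where w: "\<omega> \<in> carrier L" "\<omega> [^] p = \<zeta> [^] j" using root_exists[of "\<zeta> [^] j"] by auto
  have wF: "\<omega> \<in> F2" using F2_props(4)[OF w(1)] w(2) zeta_pow_F by simp
  have "h \<beta> [^] p = (\<omega> \<otimes> \<beta>) [^] p"
    using hh(7)[OF b(1), of p] b w j by (simp add: nat_pow_distrib)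
  moreover have "\<omega> \<otimes> \<beta> \<in> carrier L" using w(1) b(1) by simp
  ultimately obtain m where "h \<beta> = \<zeta> [^] (m::nat) \<otimes> (\<omega> \<otimes> \<beta>)"
    using same_pow_imp_conjugate[OF _ hh(1)[OF b(1)]] by blast
  moreover have "\<zeta> [^] m \<in> simple_extension F2 \<beta>" "\<omega> \<in> simple_extension F2 \<beta>"
    using S(2) wF zeta_pow_F F2_props(2) by blast+
  ultimately show "h \<beta> \<in> simple_extension F2 \<beta>" using subfield_props(5)[OF S(1)] S(3) by simp
qed

lemma zeta_minus_one:
  assumes "p = 2"
  shows "\<zeta> = \<ominus> \<one>"
proof -
  have "\<zeta> \<otimes> \<zeta> = \<one>" using zeta_pow assms square by simp
  moreover have "(\<zeta> \<ominus> \<one>) \<otimes> (\<zeta> \<oplus> \<one>) = \<zeta> \<otimes> \<zeta> \<ominus> \<one>" using zeta_closed by algebra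
  ultimately have "(\<zeta> \<ominus> \<one>) \<otimes> (\<zeta> \<oplus> \<one>) = \<zero>" by (simp add: minus_eq r_neg)
  then have "\<zeta> \<ominus> \<one> = \<zero> \<or> \<zeta> \<oplus> \<one> = \<zero>" by (rule integral) simp_all
  moreover have "\<zeta> \<ominus> \<one> \<noteq> \<zero>" using zeta_primitive[of 1] assms by simp
  ultimately have "\<zeta> \<oplus> \<one> = \<zero>" by blast
  then show ?thesis using minus_equality[of \<zeta> \<one>] by simp
qed

lemma conjugate_of_square_root:
  assumes p2: "p = 2" and h: "h \<in> hom_over L M" and x: "x \<in> carrier L" "x \<otimes> x \<in> M"
  shows "h x = x \<or> h x = \<ominus> x"
proof -
  note z = zeta_minus_one[OF p2]
  obtain i where i: "i < 2" "h x = \<zeta> [^] (i::nat) \<otimes> x"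
    using hom_root[OF h x(1)] x p2 square by metis
  then have "i = 0 \<or> i = 1" by auto
  then show ?thesis using i(2) z x(1) by (auto simp: l_minus)
qed

text \<open>If h d = d, then h \<beta> = \<plusminus>\<beta>. If h d = -d, then (\<beta> h\<beta>)^2
  = (1 + d)(1 - d) = 1 - d^2 lies in \<open>F\<close>, so \<beta> h\<beta> lies in \<open>F2\<close>
  and h\<beta> in F2(\<beta>).\<close>

lemma one_plus_root_in_F3:
  assumes p2: "p = 2" and d: "d \<in> carrier L" "d [^] p \<in> F" and b: "\<beta> \<in> carrier L" "\<beta> [^] p = \<one> \<oplus> d"
  shows "\<beta> \<in> F3"
proof (rule F3_root[OF b(1)])
  have dF: "d \<in> F2" using F2_props(4)[OF d] .
  show "\<beta> [^] p \<in> F2" using dF b(2) subfield_props(3,4)[OF F2_props(1)] by simp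
  have bb: "\<beta> \<otimes> \<beta> = \<one> \<oplus> d" using b square p2 by simp
  have dd: "d \<otimes> d \<in> F" using d square p2 by simp
  fix h assume h: "h \<in> hom_over L F"
  note hh = self_hom[OF hom_overD(1)[OF h]]
  note S = simple_kummer_subfield[OF F2_props(1,2) b(1)]
  note Sp = subfield_props[OF S(1)]
  have hbc: "h \<beta> \<in> carrier L" using hh(1) b(1) by blast
  have hb2: "h \<beta> \<otimes> h \<beta> = \<one> \<oplus> h d"
    using hh(5)[OF b(1) b(1)] bb hh(4)[of \<one> d] d(1) hh(3) by simp
  from conjugate_of_square_root[OF p2 h d(1) dd]
  show "h \<beta> \<in> simple_extension F2 \<beta>"
  proof
    assume "h d = d"
    then have "h \<beta> [^] p = \<beta> [^] p" using hb2 bb hbc b(1) square p2 by simp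
    then obtain m where "h \<beta> = \<zeta> [^] (m::nat) \<otimes> \<beta>" using same_pow_imp_conjugate[OF b(1) hbc] by metis
    moreover have "\<zeta> [^] m \<in> simple_extension F2 \<beta>" using S(2) zeta_pow_F F2_props(2) by blast
    ultimately show ?thesis using Sp(5) S(3) by simp
  next
    assume m: "h d = \<ominus> d"
    have "(\<beta> \<otimes> h \<beta>) \<otimes> (\<beta> \<otimes> h \<beta>) = (\<beta> \<otimes> \<beta>) \<otimes> (h \<beta> \<otimes> h \<beta>)" using b(1) hbc by algebra
    also have "\<dots> = \<one> \<ominus> d \<otimes> d" unfolding bb hb2 m using d(1) by algebra
    also have "\<dots> \<in> F" using dd subfield_props(3,7)[OF F_subfield] by simp
    finally have "\<beta> \<otimes> h \<beta> \<in> F2" using F2_props(4)[of "\<beta> \<otimes> h \<beta>"] b(1) hbc square p2 by simp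
    then have prod: "\<beta> \<otimes> h \<beta> \<in> simple_extension F2 \<beta>" using S(2) by blast
    show ?thesis
    proof (cases "\<beta> = \<zero>")
      case True then show ?thesis using hh(2) Sp(2) by simp
    next
      case False
      then show ?thesis using subfield_mult_cancel[OF S(1) S(3) _ hbc prod] by blast
    qed
  qed
qed

text \<open>The roots \<open>\<beta>\<close> are the two kinds of witnesses against \<open>h\<close> having order \<open>p\<close>: roots of \<open>\<alpha>\<close> itself, which
  force \<open>p = 2\<close> and \<open>h(\<surd>-1) \<noteq> \<surd>-1\<close>, and square roots of \<open>1 + \<alpha>\<close> for \<open>\<alpha> = \<surd>-c\<close>, which force \<open>1 + c\<close> to be
  positive whenever \<open>c\<close> is.\<close>

definition twist_free :: "('a \<Rightarrow> 'a) \<Rightarrow> bool"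
  where "twist_free h \<longleftrightarrow> (\<forall>\<alpha>\<in>carrier L. \<alpha> [^] p \<in> F \<longrightarrow> h \<alpha> \<noteq> \<alpha> \<longrightarrow>
    (\<forall>\<beta>\<in>carrier L. \<beta> [^] p = \<alpha> \<or> (p = 2 \<and> \<beta> [^] p = \<one> \<oplus> \<alpha>) \<longrightarrow> (h ^^ p) \<beta> = \<beta>))"

lemma triangle_dvd:
  assumes "p \<noteq> 2"
  shows "p dvd (p * (p - 1)) div 2"
proof -
  have "odd p" using prime assms prime_odd_nat p_gt by (metis le_neq_implies_less prime_ge_2_nat)
  then have "even (p - 1)" by simp
  then obtain k where "p - 1 = 2 * k" by blast
  then show ?thesis by simp
qed

text \<open>For \<beta>^p = \<alpha> write h \<beta> = \<xi> \<beta>; then \<xi>^p = \<zeta>^j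
  \<noteq> 1 and h \<xi> = \<zeta>^k \<xi>. Returning to \<beta> after p steps forces \<zeta>^(k
  p(p-1)/2 + j) = 1, impossible for odd p by \<open>triangle_dvd\<close>. For p = 2 the element
  \<xi> is itself the required square root of -1.\<close>

lemma twist_free_p2:
  assumes h: "h \<in> hom_over L F" and a: "\<alpha> \<in> carrier L" "\<alpha> [^] p \<in> F" "h \<alpha> \<noteq> \<alpha>" and tw: "twist_free h"
  shows "p = 2" "\<exists>\<xi>\<in>carrier L. \<xi> \<otimes> \<xi> = \<ominus> \<one> \<and> h \<xi> \<noteq> \<xi>"
proof -
  note hh = self_hom[OF hom_overD(1)[OF h]]
  obtain \<beta> where b: "\<beta> \<in> carrier L" "\<beta> [^] p = \<alpha>" using root_exists[OF a(1)] by blast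
  have hp: "(h ^^ p) \<beta> = \<beta>" using tw a b unfolding twist_free_def by blast
  have a0: "\<alpha> \<noteq> \<zero>" using a(3) hh(2) by auto
  have b0: "\<beta> \<noteq> \<zero>"
  proof
    assume "\<beta> = \<zero>"
    then have "\<alpha> = \<zero>" using b(2) p_gt nat_pow_zero[of p] by simp
    then show False using a0 by blast
  qed
  obtain j where j: "h \<alpha> = \<zeta> [^] (j::nat) \<otimes> \<alpha>" using hom_root[OF h a(1,2)] by metis
  have zj: "\<zeta> [^] j \<noteq> \<one>" using j a(1,3) by auto
  define \<xi> where "\<xi> = h \<beta> \<otimes> inv \<beta>"
  have bu: "\<beta> \<in> Units L" using b(1) b0 field_Units by blast
  have xc: "\<xi> \<in> carrier L" unfolding \<xi>_def using hh(1)[OF b(1)] bu by simp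
  have iv: "inv \<beta> \<in> carrier L" "inv \<beta> \<otimes> \<beta> = \<one>" using bu by auto
  have hb: "h \<beta> = \<xi> \<otimes> \<beta>" unfolding \<xi>_def m_assoc[OF hh(1)[OF b(1)] iv(1) b(1)] iv(2) using hh(1)[OF b(1)] by simp
  have "\<xi> [^] p \<otimes> \<alpha> = \<zeta> [^] j \<otimes> \<alpha>"
    using hh(7)[OF b(1), of p] b hb xc j by (simp add: nat_pow_distrib)
  then have xp: "\<xi> [^] p = \<zeta> [^] j" using m_rcancel[OF a0 a(1)] xc by simp
  then have xF: "\<xi> [^] p \<in> F" using zeta_pow_F by simp
  obtain k where k: "h \<xi> = \<zeta> [^] (k::nat) \<otimes> \<xi>" using hom_root[OF h xc xF] by metis
  have x0: "\<xi> \<noteq> \<zero>" using hb hh(10)[OF b(1)] b0 b(1) by auto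
  \<comment> \<open>The factor by which h^n multiplies \<beta>: step i contributes \<zeta>^(k i)
    \<xi>, and the exponents 0, k, ..., k(n - 1) add up to a triangular number times k.\<close>
  define t where "t n = \<zeta> [^] (k * (n * (n - 1) div 2)) \<otimes> \<xi> [^] n" for n :: nat
  have tri: "Suc n * n div 2 = n * (n - 1) div 2 + n" for n :: nat
  proof (cases n)
    case (Suc m)
    have "Suc n * n = n * (n - 1) + n * 2" using Suc by (simp add: algebra_simps)
    then show ?thesis by simp
  qed simp
  have iter: "(h ^^ n) \<beta> = t n \<otimes> \<beta>" for n
  proof (induct n)
    case 0 then show ?case using b(1) by (simp add: t_def)
  next
    case (Suc n)
    let ?e = "k * (n * (n - 1) div 2)"
    have c: "\<zeta> [^] ?e \<in> carrier L" "\<xi> [^] n \<in> carrier L" "\<zeta> [^] (k * n) \<in> carrier L" using xc by auto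
    have "h (\<xi> [^] n) = (\<zeta> [^] k \<otimes> \<xi>) [^] n" using hh(7)[OF xc] k by simp
    also have "\<dots> = \<zeta> [^] (k * n) \<otimes> \<xi> [^] n" using xc by (simp add: nat_pow_distrib nat_pow_pow)
    finally have hx: "h (\<xi> [^] n) = \<zeta> [^] (k * n) \<otimes> \<xi> [^] n" .
    have "(h ^^ Suc n) \<beta> = h (t n \<otimes> \<beta>)" using Suc by simp
    also have "\<dots> = (\<zeta> [^] ?e \<otimes> (\<zeta> [^] (k * n) \<otimes> \<xi> [^] n)) \<otimes> (\<xi> \<otimes> \<beta>)"
      unfolding t_def using hh(5) c b(1) hb hx hom_zeta[OF h order.refl] by simp
    also have "\<dots> = ((\<zeta> [^] ?e \<otimes> \<zeta> [^] (k * n)) \<otimes> (\<xi> [^] n \<otimes> \<xi>)) \<otimes> \<beta>"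
      using c xc b(1) by (simp add: m_assoc)
    also have "\<zeta> [^] ?e \<otimes> \<zeta> [^] (k * n) = \<zeta> [^] (k * (Suc n * n div 2))"
      by (simp only: nat_pow_mult[OF zeta_closed] tri distrib_left)
    finally show ?case unfolding t_def by simp
  qed
  have "t p \<otimes> \<beta> = \<one> \<otimes> \<beta>" using iter[of p] hp b(1) by simp
  then have tp: "\<zeta> [^] (k * (p * (p - 1) div 2)) \<otimes> \<zeta> [^] j = \<one>"
    using m_rcancel[OF b0 b(1), of "t p" \<one>] xp xc unfolding t_def by simp
  show p2: "p = 2"
  proof (rule ccontr)
    assume "p \<noteq> 2"
    then have "p dvd k * (p * (p - 1) div 2)" using triangle_dvd by simp
    then have "\<zeta> [^] (k * (p * (p - 1) div 2)) = \<one>" using zeta_pow_one_iff by blast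
    then show False using tp zj by simp
  qed
  \<comment> \<open>For p = 2 the only nontrivial power is \<zeta> = -1; the relation then reads
    \<zeta>^k \<zeta> = 1, so \<zeta>^k \<noteq> 1 and \<xi> is moved.\<close>
  have "\<zeta> [^] j = \<zeta>"
    using zeta_pow_mod[of j] zj p2 by (metis mod2_eq_if nat_pow_eone nat_pow_0 zeta_closed)
  then have xx: "\<xi> \<otimes> \<xi> = \<zeta>" "\<zeta> [^] k \<otimes> \<zeta> = \<one>" using xp tp p2 square[OF xc] by simp_all
  have "\<zeta> \<noteq> \<one>" using zeta_primitive[of 1] p2 by simp
  then have "\<zeta> [^] k \<noteq> \<one>" using xx(2) by auto
  then have "h \<xi> \<noteq> \<xi>" using k m_rcancel[OF x0 xc, of "\<zeta> [^] k" \<one>] xc by auto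
  then show "\<exists>\<xi>\<in>carrier L. \<xi> \<otimes> \<xi> = \<ominus> \<one> \<and> h \<xi> \<noteq> \<xi>" using xx(1) xc zeta_minus_one[OF p2] by auto
qed

end

lemma (in field) square_eq_square:
  assumes "s \<in> carrier R" "t \<in> carrier R" "t \<otimes> t = s \<otimes> s"
  shows "t = s \<or> t = \<ominus> s"
proof -
  have "(t \<ominus> s) \<otimes> (t \<oplus> s) = t \<otimes> t \<ominus> s \<otimes> s" using assms(1,2) by algebra
  also have "\<dots> = \<zero>" using assms by (simp add: minus_eq r_neg)
  finally have "t \<ominus> s = \<zero> \<or> t \<oplus> s = \<zero>" by (rule integral) (use assms in simp_all)
  then show ?thesis using assms(1,2) minus_equality[of t s] by auto
qed

subsection \<open>Sums of squares and formally real fields\<close>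

text \<open>An inductive counterpart of the indexed sums in \<open>formally_real\<close>, so that
  products, quadratic extensions and chains are treated by rule induction;
  \<open>formally_real_sum_sq\<close> makes the link.\<close>

inductive_set sum_sq :: "('a, 'b) ring_scheme \<Rightarrow> 'a set \<Rightarrow> 'a set"
  for L and M where
    zero: "\<zero>\<^bsub>L\<^esub> \<in> sum_sq L M"
  | add: "w \<in> sum_sq L M \<Longrightarrow> x \<in> M \<Longrightarrow> w \<oplus>\<^bsub>L\<^esub> x \<otimes>\<^bsub>L\<^esub> x \<in> sum_sq L M"

lemma sum_sq_mono:
  assumes "M \<subseteq> N" shows "sum_sq L M \<subseteq> sum_sq L N"
proof
  fix w assume "w \<in> sum_sq L M" then show "w \<in> sum_sq L N"
    by induct (use assms in \<open>auto intro: sum_sq.intros\<close>)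
qed

lemma sum_sq_Union_chain:
  assumes "\<C> \<noteq> {}" "subset.chain \<A> \<C>" "w \<in> sum_sq L (\<Union>\<C>)"
  shows "\<exists>M\<in>\<C>. w \<in> sum_sq L M"
  using assms(3)
proof induct
  case zero then show ?case using assms(1) sum_sq.zero by blast
next
  case (add w x)
  then obtain M N where MN: "M \<in> \<C>" "w \<in> sum_sq L M" "N \<in> \<C>" "x \<in> N" by blast
  then consider "M \<subseteq> N" | "N \<subseteq> M" using assms(2) unfolding subset_chain_def by blast
  then show ?case
  proof cases
    case 1
    then have "w \<in> sum_sq L N" using MN(2) sum_sq_mono by blast
    then show ?thesis using MN(3,4) sum_sq.add by metis
  next
    case 2
    then have "x \<in> M" using MN(4) by blast
    then show ?thesis using MN(1,2) sum_sq.add by metis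
  qed
qed

context field
begin

lemma sum_sq_props:
  assumes M: "subfield M R"
  shows "v \<in> sum_sq R M \<Longrightarrow> v \<in> M"
    and "v \<in> sum_sq R M \<Longrightarrow> w \<in> sum_sq R M \<Longrightarrow> v \<oplus> w \<in> sum_sq R M"
    and "x \<in> M \<Longrightarrow> x \<otimes> x \<in> sum_sq R M"
    and "v \<in> sum_sq R M \<Longrightarrow> w \<in> sum_sq R M \<Longrightarrow> v \<otimes> w \<in> sum_sq R M"
    and "v \<in> sum_sq R M \<Longrightarrow> v \<noteq> \<zero> \<Longrightarrow> inv v \<in> sum_sq R M"
proof -
  note Mp = subfield_props[OF M]
  have Mc: "x \<in> carrier R" if "x \<in> M" for x using that Mp(1) by blast
  show mem: "v \<in> M" if "v \<in> sum_sq R M" for v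
    using that by induct (use Mp(2,4,5) in auto)
  show plus: "v \<oplus> w \<in> sum_sq R M" if "v \<in> sum_sq R M" "w \<in> sum_sq R M" for v w
    using that(2)
  proof induct
    case zero then show ?case using that(1) mem Mc by simp
  next
    case (add w x)
    have "(v \<oplus> w) \<oplus> x \<otimes> x = v \<oplus> (w \<oplus> x \<otimes> x)"
      using Mc[OF mem[OF that(1)]] Mc[OF mem[OF add(1)]] Mc[OF add(3)] by algebra
    then show ?case using sum_sq.add[OF add(2,3)] by simp
  qed
  show sq: "x \<otimes> x \<in> sum_sq R M" if "x \<in> M" for x
    using sum_sq.add[OF sum_sq.zero[of R M] that] Mc[OF that] by simp
  have sqm: "v \<otimes> (y \<otimes> y) \<in> sum_sq R M" if "v \<in> sum_sq R M" "y \<in> M" for v y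
    using that(1)
  proof induct
    case zero then show ?case using Mc[OF that(2)] by (simp add: sum_sq.zero)
  next
    case (add w x)
    have "(w \<oplus> x \<otimes> x) \<otimes> (y \<otimes> y) = w \<otimes> (y \<otimes> y) \<oplus> (x \<otimes> y) \<otimes> (x \<otimes> y)"
      using Mc[OF mem[OF add(1)]] Mc[OF add(3)] Mc[OF that(2)] by algebra
    then show ?case using sum_sq.add[OF add(2) Mp(5)[OF add(3) that(2)]] by simp
  qed
  show mult: "v \<otimes> w \<in> sum_sq R M" if "v \<in> sum_sq R M" "w \<in> sum_sq R M" for v w
    using that(2)
  proof induct
    case zero then show ?case using Mc[OF mem[OF that(1)]] by (simp add: sum_sq.zero)
  next
    case (add w x)
    have "v \<otimes> (w \<oplus> x \<otimes> x) = v \<otimes> w \<oplus> v \<otimes> (x \<otimes> x)"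
      using Mc[OF mem[OF that(1)]] Mc[OF mem[OF add(1)]] Mc[OF add(3)] by algebra
    then show ?case using plus[OF add(2) sqm[OF that(1) add(3)]] by simp
  qed
  show "inv v \<in> sum_sq R M" if v: "v \<in> sum_sq R M" "v \<noteq> \<zero>" for v
  proof -
    have vM: "v \<in> M" using mem[OF v(1)] .
    have iv: "inv v \<in> M" using Mp(8)[OF vM v(2)] .
    have "v \<in> Units R" using v(2) Mc[OF vM] field_Units by blast
    \<comment> \<open>The inverse of v is v times the square of that inverse, hence again a sum of
      squares.\<close>
    then have "v \<otimes> (inv v \<otimes> inv v) = inv v" using Mc[OF vM] Mc[OF iv] by (simp add: m_assoc[symmetric])
    then show ?thesis using sqm[OF v(1) iv] by simp
  qed
qed

lemma formally_real_sum_sq: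
  assumes M: "subfield M R" and "formally_real R M"
  shows "\<ominus> \<one> \<notin> sum_sq R M"
proof -
  note Mp = subfield_props[OF M]
  have "\<exists>(n::nat) x. x \<in> {..<n} \<rightarrow> M \<and> (\<Oplus>i\<in>{..<n}. x i \<otimes> x i) = w" if "w \<in> sum_sq R M" for w
    using that
  proof induct
    case zero show ?case by (intro exI[of _ "0::nat"]) auto
  next
    case (add w y)
    then obtain n :: nat and x where x: "x \<in> {..<n} \<rightarrow> M" "(\<Oplus>i\<in>{..<n}. x i \<otimes> x i) = w" by blast
    define x' where "x' = x(n := y)"
    have xM: "x' \<in> {..<Suc n} \<rightarrow> M" unfolding x'_def using x(1) add(3) by (auto simp: less_Suc_eq)
    have xc: "x' i \<in> carrier R" if "i < Suc n" for i using xM that Mp(1) by auto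
    have "(\<Oplus>i\<in>{..<Suc n}. x' i \<otimes> x' i) = x' n \<otimes> x' n \<oplus> (\<Oplus>i\<in>{..<n}. x' i \<otimes> x' i)"
      unfolding lessThan_Suc using xc by (intro finsum_insert) auto
    also have "(\<Oplus>i\<in>{..<n}. x' i \<otimes> x' i) = (\<Oplus>i\<in>{..<n}. x i \<otimes> x i)"
      using x(1) Mp(1) by (intro finsum_cong') (auto simp: x'_def)
    also have "x' n \<otimes> x' n \<oplus> \<dots> = w \<oplus> y \<otimes> y"
    proof -
      have "w \<in> carrier R" "y \<otimes> y \<in> carrier R"
        using sum_sq_props(1)[OF M add(1)] add(3) Mp(1) by auto
      then show ?thesis unfolding x(2) by (simp add: x'_def a_comm)
    qed
    finally show ?case using xM by blast
  qed
  then show ?thesis using assms(2) unfolding formally_real_def by blast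
qed

lemma quadratic_extension_mem:
  assumes M: "subfield M R" and t: "t \<in> carrier R" "t \<otimes> t \<in> M" and z: "z \<in> simple_extension M t"
  shows "\<exists>x\<in>M. \<exists>y\<in>M. z = x \<oplus> y \<otimes> t"
  using z
proof induct
  note Mp = subfield_props[OF M]
  case zero
  show ?case using Mp(2) t(1) by (intro bexI[of _ \<zero>]) auto
next
  note Mp = subfield_props[OF M]
  case (lin k1 k2)
  then obtain x y where xy: "x \<in> M" "y \<in> M" "k1 = x \<oplus> y \<otimes> t" by blast
  have c: "x \<in> carrier R" "y \<in> carrier R" "k2 \<in> carrier R" using xy lin Mp(1) by auto
  have "k1 \<otimes> t \<oplus> k2 = (y \<otimes> (t \<otimes> t) \<oplus> k2) \<oplus> x \<otimes> t" unfolding xy(3) using c t(1) by algebra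
  moreover have "y \<otimes> (t \<otimes> t) \<oplus> k2 \<in> M" using xy(1,2) lin(3) t(2) by (simp add: Mp(4,5))
  ultimately show ?case using xy(1) by (intro bexI)
qed

text \<open>Expanding squares (x + y t)^2 collects u from the x^2, v from the y^2, and the cross
  terms in q.\<close>

lemma sum_sq_quadratic_extension:
  assumes M: "subfield M R" and t: "t \<in> carrier R" "t \<otimes> t \<in> M"
    and w: "w \<in> sum_sq R (simple_extension M t)"
  shows "\<exists>u\<in>sum_sq R M. \<exists>v\<in>sum_sq R M. \<exists>q\<in>M. w = (u \<oplus> v \<otimes> (t \<otimes> t)) \<oplus> q \<otimes> t"
  using w
proof induct
  note Mp = subfield_props[OF M]
  case zero
  have "\<zero> = (\<zero> \<oplus> \<zero> \<otimes> (t \<otimes> t)) \<oplus> \<zero> \<otimes> t" using t(1) by simp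
  then show ?case using sum_sq.zero[of R M] Mp(2) by blast
next
  note Mp = subfield_props[OF M] and S = sum_sq_props[OF M]
  case (add w z)
  then obtain u v q where uvq: "u \<in> sum_sq R M" "v \<in> sum_sq R M" "q \<in> M"
    "w = (u \<oplus> v \<otimes> (t \<otimes> t)) \<oplus> q \<otimes> t" by blast
  obtain x y where xy: "x \<in> M" "y \<in> M" "z = x \<oplus> y \<otimes> t" using quadratic_extension_mem[OF M t add(3)] by blast
  have c: "u \<in> carrier R" "v \<in> carrier R" "q \<in> carrier R" "x \<in> carrier R" "y \<in> carrier R"
    using uvq xy S(1) Mp(1) by auto
  have "w \<oplus> z \<otimes> z = ((u \<oplus> x \<otimes> x) \<oplus> (v \<oplus> y \<otimes> y) \<otimes> (t \<otimes> t)) \<oplus> (q \<oplus> (x \<otimes> y \<oplus> x \<otimes> y)) \<otimes> t"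
    unfolding uvq(4) xy(3) using c t(1) by algebra
  moreover have "q \<oplus> (x \<otimes> y \<oplus> x \<otimes> y) \<in> M" using uvq(3) xy(1,2) by (simp add: Mp(4,5))
  ultimately show ?case
    by (intro bexI[OF _ sum_sq.add[OF uvq(1) xy(1)]] bexI[OF _ sum_sq.add[OF uvq(2) xy(2)]] bexI)
qed

text \<open>In -1 = u + v t^2 + q t the coefficient q vanishes because t is not in M, and v is
  nonzero because -1 is not a sum of squares in M. So -t^2 = (1 + u)/v.\<close>

lemma minus_one_sum_sq_quadratic:
  assumes M: "subfield M R" "\<ominus> \<one> \<notin> sum_sq R M" and t: "t \<in> carrier R" "t \<notin> M" "t \<otimes> t \<in> M"
    and w: "\<ominus> \<one> \<in> sum_sq R (simple_extension M t)"
  shows "\<ominus> (t \<otimes> t) \<in> sum_sq R M"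
proof -
  note Mp = subfield_props[OF M(1)] and S = sum_sq_props[OF M(1)]
  obtain u v q where uvq: "u \<in> sum_sq R M" "v \<in> sum_sq R M" "q \<in> M"
    "\<ominus> \<one> = (u \<oplus> v \<otimes> (t \<otimes> t)) \<oplus> q \<otimes> t"
    using sum_sq_quadratic_extension[OF M(1) t(1,3) w] by blast
  define c where "c = t \<otimes> t"
  have uM: "u \<in> M" "v \<in> M" "c \<in> M" using uvq S(1) t(3) unfolding c_def by auto
  have cc: "u \<in> carrier R" "v \<in> carrier R" "c \<in> carrier R" "q \<in> carrier R" using uM uvq Mp(1) by auto
  have eq: "\<ominus> \<one> = (u \<oplus> v \<otimes> c) \<oplus> q \<otimes> t" using uvq(4) unfolding c_def .
  have "q = \<zero>"
  proof (rule ccontr)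
    assume q: "q \<noteq> \<zero>"
    have "q \<otimes> t = \<ominus> \<one> \<ominus> (u \<oplus> v \<otimes> c)" unfolding eq using cc t(1) by algebra
    also have "\<dots> \<in> M" using uM by (simp add: Mp(3-7))
    finally show False using subfield_mult_cancel[OF M(1) uvq(3) q t(1)] t(2) by blast
  qed
  then have e: "\<ominus> \<one> = u \<oplus> v \<otimes> c" using eq cc t(1) by simp
  have v0: "v \<noteq> \<zero>"
  proof
    assume "v = \<zero>"
    then have "\<ominus> \<one> = u" using e cc by simp
    then show False using M(2) uvq(1) by simp
  qed
  have vu: "v \<in> Units R" using v0 cc field_Units by blast
  have "(\<one> \<oplus> u) \<otimes> inv v \<in> sum_sq R M"
    using S(2)[OF _ uvq(1), of \<one>] S(3)[OF Mp(3)] S(4) S(5)[OF uvq(2) v0] by simp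
  moreover have "\<one> \<oplus> u = v \<otimes> \<ominus> c"
  proof -
    have "\<one> \<oplus> u = \<ominus> (\<ominus> \<one>) \<oplus> u" by simp
    also have "\<dots> = v \<otimes> \<ominus> c" unfolding e using cc by algebra
    finally show ?thesis .
  qed
  then have "(\<one> \<oplus> u) \<otimes> inv v = \<ominus> c"
    using cc vu by (simp add: m_comm m_assoc[symmetric])
  ultimately show ?thesis unfolding c_def by simp
qed

end

section \<open>The ordering cut out by a twist-free map, and maximal formally real subfields\<close>

context kummer
begin

text \<open>The characteristic is not 2: the primitive root \<zeta> = -1 differs from 1.\<close>

lemma neg_eq_self:
  assumes "p = 2" "x \<in> carrier L" "\<ominus> x = x"
  shows "x = \<zero>"
proof (rule ccontr)
  assume "x \<noteq> \<zero>"
  moreover have "(\<ominus> \<one>) \<otimes> x = \<one> \<otimes> x" using assms(2,3) by (simp add: l_minus)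
  ultimately have "\<ominus> \<one> = \<one>" using m_rcancel[of x "\<ominus> \<one>" \<one>] assms(2) by simp
  then have "\<zeta> [^] (1::nat) = \<one>" using zeta_minus_one[OF assms(1)] by simp
  then show False using zeta_primitive[of 1] assms(1) by simp
qed

lemma square_root_exists:
  assumes "p = 2" "a \<in> carrier L"
  obtains s where "s \<in> carrier L" "s \<otimes> s = a"
  using root_exists[OF assms(2)] square assms(1) by metis

lemma twist_free_ordering:
  assumes p2: "p = 2" and h: "h \<in> hom_over L F" and tw: "twist_free h"
    and i: "\<iota> \<in> carrier L" "\<iota> \<otimes> \<iota> = \<ominus> \<one>" "h \<iota> \<noteq> \<iota>"
  shows "field_ordering L F (fixed_sqrts L F h)"
proof -
  note hh = self_hom[OF hom_overD(1)[OF h]] and Fp = subfield_props[OF F_subfield]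
  let ?P = "fixed_sqrts L F h"
  have Fc: "x \<in> carrier L" if "x \<in> F" for x using that Fp(1) by blast
  have conj: "h s = s \<or> h s = \<ominus> s" if "s \<in> carrier L" "s \<otimes> s \<in> F" for s
    using conjugate_of_square_root[OF p2 h that] .
  have P_iff: "a \<in> ?P \<longleftrightarrow> h s = s" if a: "a \<in> F" "a \<noteq> \<zero>" and s: "s \<in> carrier L" "s \<otimes> s = a" for a s
  proof
    show "h s = s" if "a \<in> ?P" using that s unfolding fixed_sqrts_def by blast
    assume hs: "h s = s"
    have "h t = t" if t: "t \<in> carrier L" "t \<otimes> t = a" for t
      using square_eq_square[OF s(1) t(1)] s t hs hh(6) by auto
    then show "a \<in> ?P" unfolding fixed_sqrts_def using a by blast
  qed
  have nonzero: "s \<noteq> \<zero>" if "s \<otimes> s \<noteq> \<zero>" "s \<in> carrier L" for s using that by auto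
  have hi: "h \<iota> = \<ominus> \<iota>" using conj[OF i(1)] i Fp by auto
  \<comment> \<open>If s is a square root of a, then s \<iota> is one of -a. Since h negates \<iota>
    and sends s to s or -s, it fixes exactly one of the two.\<close>
  have xor: "(a \<in> ?P) \<noteq> (\<ominus> a \<in> ?P)" if a: "a \<in> F" "a \<noteq> \<zero>" for a
  proof -
    obtain s where s: "s \<in> carrier L" "s \<otimes> s = a" using square_root_exists[OF p2 Fc[OF a(1)]] .
    have s0: "s \<noteq> \<zero>" using nonzero s a(2) by blast
    have si: "s \<otimes> \<iota> \<in> carrier L" "(s \<otimes> \<iota>) \<otimes> (s \<otimes> \<iota>) = \<ominus> a"
    proof -
      have "(s \<otimes> \<iota>) \<otimes> (s \<otimes> \<iota>) = (s \<otimes> s) \<otimes> (\<iota> \<otimes> \<iota>)" using s(1) i(1) by algebra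
      also have "\<dots> = \<ominus> a" unfolding s(2) i(2) using Fc[OF a(1)] by algebra
      finally show "(s \<otimes> \<iota>) \<otimes> (s \<otimes> \<iota>) = \<ominus> a" .
    qed (use s i in simp)
    have i0: "\<iota> \<noteq> \<zero>" using i(3) hh(2) by auto
    have "\<ominus> a \<noteq> \<zero>" "\<ominus> a \<in> F" using a Fc[OF a(1)] Fp(6) by auto
    then have n: "\<ominus> a \<in> ?P \<longleftrightarrow> h (s \<otimes> \<iota>) = s \<otimes> \<iota>" using P_iff si by blast
    have y: "a \<in> ?P \<longleftrightarrow> h s = s" using P_iff[OF a s] .
    have m: "h (s \<otimes> \<iota>) = h s \<otimes> \<ominus> \<iota>" using hh(5)[OF s(1) i(1)] hi by simp
    have si0: "s \<otimes> \<iota> \<noteq> \<zero>" using s0 i0 s(1) i(1) integral by blast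
    have "s \<otimes> s \<in> F" using s a by simp
    from conj[OF s(1) this] show ?thesis
    proof
      assume *: "h s = s"
      then have "h (s \<otimes> \<iota>) = \<ominus> (s \<otimes> \<iota>)" using m s(1) i(1) by (simp add: r_minus)
      then have "h (s \<otimes> \<iota>) \<noteq> s \<otimes> \<iota>" using neg_eq_self[OF p2 si(1)] si0 by auto
      then show ?thesis using n y * by blast
    next
      assume *: "h s = \<ominus> s"
      then have "h (s \<otimes> \<iota>) = s \<otimes> \<iota>" using m s(1) i(1) by (simp add: r_minus l_minus)
      moreover have "h s \<noteq> s" using * neg_eq_self[OF p2 s(1)] s0 by auto
      ultimately show ?thesis using n y by blast
    qed
  qed
  have Psub: "a \<in> F" "a \<noteq> \<zero>" if "a \<in> ?P" for a using that unfolding fixed_sqrts_def by auto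
  have mult: "a \<otimes> b \<in> ?P" if ab: "a \<in> ?P" "b \<in> ?P" for a b
  proof -
    obtain s where s: "s \<in> carrier L" "s \<otimes> s = a" using square_root_exists[OF p2 Fc[OF Psub(1)[OF ab(1)]]] .
    obtain t where t: "t \<in> carrier L" "t \<otimes> t = b" using square_root_exists[OF p2 Fc[OF Psub(1)[OF ab(2)]]] .
    have "h s = s" "h t = t" using P_iff[OF Psub[OF ab(1)] s] P_iff[OF Psub[OF ab(2)] t] ab by auto
    then have st: "h (s \<otimes> t) = s \<otimes> t" using hh(5)[OF s(1) t(1)] by simp
    have e: "(s \<otimes> t) \<otimes> (s \<otimes> t) = a \<otimes> b"
      unfolding s(2)[symmetric] t(2)[symmetric] using s(1) t(1) by algebra
    have "a \<otimes> b \<in> F" using Fp(5) Psub ab by blast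
    moreover have "a \<otimes> b \<noteq> \<zero>" using Psub[OF ab(1)] Psub[OF ab(2)] Fc integral by blast
    ultimately show ?thesis using P_iff[OF _ _ _ e] s(1) t(1) st by simp
  qed
  have "\<one> \<in> ?P" using P_iff[of \<one> \<one>] Fp(3) hh(3) by simp
  then have minus_one: "\<ominus> \<one> \<notin> ?P" using xor[of \<one>] Fp(3) by simp
  \<comment> \<open>A square root d of -c is moved to -d. For \<beta>^2 = 1 + d,
    \<open>twist_free\<close> makes h interchange \<beta> and h\<beta>, so \<beta> h\<beta> is a
    fixed square root of (1 + d)(1 - d) = 1 + c.\<close>
  have succ: "\<one> \<oplus> c \<in> ?P" if c: "c \<in> ?P" for c
  proof (rule ccontr)
    assume n: "\<one> \<oplus> c \<notin> ?P"
    have cF: "c \<in> F" "c \<noteq> \<zero>" "c \<in> carrier L" using Psub[OF c] Fc by auto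
    have sF: "\<one> \<oplus> c \<in> F" using Fp(3,4) cF by blast
    have s0: "\<one> \<oplus> c \<noteq> \<zero>"
    proof
      assume "\<one> \<oplus> c = \<zero>"
      then have "c \<oplus> \<one> = \<zero>" using cF(3) by (simp add: a_comm)
      then have "c = \<ominus> \<one>" using minus_equality[of c \<one>] cF(3) by simp
      then show False using minus_one c by simp
    qed
    have nc: "\<ominus> c \<in> F" "\<ominus> c \<noteq> \<zero>" "\<ominus> c \<notin> ?P" using cF Fp(6) xor[OF cF(1,2)] c by auto
    obtain d where d: "d \<in> carrier L" "d \<otimes> d = \<ominus> c" using square_root_exists[OF p2 Fc[OF nc(1)]] .
    have dF: "d [^] p \<in> F" using d square p2 nc(1) by simp
    have hd: "h d \<noteq> d" using P_iff[OF nc(1,2) d] nc(3) by blast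
    have hd': "h d = \<ominus> d" using conj[OF d(1)] d(2) nc(1) hd by auto
    have dc: "\<one> \<oplus> d \<in> carrier L" using d(1) by simp
    obtain \<beta> where b: "\<beta> \<in> carrier L" "\<beta> \<otimes> \<beta> = \<one> \<oplus> d" using square_root_exists[OF p2 dc] .
    have "\<beta> [^] p = \<one> \<oplus> d" using b square p2 by simp
    then have "(h ^^ p) \<beta> = \<beta>" using tw d(1) dF hd b(1) p2 unfolding twist_free_def by blast
    then have hhb: "h (h \<beta>) = \<beta>" using p2 by (simp add: numeral_2_eq_2)
    have hb: "h \<beta> \<in> carrier L" using hh(1)[OF b(1)] .
    have hb2: "h \<beta> \<otimes> h \<beta> = \<one> \<oplus> \<ominus> d"
      using hh(5)[OF b(1) b(1)] b(2) hh(4)[of \<one> d] d(1) hh(3) hd' by simp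
    have r: "\<beta> \<otimes> h \<beta> \<in> carrier L" using b(1) hb by simp
    have "(\<beta> \<otimes> h \<beta>) \<otimes> (\<beta> \<otimes> h \<beta>) = (\<beta> \<otimes> \<beta>) \<otimes> (h \<beta> \<otimes> h \<beta>)" using b(1) hb by algebra
    also have "\<dots> = \<one> \<ominus> d \<otimes> d" unfolding b(2) hb2 using d(1) by algebra
    also have "\<dots> = \<one> \<oplus> c" unfolding d(2) using cF(3) by algebra
    finally have r2: "(\<beta> \<otimes> h \<beta>) \<otimes> (\<beta> \<otimes> h \<beta>) = \<one> \<oplus> c" .
    have "h (\<beta> \<otimes> h \<beta>) = h \<beta> \<otimes> \<beta>" using hh(5)[OF b(1) hb] hhb by simp
    also have "\<dots> = \<beta> \<otimes> h \<beta>" using b(1) hb by algebra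
    finally show False using P_iff[OF sF s0 r r2] n by blast
  qed
  \<comment> \<open>Reduced to \<open>succ\<close> by a + b = a (1 + b/a). The inverse of a is in P,
    since otherwise its negative would be, and multiplying by a would put -1 into P.\<close>
  have add: "a \<oplus> b \<in> ?P" if ab: "a \<in> ?P" "b \<in> ?P" for a b
  proof -
    have a: "a \<in> F" "a \<noteq> \<zero>" "a \<in> carrier L" using Psub[OF ab(1)] Fc by auto
    have b: "b \<in> F" "b \<in> carrier L" using Psub[OF ab(2)] Fc by auto
    have ia: "inv a \<in> F" "inv a \<noteq> \<zero>" "inv a \<in> carrier L" "a \<otimes> inv a = \<one>"
    proof -
      have u: "a \<in> Units L" using a field_Units by blast
      show 1: "inv a \<in> F" using Fp(8)[OF a(1,2)] .
      then show "inv a \<in> carrier L" using Fc by blast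
      show e: "a \<otimes> inv a = \<one>" using u by simp
      show "inv a \<noteq> \<zero>" using e a(3) by auto
    qed
    have "inv a \<in> ?P"
    proof (rule ccontr)
      assume "inv a \<notin> ?P"
      then have "\<ominus> (inv a) \<in> ?P" using xor[OF ia(1,2)] by blast
      then have "a \<otimes> \<ominus> (inv a) \<in> ?P" using mult ab(1) by blast
      moreover have "a \<otimes> \<ominus> (inv a) = \<ominus> \<one>" using a(3) ia(3,4) by (simp add: r_minus)
      ultimately show False using minus_one by simp
    qed
    then have "\<one> \<oplus> inv a \<otimes> b \<in> ?P" using succ mult ab(2) by blast
    then have "a \<otimes> (\<one> \<oplus> inv a \<otimes> b) \<in> ?P" using mult ab(1) by blast
    moreover have "a \<otimes> (\<one> \<oplus> inv a \<otimes> b) = a \<oplus> (a \<otimes> inv a) \<otimes> b" using a(3) b(2) ia(3) by algebra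
    ultimately show ?thesis using ia(4) b(2) by simp
  qed
  show ?thesis unfolding field_ordering_def
  proof (intro conjI ballI)
    show "?P \<subseteq> F - {\<zero>}" using Psub by auto
    show "(a \<in> ?P) \<noteq> (\<ominus> a \<in> ?P)" if "a \<in> F - {\<zero>}" for a using xor[of a] that by simp
  qed (fact add mult)+
qed

text \<open>A representation of -1 as a sum of squares uses finitely many elements, hence lives in
  one member of a chain; this is the bound Zorn's lemma asks for, applied to subfields of
  \<open>F22\<close>.\<close>

lemma maximal_formally_real:
  assumes "formally_real L F"
  obtains R where "subfield R L" "F \<subseteq> R" "R \<subseteq> F22" "\<ominus> \<one> \<notin> sum_sq L R"
    "\<And>M. subfield M L \<Longrightarrow> R \<subseteq> M \<Longrightarrow> M \<subseteq> F22 \<Longrightarrow> \<ominus> \<one> \<notin> sum_sq L M \<Longrightarrow> M = R"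
proof -
  define A where "A = {M. subfield M L \<and> F \<subseteq> M \<and> M \<subseteq> F22 \<and> \<ominus> \<one> \<notin> sum_sq L M}"
  have FA: "F \<in> A" unfolding A_def
    using F_subfield F22_props(3) formally_real_sum_sq[OF F_subfield assms] by simp
  have "\<exists>R\<in>A. \<forall>M\<in>A. R \<subseteq> M \<longrightarrow> M = R"
  proof (rule subset_Zorn_nonempty)
    show "A \<noteq> {}" using FA by blast
    fix \<C> assume C: "\<C> \<noteq> {}" "subset.chain A \<C>"
    have CA: "subfield M L" "F \<subseteq> M" "M \<subseteq> F22" "\<ominus> \<one> \<notin> sum_sq L M" if "M \<in> \<C>" for M
      using that C(2) unfolding subset.chain_def A_def by auto
    have common: "\<exists>M\<in>\<C>. x \<in> M \<and> y \<in> M" if "x \<in> \<Union>\<C>" "y \<in> \<Union>\<C>" for x y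
      using C(2) that unfolding subset_chain_def by blast
    have "subfield (\<Union>\<C>) L"
    proof (rule subfieldI')
      show "subring (\<Union>\<C>) L"
      proof (rule subringI)
        show "\<Union>\<C> \<subseteq> carrier L" using subfield_props(1)[OF CA(1)] by blast
        show "\<one> \<in> \<Union>\<C>" using C(1) subfield_props(3)[OF CA(1)] by blast
        show "\<ominus> x \<in> \<Union>\<C>" if "x \<in> \<Union>\<C>" for x using that subfield_props(6)[OF CA(1)] by blast
        show "x \<otimes> y \<in> \<Union>\<C>" if "x \<in> \<Union>\<C>" "y \<in> \<Union>\<C>" for x y
          using common[OF that] subfield_props(5)[OF CA(1)] by blast
        show "x \<oplus> y \<in> \<Union>\<C>" if "x \<in> \<Union>\<C>" "y \<in> \<Union>\<C>" for x y
          using common[OF that] subfield_props(4)[OF CA(1)] by blast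
      qed
      show "inv k \<in> \<Union>\<C>" if "k \<in> \<Union>\<C> - {\<zero>}" for k using that subfield_props(8)[OF CA(1)] by blast
    qed
    moreover have "F \<subseteq> \<Union>\<C>" using C(1) CA(2) by blast
    moreover have "\<Union>\<C> \<subseteq> F22" using CA(3) by blast
    moreover have "\<ominus> \<one> \<notin> sum_sq L (\<Union>\<C>)" using sum_sq_Union_chain[OF C] CA(4) by blast
    ultimately show "\<Union>\<C> \<in> A" unfolding A_def by simp
  qed
  then obtain R where R: "R \<in> A" "\<forall>M\<in>A. R \<subseteq> M \<longrightarrow> M = R" by (elim bexE)
  have R': "subfield R L" "F \<subseteq> R" "R \<subseteq> F22" "\<ominus> \<one> \<notin> sum_sq L R" using R(1) unfolding A_def by auto
  have "M = R" if M: "subfield M L" "R \<subseteq> M" "M \<subseteq> F22" "\<ominus> \<one> \<notin> sum_sq L M" for M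
  proof -
    have "M \<in> A" unfolding A_def using M R'(2) by auto
    then show ?thesis using R(2) M(2) by (elim ballE[where x = M]) simp_all
  qed
  then show thesis using that[OF R'] by blast
qed

end

context kummer
begin

text \<open>The involution is complex conjugation of \<open>R(\<surd>-1)\<close> for a maximal formally real \<open>R\<close> inside
  \<open>F22\<close>; that \<open>R(\<surd>-1)\<close> is all of \<open>F22\<close> uses only the explicit square root of \<open>u + v\<surd>-1\<close>.\<close>

lemma formally_real_involution:
  assumes p2: "p = 2" and fr: "formally_real L F"
  obtains h \<iota> where "h \<in> hom_over L F" "\<iota> \<in> carrier L" "\<iota> \<otimes> \<iota> = \<ominus> \<one>" "h \<iota> \<noteq> \<iota>"
    "\<And>y. y \<in> F22 \<Longrightarrow> h (h y) = y"
proof -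
  obtain R where R: "subfield R L" "F \<subseteq> R" "R \<subseteq> F22" "\<ominus> \<one> \<notin> sum_sq L R"
    and max: "\<And>M. subfield M L \<Longrightarrow> R \<subseteq> M \<Longrightarrow> M \<subseteq> F22 \<Longrightarrow> \<ominus> \<one> \<notin> sum_sq L M \<Longrightarrow> M = R"
    using maximal_formally_real[OF fr] by blast
  note Rp = subfield_props[OF R(1)] and S = sum_sq_props[OF R(1)] and Fp = subfield_props[OF F_subfield]
    and Qp = subfield_props[OF F22_props(1)]
  have Rc: "x \<in> carrier L" if "x \<in> R" for x using that Rp(1) by blast
  have Qc: "x \<in> carrier L" if "x \<in> F22" for x using that Qp(1) by blast
  obtain \<iota> where i: "\<iota> \<in> carrier L" "\<iota> \<otimes> \<iota> = \<ominus> \<one>" using square_root_exists[OF p2, of "\<ominus> \<one>"] by auto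
  have ip: "\<iota> [^] p = \<ominus> \<one>" using i square p2 by simp
  have iF: "\<iota> [^] p \<in> F" "\<iota> [^] p \<in> R" unfolding ip using Fp(3,6) R(2) by auto
  have iQ: "\<iota> \<in> F22" using F2_props(4)[OF i(1) iF(1)] F22_props(2) by blast
  have i0: "\<iota> \<noteq> \<zero>"
  proof
    assume "\<iota> = \<zero>"
    then have "\<ominus> \<one> = \<zero>" using i(2) by simp
    then have "\<one> = \<zero>" using l_neg[of \<one>] by simp
    then show False by simp
  qed
  have iR: "\<iota> \<notin> R"
  proof
    assume "\<iota> \<in> R"
    then have "\<ominus> \<one> \<in> sum_sq L R" using S(3) i(2) by metis
    then show False using R(4) by blast
  qed
  \<comment> \<open>By maximality R(t) is no longer formally real, so -1 is a sum of squares
    there.\<close>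
  have step: "\<ominus> (t \<otimes> t) \<in> sum_sq L R" if t: "t \<in> F22" "t \<notin> R" "t \<otimes> t \<in> R" for t
  proof -
    note T = simple_kummer_subfield[OF R(1,2) Qc[OF t(1)]]
    have sub: "simple_extension R t \<subseteq> F22"
      using simple_extension_subring_incl[OF subfieldE(1)[OF F22_props(1)] R(3) t(1)] .
    have "\<ominus> \<one> \<in> sum_sq L (simple_extension R t)" using max[OF T(1,2) sub] T(3) t(2) by auto
    then show ?thesis using minus_one_sum_sq_quadratic[OF R(1,4) Qc[OF t(1)] t(2,3)] by blast
  qed
  \<comment> \<open>If both failed, \<open>step\<close> for t and for \<iota> t would make -t^2 and
    t^2 sums of squares, and their quotient is -1.\<close>
  have dich: "t \<in> R \<or> \<iota> \<otimes> t \<in> R" if t: "t \<in> F22" "t \<otimes> t \<in> R" for t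
  proof (rule ccontr)
    assume n: "\<not> ?thesis"
    define c where "c = t \<otimes> t"
    have tc: "t \<in> carrier L" "c \<in> carrier L" using Qc[OF t(1)] unfolding c_def by auto
    have itQ: "\<iota> \<otimes> t \<in> F22" using Qp(5)[OF iQ t(1)] .
    have it: "(\<iota> \<otimes> t) \<otimes> (\<iota> \<otimes> t) = \<ominus> c"
    proof -
      have "(\<iota> \<otimes> t) \<otimes> (\<iota> \<otimes> t) = (\<iota> \<otimes> \<iota>) \<otimes> (t \<otimes> t)" using i(1) tc by algebra
      then show ?thesis using i(2) tc unfolding c_def by (simp add: l_minus)
    qed
    have 1: "\<ominus> c \<in> sum_sq L R" unfolding c_def using step t n by blast
    have "\<ominus> (\<ominus> c) \<in> sum_sq L R"
      using step[OF itQ] n Rp(6)[OF t(2)] it unfolding c_def by simp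
    then have 2: "c \<in> sum_sq L R" using tc by simp
    have "t \<noteq> \<zero>" using n Rp(2) by auto
    then have c0: "c \<noteq> \<zero>" unfolding c_def using tc integral by blast
    have "\<ominus> c \<otimes> inv c \<in> sum_sq L R" using S(4)[OF 1 S(5)[OF 2 c0]] .
    moreover have "c \<in> Units L" using c0 tc field_Units by blast
    then have "\<ominus> c \<otimes> inv c = \<ominus> \<one>" using tc by (simp add: l_minus)
    ultimately show False using R(4) by simp
  qed
  let ?K = "simple_extension R \<iota>"
  note K = simple_kummer_subfield[OF R(1,2) i(1)]
  note Kp = subfield_props[OF K(1)]
  have inK: "t \<in> ?K" if t: "t \<in> F22" "t \<otimes> t \<in> R" for t
    using dich[OF t] subfield_mult_cancel[OF K(1,3) i0 Qc[OF t(1)]] K(2) by blast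
  obtain h where h: "h \<in> hom_over L R" "h \<iota> = \<zeta> [^] (1::nat) \<otimes> \<iota>"
    using kummer_simple(2)[OF R(1,2) i(1) iF(2) iR] by blast
  note hh = self_hom[OF hom_overD(1)[OF h(1)]]
  have hi: "h \<iota> = \<ominus> \<iota>" using h(2) zeta_minus_one[OF p2] i(1) by (simp add: l_minus)
  have hF: "h \<in> hom_over L F" using hom_over_le[OF h(1) R(2)] .
  have hhK: "h (h y) = y" if y: "y \<in> ?K" for y
  proof -
    have "(h \<circ> h) \<iota> = id \<iota>" using hi hh(6)[OF i(1)] i(1) by simp
    then have "(h \<circ> h) y = id y"
      using hom_over_simple_extension_eq[OF R(1) i(1) hom_over_comp[OF h(1) h(1)] id_hom_over _ y] by blast
    then show ?thesis by simp
  qed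
  have two: "t \<oplus> t \<in> ?K \<Longrightarrow> t \<in> ?K" if "t \<in> carrier L" for t
  proof -
    assume tt: "t \<oplus> t \<in> ?K"
    have "(\<one> \<oplus> \<one>) \<otimes> t = t \<oplus> t" using that by algebra
    moreover have "\<one> \<oplus> \<one> \<noteq> \<zero>"
    proof
      assume "\<one> \<oplus> \<one> = \<zero>"
      then have "\<ominus> \<one> = \<one>" using minus_equality[of \<one> \<one>] by simp
      then show False using neg_eq_self[OF p2, of \<one>] by simp
    qed
    moreover have "\<one> \<oplus> \<one> \<in> ?K" using Kp(3,4) by blast
    ultimately show "t \<in> ?K" using subfield_mult_cancel[OF K(1), of "\<one> \<oplus> \<one>" t] that tt by simp
  qed
  have F2K: "F2 \<subseteq> ?K"
    unfolding F2_def
  proof (rule kum_subset_iff[OF F_subfield K(1)])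
    show "F \<subseteq> ?K" using R(2) K(2) by blast
    fix x assume x: "x \<in> carrier L" "x [^] p \<in> F"
    have "x \<in> F22" using F2_props(4)[OF x] F22_props(2) by blast
    moreover have "x \<otimes> x \<in> R" using x square p2 R(2) by auto
    ultimately show "x \<in> ?K" using inK by blast
  qed
  have F22K: "F22 \<subseteq> ?K"
    unfolding F22_def
  proof (rule kum_subset_iff[OF F2_props(1) K(1) F2K])
    fix s assume s: "s \<in> carrier L" "s [^] p \<in> F2"
    have sQ: "s \<in> F22" using F22_props(5)[OF s] .
    define b where "b = s \<otimes> s"
    have "b \<in> ?K" unfolding b_def using s square p2 F2K by auto
    then obtain u v where uv: "u \<in> R" "v \<in> R" "b = u \<oplus> v \<otimes> \<iota>"
      using quadratic_extension_mem[OF R(1) i(1), of b] iF(2) square[OF i(1)] p2 by auto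
    have c: "u \<in> carrier L" "v \<in> carrier L" using uv Rc by auto
    \<comment> \<open>The conjugate root, with r^2 = u - v \<iota>. With n = s r in
      \<open>R\<close>, the squares of s + r and s - r are 2u + 2n and 2u - 2n, both in
      \<open>R\<close>, so both elements lie in R(\<iota>); halving their sum recovers s.\<close>
    define r where "r = h s"
    have rQ: "r \<in> F22" unfolding r_def using stable_overD[OF F22_props(4) hF sQ] .
    have rc: "r \<in> carrier L" using Qc[OF rQ] .
    have rr: "r \<otimes> r = u \<oplus> \<ominus> (v \<otimes> \<iota>)"
    proof -
      have "r \<otimes> r = h b" unfolding r_def b_def using hh(5)[OF s(1) s(1)] by simp
      also have "\<dots> = h u \<oplus> h v \<otimes> h \<iota>" unfolding uv(3) using hh(4,5) c i(1) by simp
      finally show ?thesis using hom_overD(2)[OF h(1)] uv(1,2) hi c i(1) by (simp add: r_minus)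
    qed
    have ss: "s \<otimes> s = u \<oplus> v \<otimes> \<iota>" using uv(3) unfolding b_def .
    define n where "n = s \<otimes> r"
    have nQ: "n \<in> F22" unfolding n_def using Qp(5)[OF sQ rQ] .
    have nc: "n \<in> carrier L" using Qc[OF nQ] .
    have nn: "n \<otimes> n = u \<otimes> u \<oplus> v \<otimes> v"
    proof -
      have "n \<otimes> n = (s \<otimes> s) \<otimes> (r \<otimes> r)" unfolding n_def using s(1) rc by algebra
      also have "\<dots> = u \<otimes> u \<ominus> (v \<otimes> v) \<otimes> (\<iota> \<otimes> \<iota>)" unfolding ss rr using c i(1) by algebra
      also have "\<dots> = u \<otimes> u \<oplus> v \<otimes> v" unfolding i(2) using c by algebra
      finally show ?thesis .
    qed
    have nnR: "n \<otimes> n \<in> R" unfolding nn using uv Rp(4,5) by simp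
    \<comment> \<open>n^2 = u^2 + v^2 is a sum of squares. Were n outside \<open>R\<close>, then w =
      \<iota> n would be in \<open>R\<close> with -w^2 = n^2 a sum of squares, and dividing by w^2
      would make -1 one too.\<close>
    have nR: "n \<in> R"
    proof (rule ccontr)
      assume nn0: "n \<notin> R"
      then have w: "\<iota> \<otimes> n \<in> R" using dich[OF nQ nnR] by blast
      define w where "w = \<iota> \<otimes> n"
      have wR: "w \<in> R" "w \<in> carrier L" using w Rc unfolding w_def by auto
      have "w \<noteq> \<zero>" unfolding w_def using i0 i(1) nc integral nn0 Rp(2) by blast
      then have w0: "w \<otimes> w \<noteq> \<zero>" using wR(2) integral by blast
      have "w \<otimes> w = (\<iota> \<otimes> \<iota>) \<otimes> (n \<otimes> n)" unfolding w_def using i(1) nc by algebra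
      then have ww: "\<ominus> (w \<otimes> w) = n \<otimes> n" using i(2) nc by (simp add: l_minus)
      have "n \<otimes> n \<in> sum_sq L R" unfolding nn using S(2,3) uv by blast
      then have "\<ominus> (w \<otimes> w) \<otimes> inv (w \<otimes> w) \<in> sum_sq L R"
        unfolding ww[symmetric] using S(4) S(5)[OF S(3)[OF wR(1)] w0] by blast
      moreover have "w \<otimes> w \<in> Units L" using w0 wR(2) field_Units by blast
      then have "\<ominus> (w \<otimes> w) \<otimes> inv (w \<otimes> w) = \<ominus> \<one>" using wR(2) by (simp add: l_minus)
      ultimately show False using R(4) by simp
    qed
    have "(s \<oplus> r) \<otimes> (s \<oplus> r) = (s \<otimes> s \<oplus> r \<otimes> r) \<oplus> (n \<oplus> n)" unfolding n_def using s(1) rc by algebra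
    also have "\<dots> = (u \<oplus> u) \<oplus> (n \<oplus> n)" unfolding ss rr using c i(1) nc by algebra
    also have "\<dots> \<in> R" using uv(1) nR Rp(4) by simp
    finally have 1: "s \<oplus> r \<in> ?K" using inK[of "s \<oplus> r"] Qp(4)[OF sQ rQ] by blast
    have "(s \<ominus> r) \<otimes> (s \<ominus> r) = (s \<otimes> s \<oplus> r \<otimes> r) \<ominus> (n \<oplus> n)" unfolding n_def using s(1) rc by algebra
    also have "\<dots> = (u \<oplus> u) \<ominus> (n \<oplus> n)" unfolding ss rr using c i(1) nc by algebra
    also have "\<dots> \<in> R" using uv(1) nR Rp(4,7) by simp
    finally have 2: "s \<ominus> r \<in> ?K" using inK[of "s \<ominus> r"] Qp(7)[OF sQ rQ] by blast
    have "s \<oplus> s = (s \<oplus> r) \<oplus> (s \<ominus> r)" using s(1) rc by algebra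
    also have "\<dots> \<in> ?K" using Kp(4)[OF 1 2] .
    finally show "s \<in> ?K" using two[OF s(1)] by blast
  qed
  have "h \<iota> \<noteq> \<iota>" using hi neg_eq_self[OF p2 i(1)] i0 by auto
  then show thesis using that[OF hF i] hhK F22K by blast
qed

lemma funpow_restrict:
  assumes "stable_over L F E" "h \<in> hom_over L F" "x \<in> E"
  shows "(restrict h E ^^ n) x = (h ^^ n) x \<and> (h ^^ n) x \<in> E"
  using assms(3) stable_overD[OF assms(1,2)] by (induct n) auto

text \<open>A cyclic E lies in \<open>F2\<close>, so its root adjunction lies in \<open>F22\<close>;
  stability over \<open>F\<close> is inherited from E.\<close>

lemma second_ext_of_cyclic:
  assumes E: "E \<subseteq> sep" "cyclic_extension L p F E"
  shows "second_ext L sep p E = kum E" "subfield (kum E) L" "E \<subseteq> kum E" "kum E \<subseteq> F22" "F \<subseteq> kum E"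
    "stable_over L F (kum E)"
proof -
  have gal: "galois_extension L F E" using E(2) unfolding cyclic_extension_def by blast
  have s: "subfield E L" "F \<subseteq> E" using gal unfolding galois_extension_def by auto
  have "E \<subseteq> F2" unfolding F2_def using cyclic_subset_kum[OF F_subfield order.refl E(2)] .
  then show sub: "kum E \<subseteq> F22" unfolding F22_def using kum_mono[OF s(1) F2_props(1)] by blast
  show "second_ext L sep p E = kum E" using second_ext_eq[OF s sub] .
  show "subfield (kum E) L" "E \<subseteq> kum E" using kum_props[OF s(1)] by auto
  then show "F \<subseteq> kum E" using s(2) by blast
  show "stable_over L F (kum E)" using kum_stable[OF s(1) galois_stable[OF gal order.refl]] .
qed

text \<open>For E = F(\<alpha>) both kinds of \<beta> have \<beta>^p in E, so they lie in
  \<open>kum E\<close>. As h multiplies \<alpha> by a nontrivial power of \<zeta>, p divides the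
  order there, and the bound makes the order exactly p. The lower bound 1 excludes the value 0 by
  which \<open>ord\<close> encodes infinite order.\<close>

lemma twist_free_if_bounded_order:
  assumes h: "h \<in> hom_over L F"
    and ord: "\<And>E. E \<subseteq> sep \<Longrightarrow> cyclic_extension L p F E \<Longrightarrow>
      group.ord (galois_group L F (kum E)) (restrict h (kum E)) \<in> {1..p}"
  shows "twist_free h"
  unfolding twist_free_def
proof (intro ballI impI)
  fix \<alpha> \<beta> assume a: "\<alpha> \<in> carrier L" "\<alpha> [^] p \<in> F" "h \<alpha> \<noteq> \<alpha>"
    and b: "\<beta> \<in> carrier L" "\<beta> [^] p = \<alpha> \<or> (p = 2 \<and> \<beta> [^] p = \<one> \<oplus> \<alpha>)"
  let ?E = "simple_extension F \<alpha>"
  note S = simple_kummer_subfield[OF F_subfield order.refl a(1)]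
  have aF: "\<alpha> \<notin> F" using a(3) hom_overD(2)[OF h] by blast
  have a22: "\<alpha> \<in> F22" using F2_props(4)[OF a(1,2)] F22_props(2) by blast
  note kc = kummer_cyclic[OF F_subfield order.refl F22_props(3) a22 a(2) aF]
  have Es: "?E \<subseteq> sep" using kc(2) F22_sep by blast
  note E = second_ext_of_cyclic[OF Es kc(1)]
  let ?\<tau> = "restrict h (kum ?E)"
  interpret T: group "galois_group L F (kum ?E)" using group_galois_group[OF E(2,5)] .
  have t: "?\<tau> \<in> carrier (galois_group L F (kum ?E))"
    using restrict_in_galois_group[OF F_subfield order.refl E(5,2,6) h] .
  define m where "m = T.ord ?\<tau>"
  have m: "1 \<le> m" "m \<le> p" using ord[OF Es kc(1)] unfolding m_def by auto
  have hm: "(h ^^ m) x = x" if x: "x \<in> kum ?E" for x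
  proof -
    have "?\<tau> [^]\<^bsub>galois_group L F (kum ?E)\<^esub> m = \<one>\<^bsub>galois_group L F (kum ?E)\<^esub>"
      unfolding m_def using T.pow_ord_eq_1[OF t] .
    then have "(?\<tau> ^^ m) x = x"
      using galois_group_pow[OF E(2,5) t x, of m] x by (simp add: galois_group_one)
    then show ?thesis using funpow_restrict[OF E(6) h x, of m] by simp
  qed
  obtain j where j: "h \<alpha> = \<zeta> [^] (j::nat) \<otimes> \<alpha>" using hom_root[OF h a(1,2)] by metis
  have a0: "\<alpha> \<noteq> \<zero>" using a(3) self_hom(2)[OF hom_overD(1)[OF h]] by auto
  have "\<zeta> [^] j \<noteq> \<one>" using j a(1,3) by auto
  then have nj: "\<not> p dvd j" using zeta_pow_one_iff by blast
  have "\<alpha> \<in> kum ?E" using S(3) E(3) by blast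
  then have "\<zeta> [^] (j * m) \<otimes> \<alpha> = \<one> \<otimes> \<alpha>" using hm funpow_eigenvector[OF h order.refl a(1) j, of m] a(1) by simp
  then have "\<zeta> [^] (j * m) = \<one>" using m_rcancel[OF a0 a(1), of "\<zeta> [^] (j * m)" \<one>] by simp
  then have "p dvd m" using zeta_pow_one_iff nj prime by (metis prime_dvd_mult_iff)
  then have mp: "m = p" using m by (meson dvd_imp_le le_antisym less_le_trans zero_less_one)
  have "\<alpha> \<in> ?E" "\<one> \<oplus> \<alpha> \<in> ?E" using S(3) subfield_props(3,4)[OF S(1)] by auto
  then have "\<beta> [^] p \<in> ?E" using b(2) by auto
  then have "\<beta> \<in> kum ?E" using kum_props(3)[OF S(1) b(1)] by blast
  then show "(h ^^ p) \<beta> = \<beta>" using hm mp by blast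
qed

end

section \<open>From group elements to orderings and back\<close>

context kummer_layer
begin

text \<open>The results on \<open>twist_free\<close> speak of the lift h; they transfer to s because
  all square roots of elements of \<open>F\<close> lie in \<open>U\<close>, where s and h
  agree.\<close>

lemma twist_free_imp_ordering:
  assumes s: "s \<in> carrier Gal" "s \<notin> frattini Gal (krull_topology L F U)"
    and tw: "\<And>h. h \<in> hom_over L F \<Longrightarrow> s = restrict h U \<Longrightarrow> twist_free h"
  shows "p = 2 \<and> formally_real L F \<and> field_ordering L F (fixed_sqrts L F s)"
proof -
  obtain h where h: "h \<in> hom_over L F" "s = restrict h U"
    using galois_group_lift[OF order.refl FU U(1) s(1)] by blast
  have F2U: "x \<in> U" if "x \<in> carrier L" "x [^] p \<in> F" for x using F2_props(4)[OF that] U(2) by blast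
  obtain \<alpha> where a: "\<alpha> \<in> carrier L" "\<alpha> [^] p \<in> F" "s \<alpha> \<noteq> \<alpha>" using not_frattini_moves_root[OF s] by blast
  then have ha: "h \<alpha> \<noteq> \<alpha>" using h(2) F2U by simp
  note tw = tw[OF h]
  note p2 = twist_free_p2[OF h(1) a(1,2) ha tw]
  obtain \<iota> where i: "\<iota> \<in> carrier L" "\<iota> \<otimes> \<iota> = \<ominus> \<one>" "h \<iota> \<noteq> \<iota>" using p2(2) by blast
  have ord: "field_ordering L F (fixed_sqrts L F h)" using twist_free_ordering[OF p2(1) h(1) tw i] .
  have "s x = h x" if "x \<in> carrier L" "x \<otimes> x \<in> F" for x
    using F2U[of x] that square p2(1) h(2) by simp
  then have "fixed_sqrts L F s = fixed_sqrts L F h" unfolding fixed_sqrts_def by auto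
  then show ?thesis using p2(1) ord field_ordering_formally_real[OF F_subfield ord] by simp
qed

text \<open>By \<open>roots\<close> the layer \<open>U\<close> contains every \<beta> tested by
  \<open>twist_free\<close>, so triviality of the p-th power of s on \<open>U\<close> is
  enough.\<close>

lemma order_p_imp_ordering:
  assumes s: "s \<in> carrier Gal" "s \<notin> frattini Gal (krull_topology L F U)" "Gal.ord s = p"
    and roots: "\<And>\<alpha> \<beta>. \<alpha> \<in> carrier L \<Longrightarrow> \<alpha> [^] p \<in> F \<Longrightarrow> \<beta> \<in> carrier L \<Longrightarrow>
      \<beta> [^] p = \<alpha> \<or> (p = 2 \<and> \<beta> [^] p = \<one> \<oplus> \<alpha>) \<Longrightarrow> \<beta> \<in> U"
  shows "p = 2 \<and> formally_real L F \<and> field_ordering L F (fixed_sqrts L F s)"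
proof (rule twist_free_imp_ordering[OF s(1,2)])
  fix h assume h: "h \<in> hom_over L F" "s = restrict h U"
  have sp: "s [^]\<^bsub>Gal\<^esub> p = \<one>\<^bsub>Gal\<^esub>" using Gal.pow_ord_eq_1[OF s(1)] s(3) by simp
  have "(h ^^ p) x = x" if x: "x \<in> U" for x
  proof -
    have "(s ^^ p) x = x" using galois_group_pow[OF U(1) FU s(1) x, of p] sp x by (simp add: galois_group_one)
    then show ?thesis using funpow_restrict[OF U(4) h(1) x, of p] h(2) by simp
  qed
  then show "twist_free h" unfolding twist_free_def using roots by blast
qed

text \<open>The moved element \<iota> is a square root of -1, which lies in \<open>F\<close>; it
  witnesses both that the restriction is outside the Frattini subgroup and that it is
  nontrivial.\<close>

lemma involution_not_frattini:
  assumes p2: "p = 2" and h: "h \<in> hom_over L F" and i: "\<iota> \<in> carrier L" "\<iota> \<otimes> \<iota> = \<ominus> \<one>" "h \<iota> \<noteq> \<iota>"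
    and inv: "\<And>y. y \<in> F22 \<Longrightarrow> h (h y) = y"
  shows "restrict h U \<in> carrier Gal - frattini Gal (krull_topology L F U)" "Gal.ord (restrict h U) = p"
proof -
  let ?s = "restrict h U"
  have s: "?s \<in> carrier Gal" using Gal_restrict[OF h] .
  have iF: "\<iota> [^] p \<in> F" using i square p2 subfield_props(3,6)[OF F_subfield] by simp
  have iU: "\<iota> \<in> U" using F2_props(4)[OF i(1) iF] U(2) by blast
  then have si: "?s \<iota> \<noteq> \<iota>" using i(3) by simp
  then show "?s \<in> carrier Gal - frattini Gal (krull_topology L F U)"
    using s moves_square_root_not_frattini[OF p2 s i(1) iF] by blast
  have "?s [^]\<^bsub>Gal\<^esub> p = \<one>\<^bsub>Gal\<^esub>"
  proof (rule galois_group_ext)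
    fix x assume x: "x \<in> U"
    have "(?s ^^ p) x = x" using funpow_restrict[OF U(4) h x, of p] inv[of x] x U(3) p2
      by (auto simp: numeral_2_eq_2)
    then show "(?s [^]\<^bsub>Gal\<^esub> p) x = \<one>\<^bsub>Gal\<^esub> x"
      using galois_group_pow[OF U(1) FU s x] x by (simp add: galois_group_one)
  qed (use s in auto)
  moreover have "?s \<noteq> \<one>\<^bsub>Gal\<^esub>"
  proof
    assume "?s = \<one>\<^bsub>Gal\<^esub>"
    then have "?s \<iota> = \<iota>" using iU by (simp only: galois_group_one restrict_apply')
    then show False using si by blast
  qed
  ultimately show "Gal.ord ?s = p" using Gal.ord_eq_prime_iff[OF prime s] by blast
qed

end

section \<open>Application to the groups V, W and T\<close>

context kummer
begin

interpretation V: kummer_layer L F p \<zeta> F22 "{x \<in> carrier L. x [^] p \<in> F2}" by (rule layer_F22)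
interpretation W: kummer_layer L F p \<zeta> F3 third_roots by (rule layer_F3)

lemma V_group_eq: "V_group L p F = galois_group L F F22"
  and V_frattini_eq: "V_frattini L p F = frattini (galois_group L F F22) (krull_topology L F F22)"
  and W_group_eq: "W_group L p F = galois_group L F F3"
  and W_frattini_eq: "W_frattini L p F = frattini (galois_group L F F3) (krull_topology L F F3)"
  unfolding V_frattini_def W_frattini_def V_group_def W_group_def second_second_ext_F F3_def by simp_all

lemma V_order_p:
  assumes "s \<in> carrier (V_group L p F) - V_frattini L p F" "group.ord (V_group L p F) s = p"
  shows "p = 2 \<and> formally_real L F \<and> field_ordering L F (fixed_sqrts L F s)"
proof (rule V.order_p_imp_ordering)
  show "\<beta> \<in> F22" if a: "\<alpha> \<in> carrier L" "\<alpha> [^] p \<in> F" and b: "\<beta> \<in> carrier L"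
    "\<beta> [^] p = \<alpha> \<or> (p = 2 \<and> \<beta> [^] p = \<one> \<oplus> \<alpha>)" for \<alpha> \<beta>
  proof -
    have "\<alpha> \<in> F2" using F2_props(4)[OF a] .
    then have "\<beta> [^] p \<in> F2" using b(2) subfield_props(3,4)[OF F2_props(1)] by auto
    then show ?thesis using F22_props(5)[OF b(1)] by blast
  qed
qed (use assms in \<open>auto simp: V_group_eq V_frattini_eq\<close>)

lemma W_order_p:
  assumes "s \<in> carrier (W_group L p F) - W_frattini L p F" "group.ord (W_group L p F) s = p"
  shows "p = 2 \<and> formally_real L F \<and> field_ordering L F (fixed_sqrts L F s)"
proof (rule W.order_p_imp_ordering)
  show "\<beta> \<in> F3" if a: "\<alpha> \<in> carrier L" "\<alpha> [^] p \<in> F" and b: "\<beta> \<in> carrier L"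
    "\<beta> [^] p = \<alpha> \<or> (p = 2 \<and> \<beta> [^] p = \<one> \<oplus> \<alpha>)" for \<alpha> \<beta>
    using b(2) root_of_root_in_F3[OF a b(1)] one_plus_root_in_F3[OF _ a b(1)] by blast
qed (use assms in \<open>auto simp: W_group_eq W_frattini_eq\<close>)

lemma V_bounded_order:
  assumes s: "s \<in> carrier (V_group L p F) - V_frattini L p F"
    and T: "\<And>E. E \<subseteq> sep \<Longrightarrow> cyclic_extension L p F E \<Longrightarrow>
      group.ord (T_group L p F E) (T_restrict L p F E s) \<in> {1..p}"
  shows "p = 2 \<and> formally_real L F \<and> field_ordering L F (fixed_sqrts L F s)"
proof (rule V.twist_free_imp_ordering)
  fix h assume h: "h \<in> hom_over L F" "s = restrict h F22"
  show "twist_free h"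
  proof (rule twist_free_if_bounded_order[OF h(1)])
    fix E assume E: "E \<subseteq> sep" "cyclic_extension L p F E"
    note K = second_ext_of_cyclic[OF E]
    have "restrict s (kum E) = restrict h (kum E)" unfolding h(2) using K(4) by (intro restrict_ext) auto
    then show "group.ord (galois_group L F (kum E)) (restrict h (kum E)) \<in> {1..p}"
      using T[OF E] unfolding T_group_def T_restrict_def K(1) by simp
  qed
qed (use s in \<open>auto simp: V_group_eq V_frattini_eq\<close>)

text \<open>One involution serves all groups: its square is the identity on \<open>F22\<close>,
  hence on \<open>F3\<close> and on the root adjunction of every cyclic E. In the T-groups it is
  enough that the order divides p.\<close>

lemma formally_real_imp_elements:
  assumes p2: "p = 2" and fr: "formally_real L F"
  shows "\<exists>s\<in>carrier (V_group L p F) - V_frattini L p F. group.ord (V_group L p F) s = p \<and>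
      (\<forall>E. E \<subseteq> sep \<and> cyclic_extension L p F E \<longrightarrow>
        group.ord (T_group L p F E) (T_restrict L p F E s) \<in> {1..p})"
    and "\<exists>s\<in>carrier (W_group L p F) - W_frattini L p F. group.ord (W_group L p F) s = p"
proof -
  obtain h \<iota> where h: "h \<in> hom_over L F" and i: "\<iota> \<in> carrier L" "\<iota> \<otimes> \<iota> = \<ominus> \<one>" "h \<iota> \<noteq> \<iota>"
    and inv: "\<And>y. y \<in> F22 \<Longrightarrow> h (h y) = y" using formally_real_involution[OF p2 fr] by blast
  show "\<exists>s\<in>carrier (W_group L p F) - W_frattini L p F. group.ord (W_group L p F) s = p"
    using W.involution_not_frattini[OF p2 h i inv] unfolding W_group_eq W_frattini_eq by blast
  have T: "group.ord (T_group L p F E) (T_restrict L p F E (restrict h F22)) \<in> {1..p}"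
    if E: "E \<subseteq> sep" "cyclic_extension L p F E" for E
  proof -
    note K = second_ext_of_cyclic[OF E]
    let ?\<tau> = "restrict h (kum E)"
    interpret T: group "galois_group L F (kum E)" using group_galois_group[OF K(2,5)] .
    have t: "?\<tau> \<in> carrier (galois_group L F (kum E))"
      using restrict_in_galois_group[OF F_subfield order.refl K(5,2,6) h] .
    have "?\<tau> [^]\<^bsub>galois_group L F (kum E)\<^esub> p = \<one>\<^bsub>galois_group L F (kum E)\<^esub>"
    proof (rule galois_group_ext)
      fix x assume x: "x \<in> kum E"
      have "(?\<tau> ^^ p) x = x" using funpow_restrict[OF K(6) h x, of p] inv[of x] x K(4) p2
        by (auto simp: numeral_2_eq_2)
      then show "(?\<tau> [^]\<^bsub>galois_group L F (kum E)\<^esub> p) x = \<one>\<^bsub>galois_group L F (kum E)\<^esub> x"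
        using galois_group_pow[OF K(2,5) t x] x by (simp add: galois_group_one)
    qed (use t in auto)
    then have d: "T.ord ?\<tau> dvd p" using T.pow_eq_id[OF t] by simp
    have "T.ord ?\<tau> \<in> {1..p}"
      using dvd_imp_le[OF d p_gt(2)] dvd_pos_nat[OF p_gt(2) d] by simp
    moreover have "restrict (restrict h F22) (kum E) = ?\<tau>" using K(4) by (intro restrict_ext) auto
    ultimately show ?thesis unfolding T_group_def T_restrict_def K(1) by simp
  qed
  show "\<exists>s\<in>carrier (V_group L p F) - V_frattini L p F. group.ord (V_group L p F) s = p \<and>
      (\<forall>E. E \<subseteq> sep \<and> cyclic_extension L p F E \<longrightarrow>
        group.ord (T_group L p F E) (T_restrict L p F E s) \<in> {1..p})"
    using V.involution_not_frattini[OF p2 h i inv] T unfolding V_group_eq V_frattini_eq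
    by (intro bexI[of _ "restrict h F22"]) auto
qed

end

text \<open>Each group condition is compared with the field condition, which yields all pairwise
  equivalences. For the converse direction a single element of the V-group satisfies both the order
  condition and the bounds in the T-groups.\<close>

theorem theoremA4:
  fixes L :: "('a, 'b) ring_scheme" and F :: "'a set" and p :: nat
  assumes "algebraic_closure L F"
    and "Factorial_Ring.prime p"
    and "\<exists>\<xi>\<in>F. \<xi> [^]\<^bsub>L\<^esub> p = \<one>\<^bsub>L\<^esub> \<and> (\<forall>k::nat. 0 < k \<and> k < p \<longrightarrow> \<xi> [^]\<^bsub>L\<^esub> k \<noteq> \<one>\<^bsub>L\<^esub>)"
  shows
    "((\<exists>\<sigma>\<in>carrier (V_group L p F) - V_frattini L p F. group.ord (V_group L p F) \<sigma> = p)
        \<longleftrightarrow> p = 2 \<and> formally_real L F) \<and>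
     ((\<exists>\<sigma>\<in>carrier (W_group L p F) - W_frattini L p F. group.ord (W_group L p F) \<sigma> = p)
        \<longleftrightarrow> p = 2 \<and> formally_real L F) \<and>
     ((\<exists>\<sigma>\<in>carrier (V_group L p F) - V_frattini L p F.
          \<forall>E. E \<subseteq> separable_closure L F \<and> cyclic_extension L p F E \<longrightarrow>
            group.ord (T_group L p F E) (T_restrict L p F E \<sigma>) \<in> {1..p})
        \<longleftrightarrow> p = 2 \<and> formally_real L F) \<and>
     (\<forall>\<sigma>\<in>carrier (V_group L p F) - V_frattini L p F.
        group.ord (V_group L p F) \<sigma> = p \<longrightarrow> field_ordering L F (fixed_sqrts L F \<sigma>)) \<and>
     (\<forall>\<sigma>\<in>carrier (W_group L p F) - W_frattini L p F.
        group.ord (W_group L p F) \<sigma> = p \<longrightarrow> field_ordering L F (fixed_sqrts L F \<sigma>)) \<and>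
     (\<forall>\<sigma>\<in>carrier (V_group L p F) - V_frattini L p F.
        (\<forall>E. E \<subseteq> separable_closure L F \<and> cyclic_extension L p F E \<longrightarrow>
            group.ord (T_group L p F E) (T_restrict L p F E \<sigma>) \<in> {1..p})
        \<longrightarrow> field_ordering L F (fixed_sqrts L F \<sigma>))"
proof -
  obtain \<xi> where \<xi>: "\<xi> \<in> F" "\<xi> [^]\<^bsub>L\<^esub> p = \<one>\<^bsub>L\<^esub>"
    "\<And>k::nat. 0 < k \<Longrightarrow> k < p \<Longrightarrow> \<xi> [^]\<^bsub>L\<^esub> k \<noteq> \<one>\<^bsub>L\<^esub>"
    using assms(3) by blast
  interpret kummer L F p \<xi>
    by (intro kummer.intro kummer_axioms.intro assms(1,2) \<xi>)
  let ?bounded = "\<lambda>s. \<forall>E. E \<subseteq> separable_closure L F \<and> cyclic_extension L p F E \<longrightarrow>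
            group.ord (T_group L p F E) (T_restrict L p F E s) \<in> {1..p}"
  let ?real = "\<lambda>s. p = 2 \<and> formally_real L F \<and> field_ordering L F (fixed_sqrts L F s)"
  have V: "\<forall>s\<in>carrier (V_group L p F) - V_frattini L p F. group.ord (V_group L p F) s = p \<longrightarrow> ?real s"
    by (intro ballI impI V_order_p)
  have W: "\<forall>s\<in>carrier (W_group L p F) - W_frattini L p F. group.ord (W_group L p F) s = p \<longrightarrow> ?real s"
    by (intro ballI impI W_order_p)
  have T: "\<forall>s\<in>carrier (V_group L p F) - V_frattini L p F. ?bounded s \<longrightarrow> ?real s"
  proof (intro ballI impI)
    fix s assume s: "s \<in> carrier (V_group L p F) - V_frattini L p F" and b: "?bounded s"
    show "?real s" by (rule V_bounded_order[OF s]) (use b in blast)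
  qed
  have ex: "(\<exists>s\<in>carrier (V_group L p F) - V_frattini L p F. group.ord (V_group L p F) s = p \<and> ?bounded s) \<and>
      (\<exists>s\<in>carrier (W_group L p F) - W_frattini L p F. group.ord (W_group L p F) s = p)"
    if "p = 2 \<and> formally_real L F"
    using formally_real_imp_elements that by blast
  show ?thesis
    by (intro conjI) (use V W T ex in meson)+
qed


end
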